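(* Let $H:\mathbb{R}\times\mathbb{R}^N\to[0,+\infty)$ be a continuous nonnegative function and let $L(x,t,\xi)=H(t,\xi)$ for every $(x,t,\xi)\in\Omega\times\mathbb{R}\times\mathbb{R}^N$. Assume that at least one of the two following assumptions is satisfied: (A) For every $t\in\mathbb{R}$, there exists $\zeta\in\mathbb{R}^N$ such that $$\forall \xi\in\mathbb{R}^N,\quad H(t,\xi)\geq H(t,0)+\langle\zeta,\xi\rangle.$$ (B) There exists $C\geq1$ such that for every $t\in\mathbb{R}$ and every $\xi\in\mathbb{R}^N$, one has $$H(t,-\xi)\leq C(H(t,\xi)+1).$$ Then $\mathcal L$ is $L^\infty(\Omega)$-regular at every $u\in\mathcal A$.
   Context: Let $N\ge 1$, let $\Omega\subset\mathbb{R}^N$ be a bounded open set, $1\leq p\leq N$, and $\varphi\in W^{1,p}(\mathbb{R}^N)\cap L^\infty(\mathbb{R}^N)$. $W^{1,p}_0(\Omega)$ is the closure in $W^{1,p}(\Omega)$ of the $C^1$ functions with compact support in $\Omega$, and $W^{1,p}_\varphi(\Omega)=\varphi+W^{1,p}_0(\Omega)$. Given $L:\Omega\times\mathbb{R}\times\mathbb{R}^N\to\mathbb{R}$, set $\mathcal L(u)=\int_\Omega L(x,u(x),\nabla u(x))\,dx$, and let $\mathcal A=\{u\in W^{1,p}_\varphi(\Omega): L(x,u,\nabla u)\in L^1(\Omega)\}$. The functional $\mathcal L$ is said to be $L^\infty(\Omega)$-regular at $u\in\mathcal A$ if there exists a sequence $(u_k)_{k\ge1}\subset\mathcal A\cap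 L^\infty(\Omega)$ such that $u_k\to u$ in $W^{1,p}(\Omega)$ and $L(x,u_k,\nabla u_k)\to L(x,u,\nabla u)$ in $L^1(\Omega)$. *)

theory Defs
  imports "HOL-Analysis.Analysis"
begin

text \<open>
  Elements of the function spaces are represented by functions on the whole space; only their
  values on \<open>\<Omega>\<close>, and these only up to Lebesgue-null sets, matter.
\<close>

definition Lp_space :: "real \<Rightarrow> 'a::euclidean_space set \<Rightarrow> ('a \<Rightarrow> 'b::euclidean_space) set" where
  "Lp_space p \<Omega> = {f \<in> borel_measurable (lebesgue_on \<Omega>).
     integrable (lebesgue_on \<Omega>) (\<lambda>x. norm (f x) powr p)}"

definition Lp_norm :: "real \<Rightarrow> 'a::euclidean_space set \<Rightarrow> ('a \<Rightarrow> 'b::euclidean_space) \<Rightarrow> real" where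
  "Lp_norm p \<Omega> f = (\<integral>x. norm (f x) powr p \<partial>lebesgue_on \<Omega>) powr (1 / p)"

definition Linf_space :: "'a::euclidean_space set \<Rightarrow> ('a \<Rightarrow> real) set" where
  "Linf_space \<Omega> = {f \<in> borel_measurable (lebesgue_on \<Omega>).
     \<exists>M. AE x in lebesgue_on \<Omega>. \<bar>f x\<bar> \<le> M}"

definition locally_integrable :: "'a::euclidean_space set \<Rightarrow> ('a \<Rightarrow> 'b::euclidean_space) \<Rightarrow> bool" where
  "locally_integrable \<Omega> f \<longleftrightarrow>
     (\<forall>K. compact K \<and> K \<subseteq> \<Omega> \<longrightarrow> integrable (lebesgue_on K) f)"

definition partial_derivative :: "'a::euclidean_space \<Rightarrow> ('a \<Rightarrow> real) \<Rightarrow> 'a \<Rightarrow> real" where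
  "partial_derivative b f x = frechet_derivative f (at x) b"

text \<open>
  The \<open>C\<^sup>1\<close> functions with compact support in the open set \<open>\<Omega>\<close>, extended by zero to the whole space.
\<close>

definition C1_compact :: "'a::euclidean_space set \<Rightarrow> ('a \<Rightarrow> real) set" where
  "C1_compact \<Omega> = {\<psi>.
     (\<forall>x. \<psi> differentiable at x) \<and>
     (\<forall>b\<in>Basis. continuous_on UNIV (partial_derivative b \<psi>)) \<and>
     compact (closure {x. \<psi> x \<noteq> 0}) \<and> closure {x. \<psi> x \<noteq> 0} \<subseteq> \<Omega>}"

text \<open>
  Test functions for first-order weak derivatives are taken in \<open>C\<^sup>1\<close> with compact support, as in
  Gilbarg--Trudinger and Evans--Gariepy.
\<close>

definition has_weak_gradient ::
    "'a::euclidean_space set \<Rightarrow> ('a \<Rightarrow> real) \<Rightarrow> ('a \<Rightarrow> 'a) \<Rightarrow> bool" where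
  "has_weak_gradient \<Omega> u g \<longleftrightarrow>
     locally_integrable \<Omega> u \<and> locally_integrable \<Omega> g \<and>
     (\<forall>\<psi>\<in>C1_compact \<Omega>. \<forall>b\<in>Basis.
        (\<integral>x. u x * partial_derivative b \<psi> x \<partial>lebesgue_on \<Omega>) =
        - (\<integral>x. (g x \<bullet> b) * \<psi> x \<partial>lebesgue_on \<Omega>))"

text \<open>
  On an open set the weak gradient is unique up to null sets, so the choice of a representative
  is immaterial below.
\<close>

definition weak_gradient :: "'a::euclidean_space set \<Rightarrow> ('a \<Rightarrow> real) \<Rightarrow> 'a \<Rightarrow> 'a" where
  "weak_gradient \<Omega> u = (SOME g. has_weak_gradient \<Omega> u g)"

definition W1p_space :: "real \<Rightarrow> 'a::euclidean_space set \<Rightarrow> ('a \<Rightarrow> real) set" where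
  "W1p_space p \<Omega> = {u \<in> Lp_space p \<Omega>. \<exists>g\<in>Lp_space p \<Omega>. has_weak_gradient \<Omega> u g}"

definition W1p_norm :: "real \<Rightarrow> 'a::euclidean_space set \<Rightarrow> ('a \<Rightarrow> real) \<Rightarrow> real" where
  "W1p_norm p \<Omega> u = Lp_norm p \<Omega> u + Lp_norm p \<Omega> (weak_gradient \<Omega> u)"

definition W1p0_space :: "real \<Rightarrow> 'a::euclidean_space set \<Rightarrow> ('a \<Rightarrow> real) set" where
  "W1p0_space p \<Omega> = {u \<in> W1p_space p \<Omega>.
     \<forall>\<epsilon>>0. \<exists>\<psi>\<in>C1_compact \<Omega>. W1p_norm p \<Omega> (\<lambda>x. u x - \<psi> x) < \<epsilon>}"

definition W1p_affine_space ::
    "real \<Rightarrow> 'a::euclidean_space set \<Rightarrow> ('a \<Rightarrow> real) \<Rightarrow> ('a \<Rightarrow> real) set" where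
  "W1p_affine_space p \<Omega> \<phi> = {\<lambda>x. \<phi> x + v x | v. v \<in> W1p0_space p \<Omega>}"

definition integrand ::
    "('a::euclidean_space \<Rightarrow> real \<Rightarrow> 'a \<Rightarrow> real) \<Rightarrow> 'a set \<Rightarrow> ('a \<Rightarrow> real) \<Rightarrow> 'a \<Rightarrow> real" where
  "integrand L \<Omega> u x = L x (u x) (weak_gradient \<Omega> u x)"

definition admissible ::
    "real \<Rightarrow> 'a::euclidean_space set \<Rightarrow> ('a \<Rightarrow> real) \<Rightarrow> ('a \<Rightarrow> real \<Rightarrow> 'a \<Rightarrow> real)
      \<Rightarrow> ('a \<Rightarrow> real) set" where
  "admissible p \<Omega> \<phi> L =
     {u \<in> W1p_affine_space p \<Omega> \<phi>. integrable (lebesgue_on \<Omega>) (integrand L \<Omega> u)}"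

text \<open>
  Regularity of the functional \<open>u \<mapsto> \<integral>\<^sub>\<Omega> L(x, u, \<nabla>u) dx\<close>; the notion depends on the
  integrand \<open>L\<close> itself and not only on the values of the functional.
\<close>

definition Linf_regular_at ::
    "real \<Rightarrow> 'a::euclidean_space set \<Rightarrow> ('a \<Rightarrow> real) \<Rightarrow> ('a \<Rightarrow> real \<Rightarrow> 'a \<Rightarrow> real)
      \<Rightarrow> ('a \<Rightarrow> real) \<Rightarrow> bool" where
  "Linf_regular_at p \<Omega> \<phi> L u \<longleftrightarrow>
     (\<exists>v :: nat \<Rightarrow> 'a \<Rightarrow> real.
        (\<forall>k. v k \<in> admissible p \<Omega> \<phi> L \<inter> Linf_space \<Omega>) \<and>
        (\<lambda>k. W1p_norm p \<Omega> (\<lambda>x. v k x - u x)) \<longlonglongrightarrow> 0 \<and>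
        (\<lambda>k. Lp_norm 1 \<Omega> (\<lambda>x. integrand L \<Omega> (v k) x - integrand L \<Omega> u x)) \<longlonglongrightarrow> 0)"

end

theory Submission
  imports Defs
begin

text \<open>
  An admissible \<open>u\<close> is replaced by \<open>v = min u (t + z)\<close>, where \<open>t\<close> is a high level and \<open>z \<ge> 0\<close> a
  triangular wave of tiny amplitude with \<open>\<nabla>z = \<plusminus>\<xi>\<close> almost everywhere; then \<open>v\<close> differs from \<open>u\<close>
  only on \<open>{u > t}\<close>, where the energy density is at most about \<open>H(t, \<xi>) + H(t, -\<xi>)\<close>.  Choosing
  \<open>(t, \<xi>)\<close> as an almost minimiser of \<open>H(t, \<xi>) + |\<xi>|\<^sup>p\<close> over \<open>t \<ge> n\<close> bounds this by the energy
  density of \<open>u\<close> on \<open>{u > n}\<close>, up to the constant of (B).  Under (A) one takes \<open>\<xi> = 0\<close> (plain truncation)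
  and almost minimises \<open>H(t, 0)\<close>: since \<open>\<integral> \<nabla>u\<close> vanishes over \<open>{u \<in> B}\<close> for all Borel sets \<open>B\<close> above the
  boundary values, the subgradient inequality, made uniform on countably many Borel pieces of the range
  of \<open>u\<close>, shows that \<open>H(u, 0)\<close> is integrable on \<open>{u > n}\<close>.  Truncation from below is the mirror image under
  \<open>u \<mapsto> -u\<close>, \<open>H(t, \<xi>) \<mapsto> H(-t, -\<xi>)\<close>.

  All Sobolev calculus is done on pairs \<open>(f, g)\<close> that are limits in \<open>L\<^sup>p\<close> of \<open>(\<psi>, \<nabla>\<psi>)\<close> with \<open>\<psi>\<close> of class \<open>C\<^sup>1\<close>;
  mollification brings \<open>\<phi>\<close> into this class without increasing its upper bound.
\<close>

section \<open>Translations in \<open>L\<^sup>p\<close>\<close>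

text \<open>Plain truncation pays \<open>H t 0\<close>, and without convexity the energy of
  \<open>u\<close> gives no hold on that number. Under (B) the cap therefore takes a slope
  \<open>\<xi>\<close> at which \<open>H\<close> is cheap. A cap with this slope that stays in a
  thin strip has to turn back, so both signs occur and (B) must compare them; the term
  \<open>norm \<xi> powr p\<close> in the minimisation keeps the gradients of the caps small in L^p.
  For the energy estimate continuity of \<open>H\<close> enters only at one level and two slopes,
  since the amplitude is chosen last. Under (A) the subgradient may depend on \<open>t\<close>
  without any bound and without measurability. Once it is constant on each of countably many pieces,
  the zero mean of the gradient removes it piece by piece, whatever its size. A formal obstacle is
  that \<open>weak_gradient\<close> is an arbitrary choice: gradients are carried along as explicit
  witnesses, and uniqueness is invoked only at the interface with the given norms and
  integrands.\<close>

lemma powr_add_le: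
  fixes a b p :: real
  assumes "0 \<le> a" "0 \<le> b" "0 \<le> p"
  shows "(a + b) powr p \<le> 2 powr p * (a powr p + b powr p)"
proof -
  have "(a + b) powr p \<le> (2 * max a b) powr p"
    by (intro powr_mono2) (use assms in auto)
  also have "\<dots> = 2 powr p * max a b powr p"
    using assms by (simp add: powr_mult)
  also have "\<dots> \<le> 2 powr p * (a powr p + b powr p)"
    by (intro mult_left_mono) (auto simp: max_def)
  finally show ?thesis .
qed

lemma le_1_add_powr:
  fixes s p :: real
  assumes "0 \<le> s" "1 \<le> p"
  shows "s \<le> 1 + s powr p"
proof (cases "s \<le> 1")
  case True
  then show ?thesis by (simp add: add_increasing2)
next
  case False
  then have "s powr 1 \<le> s powr p"
    using assms by (intro powr_mono) auto
  then show ?thesis using assms by simp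
qed

text \<open>Rescaling of \<open>s \<le> 1 + s powr p\<close>. On a set of finite measure the
  constant part can be made small first, after which the power part is an L^p error; this does the
  work of Hoelder's inequality in \<open>Lpd_imp_L1\<close>.\<close>

lemma le_small_add_powr:
  fixes s p d :: real
  assumes "0 \<le> s" "1 \<le> p" "0 < d"
  shows "s \<le> d + d powr (1 - p) * s powr p"
proof -
  have "s / d \<le> 1 + (s / d) powr p"
    using assms by (intro le_1_add_powr) auto
  then have "s \<le> d * (1 + (s / d) powr p)"
    using assms by (simp add: field_simps)
  also have "\<dots> = d + d powr (1 - p) * s powr p"
    using assms by (simp add: algebra_simps powr_divide powr_diff)
  finally show ?thesis .
qed

lemma nn_integral_lborel_translate:
  fixes f :: "'a::euclidean_space \<Rightarrow> ennreal"
  assumes [measurable]: "f \<in> borel_measurable borel"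
  shows "(\<integral>\<^sup>+x. f (x - y) \<partial>lborel) = (\<integral>\<^sup>+x. f x \<partial>lborel)"
proof -
  have "(\<integral>\<^sup>+x. f x \<partial>lborel) = (\<integral>\<^sup>+x. f x \<partial>distr lborel borel ((+) (- y)))"
    by (simp add: lborel_distr_plus)
  also have "\<dots> = (\<integral>\<^sup>+x. f (- y + x) \<partial>lborel)"
    by (subst nn_integral_distr) auto
  finally show ?thesis by simp
qed

text \<open>No root is taken and the value may be infinite:
  \<open>Lp_mass p M f < \<infinity>\<close> expresses membership in L^p for measurable
  \<open>f\<close>, and no integrability has to be carried along.\<close>

abbreviation Lp_mass :: "real \<Rightarrow> 'a measure \<Rightarrow> ('a \<Rightarrow> 'b::real_normed_vector) \<Rightarrow> ennreal" where
  "Lp_mass p M f \<equiv> \<integral>\<^sup>+x. ennreal (norm (f x) powr p) \<partial>M"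

text \<open>Takes the place of Minkowski's inequality. The factor \<open>2 powr p\<close> is
  harmless since only smallness is ever at stake.\<close>

lemma nn_integral_norm_add_powr_le:
  fixes f g :: "'a \<Rightarrow> 'b::euclidean_space"
  assumes [measurable]: "f \<in> borel_measurable M" "g \<in> borel_measurable M" and "0 \<le> p"
  shows "Lp_mass p M (\<lambda>x. f x + g x)
    \<le> ennreal (2 powr p) * (Lp_mass p M f
        + Lp_mass p M g)"
proof -
  have "norm (f x + g x) powr p \<le> 2 powr p * (norm (f x) powr p + norm (g x) powr p)" for x
    using powr_mono2[OF assms(3) norm_ge_zero norm_triangle_ineq[of "f x" "g x"]]
      powr_add_le[OF norm_ge_zero norm_ge_zero assms(3), of "f x" "g x"] by linarith
  then have "Lp_mass p M (\<lambda>x. f x + g x)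
    \<le> (\<integral>\<^sup>+x. ennreal (2 powr p) * (ennreal (norm (f x) powr p) + ennreal (norm (g x) powr p)) \<partial>M)"
    by (intro nn_integral_mono) (auto simp flip: ennreal_plus ennreal_mult'' intro!: ennreal_leI)
  also have "\<dots> = ennreal (2 powr p) * (Lp_mass p M f
        + Lp_mass p M g)"
    by (subst nn_integral_cmult) (auto simp: nn_integral_add)
  finally show ?thesis .
qed

text \<open>Squeeze \<open>A\<close> between a compact \<open>K\<close> and an open \<open>U\<close>
  with \<open>U - K\<close> of small measure. A shift shorter than the distance from
  \<open>K\<close> to the complement of \<open>U\<close> moves \<open>K\<close> inside
  \<open>U\<close>, so the two indicators can differ only on \<open>U - K\<close> and on its
  translate.\<close>

lemma continuous_translation_indicator:
  fixes A :: "'a::euclidean_space set"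
  assumes A[measurable]: "A \<in> sets lborel" and fin: "emeasure lborel A < \<infinity>" and e: "0 < e"
  shows "\<exists>d>0. \<forall>y. norm y < d \<longrightarrow>
    (\<integral>\<^sup>+x. ennreal \<bar>indicator A (x - y) - indicator A x\<bar> \<partial>lborel) < ennreal e"
proof -
  obtain U where U: "open U" "A \<subseteq> U" "emeasure lebesgue (U - A) < ennreal (e/8)"
    using sets_lebesgue_outer_open[of A "e/8"] A e by (metis divide_pos_pos sets_completionI_sets zero_less_numeral)
  obtain C where C: "closed C" "C \<subseteq> A" "emeasure lebesgue (A - C) < ennreal (e/8)"
    using sets_lebesgue_inner_closed[of A "e/8"] A e by (metis divide_pos_pos sets_completionI_sets zero_less_numeral)
  have "(\<lambda>n::nat. emeasure lborel (A - cball 0 n)) \<longlonglongrightarrow> emeasure lborel (\<Inter>n::nat. A - cball 0 n)"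
  proof (rule Lim_emeasure_decseq)
    show "decseq (\<lambda>n::nat. A - cball 0 n)"
      by (auto simp: decseq_def)
    show "emeasure lborel (A - cball 0 (real n)) \<noteq> \<infinity>" for n
      using order.strict_trans1[OF emeasure_mono[of "A - cball 0 (real n)" A lborel] fin] A by auto
    show "range (\<lambda>n::nat. A - cball 0 n) \<subseteq> sets lborel"
      using A by (auto intro!: sets.Diff)
  qed
  also have "(\<Inter>n::nat. A - cball 0 n) = {}"
    using real_arch_simple by (auto simp: not_le)
  finally have "(\<lambda>n::nat. emeasure lborel (A - cball 0 n)) \<longlonglongrightarrow> 0" by simp
  then have "eventually (\<lambda>n. emeasure lborel (A - cball 0 (real n)) < ennreal (e/8)) sequentially"
    using e by (intro order_tendstoD) auto
  then obtain n where n: "emeasure lborel (A - cball 0 (real n)) < ennreal (e/8)"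
    by (auto simp: eventually_sequentially)
  \<comment> \<open>A closed set inside \<open>A\<close> need not be compact; a ball outside which
    \<open>A\<close> has measure below \<open>e/8\<close> repairs this. The three losses add up to
    \<open>3*e/8\<close>, and twice that is still below \<open>e\<close>.\<close>
  define K where "K = C \<inter> cball 0 (real n)"
  have K: "compact K" "K \<subseteq> A"
    using C by (auto simp: K_def closed_Int_compact)
  have [measurable]: "U \<in> sets borel" "K \<in> sets borel" "C \<in> sets borel"
    using U C K by (auto intro: borel_compact)
  have [measurable]: "A \<in> sets borel" using A by simp
  have "emeasure lborel (U - K) \<le> emeasure lborel ((U - A) \<union> ((A - C) \<union> (A - cball 0 (real n))))"
    by (intro emeasure_mono) (auto simp: K_def)
  also have "\<dots> \<le> emeasure lborel (U - A) + (emeasure lborel (A - C) + emeasure lborel (A - cball 0 (real n)))"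
    by (intro order.trans[OF emeasure_subadditive] add_left_mono) (auto intro: emeasure_subadditive)
  also have "\<dots> \<le> ennreal (e/8) + (ennreal (e/8) + ennreal (e/8))"
    using U(3) C(3) n by (intro add_mono) auto
  also have "\<dots> = ennreal (3*e/8)" using e by (simp flip: ennreal_plus)
  finally have UK: "emeasure lborel (U - K) \<le> ennreal (3*e/8)" .
  obtain d where d: "0 < d" "\<And>x y. x \<in> K \<Longrightarrow> y \<in> - U \<Longrightarrow> d \<le> dist x y"
  proof -
    have "K \<inter> - U = {}" using K U by auto
    then have "\<exists>d>0. \<forall>x\<in>K. \<forall>y\<in>- U. d \<le> dist x y"
      using K U by (intro separate_compact_closed) auto
    then show thesis using that by blast
  qed
  show ?thesis
  proof (intro exI[of _ d] conjI allI impI)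
    fix y :: 'a assume y: "norm y < d"
    have "\<bar>indicator A (x - y) - indicator A x\<bar> \<le> indicator (U - K) (x - y) + (indicator (U - K) x :: real)" for x
    proof -
      have "x - y \<in> K \<Longrightarrow> x \<in> U" "x \<in> K \<Longrightarrow> x - y \<in> U"
        using d(2)[of "x - y" x] d(2)[of x "x - y"] y by (force simp: dist_norm)+
      then show ?thesis
        using U(2) K(2) by (auto simp: indicator_def)
    qed
    then have "(\<integral>\<^sup>+x. ennreal \<bar>indicator A (x - y) - indicator A x\<bar> \<partial>lborel)
       \<le> (\<integral>\<^sup>+x. indicator (U - K) (x - y) + indicator (U - K) x \<partial>lborel)"
      by (intro nn_integral_mono) (simp add: ennreal_leI flip: ennreal_plus ennreal_indicator)
    also have "\<dots> = emeasure lborel (U - K) + emeasure lborel (U - K)"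
      by (subst nn_integral_add) (auto simp: nn_integral_lborel_translate[where f="indicator (U - K)"])
    also have "\<dots> \<le> ennreal (3*e/8) + ennreal (3*e/8)"
      using UK by (intro add_mono)
    also have "\<dots> < ennreal e" using e by (simp flip: ennreal_plus add: ennreal_less_iff)
    finally show "(\<integral>\<^sup>+x. ennreal \<bar>indicator A (x - y) - indicator A x\<bar> \<partial>lborel) < ennreal e" .
  qed (rule d)
qed

text \<open>Indicators, sums and limits exhaust the integrable functions. In the limit case the
  error of the approximant occurs twice, once shifted, and translation invariance of the integral
  removes the shift.\<close>

lemma continuous_translation_L1:
  fixes f :: "'a::euclidean_space \<Rightarrow> 'b::euclidean_space"
  assumes f: "integrable lborel f" and e: "0 < e"
  shows "\<exists>d>0. \<forall>y. norm y < d \<longrightarrow>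
    (\<integral>\<^sup>+x. ennreal (norm (f (x - y) - f x)) \<partial>lborel) < ennreal e"
  using f e
proof (induction f arbitrary: e rule: integrable_induct)
  case (base A c)
  obtain d where d: "d > 0" and *: "\<And>y. norm y < d \<Longrightarrow>
    (\<integral>\<^sup>+x. ennreal \<bar>indicator A (x - y) - indicator A x\<bar> \<partial>lborel) < ennreal (e / (norm c + 1))"
    using continuous_translation_indicator[of A "e / (norm c + 1)"] base
    by (meson add_nonneg_pos divide_pos_pos norm_ge_zero zero_less_one)
  have [measurable]: "A \<in> sets borel" using base by simp
  show ?case
  proof (intro exI[of _ d] conjI allI impI d)
    fix y :: 'a assume "norm y < d"
    have "(\<integral>\<^sup>+x. ennreal (norm (indicator A (x - y) *\<^sub>R c - indicator A x *\<^sub>R c)) \<partial>lborel)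
      = (\<integral>\<^sup>+x. ennreal (norm c) * ennreal \<bar>indicator A (x - y) - indicator A x\<bar> \<partial>lborel)"
      by (intro nn_integral_cong) (simp add: mult.commute flip: ennreal_mult scaleR_diff_left)
    also have "\<dots> = ennreal (norm c) * (\<integral>\<^sup>+x. ennreal \<bar>indicator A (x - y) - indicator A x\<bar> \<partial>lborel)"
      by (rule nn_integral_cmult) measurable
    also have "\<dots> \<le> ennreal (norm c) * ennreal (e / (norm c + 1))"
      using *[OF \<open>norm y < d\<close>] by (intro mult_left_mono) auto
    also have "\<dots> < ennreal e"
    proof -
      have "norm c * (e / (norm c + 1)) < (norm c + 1) * (e / (norm c + 1))"
        using base(3) by (intro mult_strict_right_mono) (auto simp: add_nonneg_pos)
      also have "\<dots> = e" by (simp add: add_nonneg_pos order_less_imp_not_eq2)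
      finally show ?thesis using base(3) by (simp add: ennreal_less_iff flip: ennreal_mult)
    qed
    finally show "(\<integral>\<^sup>+x. ennreal (norm (indicator A (x - y) *\<^sub>R c - indicator A x *\<^sub>R c)) \<partial>lborel) < ennreal e" .
  qed
next
  case (add f g)
  have [measurable]: "f \<in> borel_measurable borel" "g \<in> borel_measurable borel"
    using add(1,2) by auto
  obtain d1 where d1: "d1 > 0" "\<And>y. norm y < d1 \<Longrightarrow> (\<integral>\<^sup>+x. ennreal (norm (f (x - y) - f x)) \<partial>lborel) < ennreal (e / 2)"
    using add(3)[of "e/2"] add(5) by auto
  obtain d2 where d2: "d2 > 0" "\<And>y. norm y < d2 \<Longrightarrow> (\<integral>\<^sup>+x. ennreal (norm (g (x - y) - g x)) \<partial>lborel) < ennreal (e / 2)"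
    using add(4)[of "e/2"] add(5) by auto
  show ?case
  proof (intro exI[of _ "min d1 d2"] conjI allI impI)
    fix y :: 'a assume y: "norm y < min d1 d2"
    have "(\<integral>\<^sup>+x. ennreal (norm (f (x - y) + g (x - y) - (f x + g x))) \<partial>lborel)
      \<le> (\<integral>\<^sup>+x. ennreal (norm (f (x - y) - f x)) + ennreal (norm (g (x - y) - g x)) \<partial>lborel)"
      by (intro nn_integral_mono) (simp add: add_diff_add norm_triangle_ineq flip: ennreal_plus)
    also have "\<dots> = (\<integral>\<^sup>+x. ennreal (norm (f (x - y) - f x)) \<partial>lborel) + (\<integral>\<^sup>+x. ennreal (norm (g (x - y) - g x)) \<partial>lborel)"
      by (rule nn_integral_add) measurable
    also have "\<dots> < ennreal (e / 2) + ennreal (e / 2)"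
      using d1(2)[of y] d2(2)[of y] y by (intro add_strict_mono) auto
    also have "\<dots> = ennreal e" using add(5) by (simp flip: ennreal_plus)
    finally show "(\<integral>\<^sup>+x. ennreal (norm (f (x - y) + g (x - y) - (f x + g x))) \<partial>lborel) < ennreal e" .
  qed (use d1 d2 in auto)
next
  case (lim f s)
  have [measurable]: "f \<in> borel_measurable borel" "\<And>i. s i \<in> borel_measurable borel"
    using lim(1,4) by auto
  have "(\<lambda>i. \<integral>\<^sup>+x. norm (f x - s i x) \<partial>lborel) \<longlonglongrightarrow> 0"
  proof (rule nn_integral_dominated_convergence_norm[where w="\<lambda>x. 2 * norm (f x)"])
    have "integrable lborel (\<lambda>x. 2 * norm (f x))" using lim(4) by simp
    then show "(\<integral>\<^sup>+x. ennreal (2 * norm (f x)) \<partial>lborel) < \<infinity>"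
      unfolding integrable_iff_bounded by simp
  qed (use lim(2,3) in auto)
  then have "eventually (\<lambda>i. (\<integral>\<^sup>+x. norm (s i x - f x) \<partial>lborel) < ennreal (e / 4)) sequentially"
    using lim(6) by (intro order_tendstoD) (auto simp: norm_minus_commute)
  then obtain i where i: "(\<integral>\<^sup>+x. norm (s i x - f x) \<partial>lborel) < ennreal (e / 4)"
    by (auto simp: eventually_sequentially)
  obtain d where d: "d > 0" "\<And>y. norm y < d \<Longrightarrow> (\<integral>\<^sup>+x. ennreal (norm (s i (x - y) - s i x)) \<partial>lborel) < ennreal (e / 4)"
    using lim(5)[of "e/4" i] lim(6) by auto
  show ?case
  proof (intro exI[of _ d] conjI allI impI d)
    fix y :: 'a assume y: "norm y < d"
    have tri: "norm (f (x - y) - f x) \<le> norm (s i (x - y) - f (x - y)) + (norm (s i (x - y) - s i x) + norm (s i x - f x))" for x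
      by norm
    have "(\<integral>\<^sup>+x. ennreal (norm (f (x - y) - f x)) \<partial>lborel)
      \<le> (\<integral>\<^sup>+x. ennreal (norm (s i (x - y) - f (x - y))) + (ennreal (norm (s i (x - y) - s i x)) + ennreal (norm (s i x - f x))) \<partial>lborel)"
      using tri by (intro nn_integral_mono) (simp add: ennreal_leI flip: ennreal_plus)
    also have "\<dots> = (\<integral>\<^sup>+x. ennreal (norm (s i (x - y) - f (x - y))) \<partial>lborel)
       + ((\<integral>\<^sup>+x. ennreal (norm (s i (x - y) - s i x)) \<partial>lborel) + (\<integral>\<^sup>+x. ennreal (norm (s i x - f x)) \<partial>lborel))"
      by (subst nn_integral_add, (measurable)[2], subst nn_integral_add, (measurable)[2], rule refl)
    also have "(\<integral>\<^sup>+x. ennreal (norm (s i (x - y) - f (x - y))) \<partial>lborel) = (\<integral>\<^sup>+x. norm (s i x - f x) \<partial>lborel)"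
      by (rule nn_integral_lborel_translate[where f="\<lambda>x. ennreal (norm (s i x - f x))"]) measurable
    also have "(\<integral>\<^sup>+x. norm (s i x - f x) \<partial>lborel) + ((\<integral>\<^sup>+x. ennreal (norm (s i (x - y) - s i x)) \<partial>lborel) + (\<integral>\<^sup>+x. norm (s i x - f x) \<partial>lborel))
      \<le> ennreal (e / 4) + (ennreal (e / 4) + ennreal (e / 4))"
      using i d(2)[OF y] by (intro add_mono) auto
    also have "\<dots> < ennreal e" using lim(6) by (simp flip: ennreal_plus add: ennreal_less_iff)
    finally show "(\<integral>\<^sup>+x. ennreal (norm (f (x - y) - f x)) \<partial>lborel) < ennreal e" .
  qed
qed


text \<open>Very large and very small values of \<open>f\<close> are cut away at a small L^p cost.
  For the remaining \<open>h\<close> the upper cut makes the p-th power of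
  \<open>norm (h (x - y) - h x)\<close> at most a multiple of its first power, and the lower cut
  makes \<open>h\<close> integrable, being bounded by a multiple of
  \<open>norm (f x) powr p\<close>; so the L^1 case applies.\<close>

lemma continuous_translation_Lp:
  fixes f :: "'a::euclidean_space \<Rightarrow> 'b::euclidean_space"
  assumes [measurable]: "f \<in> borel_measurable borel" and p: "1 \<le> p"
    and f: "Lp_mass p lborel f < \<infinity>" and e: "0 < e"
  shows "\<exists>d>0. \<forall>y. norm y < d \<longrightarrow>
    Lp_mass p lborel (\<lambda>x. f (x - y) - f x) < ennreal e"
proof -
  define c where "c = 2 powr p"
  have c: "c > 0" by (simp add: c_def)
  \<comment> \<open>Two uses of the inequality with factor \<open>c\<close> turn three errors
    \<open>e1\<close> into \<open>c * (e1 + c * (e1 + e1))\<close>, which this choice keeps below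
    \<open>e\<close>.\<close>
  define e1 where "e1 = e / (4 * c * (c + 1))"
  have e1: "e1 > 0" using e c by (simp add: e1_def)
  define A where "A n = {x. 1 / real (Suc n) \<le> norm (f x) \<and> norm (f x) \<le> real (Suc n)}" for n
  define g where "g n x = indicator (A n) x *\<^sub>R f x" for n x
  have A[measurable]: "A n \<in> sets borel" for n unfolding A_def by measurable
  have g[measurable]: "g n \<in> borel_measurable borel" for n unfolding g_def by measurable
  have int_f: "integrable lborel (\<lambda>x. norm (f x) powr p)"
    using f by (intro integrableI_bounded) auto
  have "(\<lambda>n. \<integral>\<^sup>+x. norm (f x - g n x) powr p \<partial>lborel) \<longlonglongrightarrow> (\<integral>\<^sup>+x. 0 \<partial>(lborel :: 'a measure))"
  proof (rule nn_integral_dominated_convergence[where w="\<lambda>x. ennreal (norm (f x) powr p)"])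
    show "AE x in lborel. (\<lambda>n. ennreal (norm (f x - g n x) powr p)) \<longlonglongrightarrow> 0"
    proof (rule AE_I2)
      fix x
      have "eventually (\<lambda>n. f x = g n x) sequentially"
      proof (cases "f x = 0")
        case False
        then obtain N where N: "inverse (norm (f x)) < real N" using reals_Archimedean2 by blast
        obtain N2 where N2: "norm (f x) < real N2" using reals_Archimedean2 by blast
        have "x \<in> A n" if "n \<ge> max N N2" for n
        proof -
          have "1 / norm (f x) \<le> real (Suc n)" "norm (f x) \<le> real (Suc n)"
            using N N2 that by (auto simp: divide_inverse)
          then show ?thesis using False by (simp add: A_def field_simps)
        qed
        then have "f x = g n x" if "n \<ge> max N N2" for n using that by (simp add: g_def)
        then show ?thesis unfolding eventually_sequentially by blast
      qed (simp add: g_def)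
      then show "(\<lambda>n. ennreal (norm (f x - g n x) powr p)) \<longlonglongrightarrow> 0"
        by (intro tendsto_eventually) (auto elim!: eventually_mono)
    qed
    show "AE x in lborel. ennreal (norm (f x - g n x) powr p) \<le> ennreal (norm (f x) powr p)" for n
      by (auto simp: g_def indicator_def)
  qed (use f in auto)
  then have "eventually (\<lambda>n. Lp_mass p lborel (\<lambda>x. f x - g n x) < ennreal e1) sequentially"
    using e1 by (intro order_tendstoD) auto
  then obtain n where n: "Lp_mass p lborel (\<lambda>x. f x - g n x) < ennreal e1"
    by (auto simp: eventually_sequentially)
  define h where "h = g n"
  define b where "b = real (Suc n)"
  have b: "b > 0" by (simp add: b_def)
  have [measurable]: "h \<in> borel_measurable borel" by (simp add: h_def)
  have hb: "norm (h x) \<le> b" for x by (auto simp: h_def g_def b_def A_def indicator_def)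
  have "integrable lborel h"
  proof (rule Bochner_Integration.integrable_bound)
    show "integrable lborel (\<lambda>x. b powr (p - 1) * norm (f x) powr p)" using int_f by simp
    show "AE x in lborel. norm (h x) \<le> norm (b powr (p - 1) * norm (f x) powr p)"
    proof (rule AE_I2)
      fix x
      show "norm (h x) \<le> norm (b powr (p - 1) * norm (f x) powr p)"
      proof (cases "x \<in> A n")
        case True
        then have fx: "1 / b \<le> norm (f x)" by (auto simp: A_def b_def)
        then have "1 \<le> b * norm (f x)" using b by (simp add: field_simps)
        then have "1 \<le> (b * norm (f x)) powr (p - 1)" using p by (intro ge_one_powr_ge_zero) auto
        then have "norm (f x) \<le> norm (f x) * (b * norm (f x)) powr (p - 1)"
          by (simp add: mult_le_cancel_left1)
        also have "\<dots> = b powr (p - 1) * (norm (f x) powr (1 + (p - 1)))"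
          using b fx by (simp add: powr_mult powr_mult_base del: powr_one_eq_one)
        finally show ?thesis using True by (simp add: h_def g_def abs_mult)
      qed (simp add: h_def g_def)
    qed
  qed auto
  from continuous_translation_L1[OF this, of "e1 / (2 * b) powr (p - 1)"]
  obtain d where d: "d > 0" "\<And>y. norm y < d \<Longrightarrow> (\<integral>\<^sup>+x. norm (h (x - y) - h x) \<partial>lborel) < ennreal (e1 / (2 * b) powr (p - 1))"
    using e1 b by auto
  show ?thesis
  proof (intro exI[of _ d] conjI allI impI d)
    fix y :: 'a assume y: "norm y < d"
    have *: "norm (h (x - y) - h x) powr p \<le> (2 * b) powr (p - 1) * norm (h (x - y) - h x)" for x
    proof -
      have "norm (h (x - y) - h x) \<le> 2 * b"
        using hb[of x] hb[of "x - y"] norm_triangle_ineq4[of "h (x - y)" "h x"] by linarith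
      then have "norm (h (x - y) - h x) powr (p - 1) * norm (h (x - y) - h x) \<le> (2 * b) powr (p - 1) * norm (h (x - y) - h x)"
        using p by (intro mult_right_mono powr_mono2) auto
      then show ?thesis by (simp add: mult.commute powr_mult_base)
    qed
    have "Lp_mass p lborel (\<lambda>x. h (x - y) - h x) \<le> (\<integral>\<^sup>+x. ennreal ((2 * b) powr (p - 1)) * norm (h (x - y) - h x) \<partial>lborel)"
      using * by (intro nn_integral_mono) (auto simp flip: ennreal_mult' intro!: ennreal_leI)
    also have "\<dots> = ennreal ((2 * b) powr (p - 1)) * (\<integral>\<^sup>+x. norm (h (x - y) - h x) \<partial>lborel)"
      by (rule nn_integral_cmult) measurable
    also have "\<dots> \<le> ennreal ((2 * b) powr (p - 1)) * ennreal (e1 / (2 * b) powr (p - 1))"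
      using d(2)[OF y] by (intro mult_left_mono) auto
    also have "\<dots> = ennreal e1" using b e1 by (simp flip: ennreal_mult)
    finally have h: "Lp_mass p lborel (\<lambda>x. h (x - y) - h x) \<le> ennreal e1" .
    have 1: "Lp_mass p lborel (\<lambda>x. h x - f x) \<le> ennreal e1"
      using n by (simp add: h_def norm_minus_commute)
    have 2: "Lp_mass p lborel (\<lambda>x. f (x - y) - h (x - y)) \<le> ennreal e1"
      using n by (subst nn_integral_lborel_translate[where f="\<lambda>x. ennreal (norm (f x - h x) powr p)"]) (auto simp: h_def)
    have "Lp_mass p lborel (\<lambda>x. f (x - y) - f x)
      = (Lp_mass p lborel (\<lambda>x. (f (x - y) - h (x - y)) + ((h (x - y) - h x) + (h x - f x))))"
      by simp
    also have "\<dots> \<le> c * (Lp_mass p lborel (\<lambda>x. f (x - y) - h (x - y))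
       + Lp_mass p lborel (\<lambda>x. (h (x - y) - h x) + (h x - f x)))"
      unfolding c_def using p by (intro nn_integral_norm_add_powr_le) auto
    also have "\<dots> \<le> c * (Lp_mass p lborel (\<lambda>x. f (x - y) - h (x - y))
       + c * (Lp_mass p lborel (\<lambda>x. h (x - y) - h x) + Lp_mass p lborel (\<lambda>x. h x - f x)))"
      unfolding c_def using p by (intro mult_left_mono add_left_mono nn_integral_norm_add_powr_le) auto
    also have "\<dots> \<le> c * (ennreal e1 + c * (ennreal e1 + ennreal e1))"
      by (intro mult_left_mono add_mono 1 2 h) auto
    also have "\<dots> = ennreal (c * (e1 + c * (e1 + e1)))"
      using c e1 by (simp flip: ennreal_plus ennreal_mult')
    also have "c * (e1 + c * (e1 + e1)) < e"
    proof -
      have "c * (e1 + c * (e1 + e1)) < 4 * c * (c + 1) * e1"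
        using c e1 by (simp add: algebra_simps add_pos_pos)
      also have "\<dots> = e" using c by (simp add: e1_def)
      finally show ?thesis .
    qed
    then have "ennreal (c * (e1 + c * (e1 + e1))) < ennreal e"
      using e by (simp add: ennreal_less_iff c e1 less_imp_le)
    finally show "Lp_mass p lborel (\<lambda>x. f (x - y) - f x) < ennreal e" .
  qed
qed

section \<open>Jensen's inequality for powers of the norm\<close>

lemma powr_tangent:
  fixes a s p :: real
  assumes "0 \<le> a" "0 \<le> s" "1 \<le> p"
  shows "s powr p + p * s powr (p - 1) * (a - s) \<le> a powr p"
\<comment> \<open>The convexity fact concerns the open half-line, so the boundary cases are checked
  by hand; for \<open>s = 0\<close> the slope is \<open>0\<close> because
  \<open>0 powr (p - 1) = 0\<close>, also when \<open>p = 1\<close>.\<close>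
proof (cases "s = 0 \<or> a = 0")
  case True
  have "s powr p \<le> p * (s powr (p - 1) * s)"
    using assms by (simp add: mult.commute[of _ s] powr_mult_base mult_le_cancel_right1)
  then show ?thesis using True assms by (auto simp: algebra_simps)
next
  case False
  have "a powr p - s powr p \<ge> p * s powr (p - 1) * (a - s)"
  proof (rule convex_on_imp_above_tangent[OF powr_convex[OF assms(3)]])
    show "((\<lambda>x. x powr p) has_real_derivative p * s powr (p - 1)) (at s within {0<..})"
      using False assms by (intro has_real_derivative_powr[THEN DERIV_subset]) auto
  qed (use False assms in \<open>auto simp: interior_open\<close>)
  then show ?thesis by simp
qed

text \<open>Integrate the tangent inequality at the weighted mean \<open>s\<close> of
  \<open>norm (F x)\<close>: since the weight has mass one, the linear side integrates to
  \<open>s powr p\<close> exactly.\<close>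

lemma jensen_norm_powr:
  fixes F :: "'a \<Rightarrow> 'b::euclidean_space"
  assumes [measurable]: "F \<in> borel_measurable M" "\<eta> \<in> borel_measurable M"
    and \<eta>: "integrable M \<eta>" "\<And>x. 0 \<le> \<eta> x" "(\<integral>x. \<eta> x \<partial>M) = 1" and p: "1 \<le> p"
  shows "ennreal (norm (\<integral>x. \<eta> x *\<^sub>R F x \<partial>M) powr p) \<le> (\<integral>\<^sup>+x. ennreal (\<eta> x * norm (F x) powr p) \<partial>M)"
proof (cases "(\<integral>\<^sup>+x. ennreal (\<eta> x * norm (F x) powr p) \<partial>M) < \<infinity>")
  case True
  then have ip: "integrable M (\<lambda>x. \<eta> x * norm (F x) powr p)"
    using \<eta> by (intro integrableI_bounded) auto
  have i1: "integrable M (\<lambda>x. \<eta> x * norm (F x))"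
  proof (rule Bochner_Integration.integrable_bound)
    show "integrable M (\<lambda>x. \<eta> x + \<eta> x * norm (F x) powr p)" using ip \<eta> by auto
    show "AE x in M. norm (\<eta> x * norm (F x)) \<le> norm (\<eta> x + \<eta> x * norm (F x) powr p)"
    proof (rule AE_I2)
      fix x
      have "\<eta> x * norm (F x) \<le> \<eta> x * (1 + norm (F x) powr p)"
        by (intro mult_left_mono le_1_add_powr p \<eta>) auto
      then show "norm (\<eta> x * norm (F x)) \<le> norm (\<eta> x + \<eta> x * norm (F x) powr p)"
        using \<eta>(2) by (simp add: algebra_simps)
    qed
  qed auto
  define s where "s = (\<integral>x. \<eta> x * norm (F x) \<partial>M)"
  have s: "0 \<le> s" using \<eta> by (auto simp: s_def)
  have "norm (\<integral>x. \<eta> x *\<^sub>R F x \<partial>M) \<le> (\<integral>x. norm (\<eta> x *\<^sub>R F x) \<partial>M)"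
    by (rule integral_norm_bound)
  also have "\<dots> = s" using \<eta> by (simp add: s_def)
  finally have "norm (\<integral>x. \<eta> x *\<^sub>R F x \<partial>M) powr p \<le> s powr p"
    using p by (intro powr_mono2) auto
  also have "s powr p = (\<integral>x. (s powr p - p * s powr (p - 1) * s) * \<eta> x + p * s powr (p - 1) * (\<eta> x * norm (F x)) \<partial>M)"
    using \<eta> i1 by (simp add: s_def)
  also have "\<dots> \<le> (\<integral>x. \<eta> x * norm (F x) powr p \<partial>M)"
  proof (rule integral_mono)
    fix x
    show "(s powr p - p * s powr (p - 1) * s) * \<eta> x + p * s powr (p - 1) * (\<eta> x * norm (F x)) \<le> \<eta> x * norm (F x) powr p"
      using mult_left_mono[OF powr_tangent[OF norm_ge_zero s p, of "F x"] \<eta>(2)[of x]]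
      by (simp add: algebra_simps)
  qed (use \<eta> i1 ip in auto)
  finally show ?thesis
    using ip \<eta>(2) by (subst nn_integral_eq_integral) (auto intro: ennreal_leI)
qed (simp add: not_less top_unique)

section \<open>Functions of class \<open>C\<^sup>1\<close>\<close>

definition grad :: "('a::euclidean_space \<Rightarrow> real) \<Rightarrow> 'a \<Rightarrow> 'a" where
  "grad \<psi> x = (\<Sum>b\<in>Basis. partial_derivative b \<psi> x *\<^sub>R b)"

definition C1 :: "('a::euclidean_space \<Rightarrow> real) set" where
  "C1 = {\<psi>. (\<forall>x. \<psi> differentiable at x) \<and>
     (\<forall>b\<in>Basis. continuous_on UNIV (partial_derivative b \<psi>))}"

lemma grad_inner_Basis: "b \<in> Basis \<Longrightarrow> grad \<psi> x \<bullet> b = partial_derivative b \<psi> x"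
  by (simp add: grad_def)

lemma C1I:
  assumes "\<And>x. (\<psi> has_derivative (\<lambda>h. G x \<bullet> h)) (at x)" and "continuous_on UNIV G"
  shows "\<psi> \<in> C1" and "grad \<psi> = G"
proof -
  have "frechet_derivative \<psi> (at x) = (\<lambda>h. G x \<bullet> h)" for x
    using frechet_derivative_at[OF assms(1)] by simp
  then have pd: "partial_derivative b \<psi> = (\<lambda>x. G x \<bullet> b)" for b
    by (auto simp: partial_derivative_def)
  show "\<psi> \<in> C1"
    using assms by (auto simp: C1_def pd differentiable_def intro!: continuous_intros)
  show "grad \<psi> = G"
    by (auto simp: grad_def pd euclidean_representation)
qed

lemma C1_has_derivative:
  assumes "\<psi> \<in> C1"
  shows "(\<psi> has_derivative (\<lambda>h. grad \<psi> x \<bullet> h)) (at x)"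
proof -
  have d: "(\<psi> has_derivative frechet_derivative \<psi> (at x)) (at x)"
    using assms by (auto simp: C1_def frechet_derivative_works)
  interpret D: linear "frechet_derivative \<psi> (at x)"
    using d by (rule has_derivative_linear)
  have "frechet_derivative \<psi> (at x) h = grad \<psi> x \<bullet> h" for h
  proof -
    have "frechet_derivative \<psi> (at x) h = frechet_derivative \<psi> (at x) (\<Sum>b\<in>Basis. (h \<bullet> b) *\<^sub>R b)"
      by (simp add: euclidean_representation)
    also have "\<dots> = grad \<psi> x \<bullet> h"
      by (simp add: D.sum D.scale grad_def partial_derivative_def inner_sum_right inner_commute mult.commute)
    finally show ?thesis .
  qed
  then have "frechet_derivative \<psi> (at x) = (\<lambda>h. grad \<psi> x \<bullet> h)" by auto
  with d show ?thesis by simp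
qed

lemma C1_continuous_grad: "\<psi> \<in> C1 \<Longrightarrow> continuous_on A (grad \<psi>)"
  unfolding grad_def[abs_def] C1_def
  by (auto intro!: continuous_intros intro: continuous_on_subset)

lemma C1_continuous: "\<psi> \<in> C1 \<Longrightarrow> continuous_on A \<psi>"
  by (meson C1_has_derivative continuous_at_imp_continuous_on has_derivative_continuous)

lemma C1_borel [measurable_dest]: "\<psi> \<in> C1 \<Longrightarrow> \<psi> \<in> borel_measurable borel"
  by (simp add: borel_measurable_continuous_onI C1_continuous)

lemma C1_grad_borel [measurable_dest]: "\<psi> \<in> C1 \<Longrightarrow> grad \<psi> \<in> borel_measurable borel"
  by (simp add: borel_measurable_continuous_onI C1_continuous_grad)

text \<open>Any compact set off which the function vanishes may serve in place of the closure of its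
  support; membership is checked and used in this form below.\<close>

lemma C1_compact_iff:
  "\<psi> \<in> C1_compact \<Omega> \<longleftrightarrow> \<psi> \<in> C1 \<and> (\<exists>K. compact K \<and> K \<subseteq> \<Omega> \<and> (\<forall>x. x \<notin> K \<longrightarrow> \<psi> x = 0))"
proof
  assume "\<psi> \<in> C1_compact \<Omega>"
  then show "\<psi> \<in> C1 \<and> (\<exists>K. compact K \<and> K \<subseteq> \<Omega> \<and> (\<forall>x. x \<notin> K \<longrightarrow> \<psi> x = 0))"
    unfolding C1_compact_def C1_def
    using closure_subset[of "{x. \<psi> x \<noteq> 0}"] by (auto intro!: exI[of _ "closure {x. \<psi> x \<noteq> 0}"])
next
  assume *: "\<psi> \<in> C1 \<and> (\<exists>K. compact K \<and> K \<subseteq> \<Omega> \<and> (\<forall>x. x \<notin> K \<longrightarrow> \<psi> x = 0))"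
  then obtain K where K: "compact K" "K \<subseteq> \<Omega>" "\<forall>x. x \<notin> K \<longrightarrow> \<psi> x = 0" by blast
  then have "closure {x. \<psi> x \<noteq> 0} \<subseteq> K"
    by (intro closure_minimal) (auto simp: compact_imp_closed)
  moreover from this K have "compact (closure {x. \<psi> x \<noteq> 0})"
    by (meson bounded_subset closed_closure compact_eq_bounded_closed)
  ultimately show "\<psi> \<in> C1_compact \<Omega>"
    using * K(2) unfolding C1_compact_def C1_def by auto
qed

lemma C1_compact_mono:
  assumes "A \<subseteq> B"
  shows "C1_compact A \<subseteq> C1_compact B"
  using assms by (meson C1_compact_iff order_trans subsetI)

lemma C1_const: "(\<lambda>_. c) \<in> C1" and grad_const: "grad (\<lambda>_. c) = (\<lambda>_. 0)"
  using C1I[of "\<lambda>_. c" "\<lambda>_. 0"] by (auto simp: continuous_on_const)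

lemma
  assumes "f \<in> C1" "g \<in> C1"
  shows C1_add: "(\<lambda>x. f x + g x) \<in> C1"
    and grad_add: "grad (\<lambda>x. f x + g x) = (\<lambda>x. grad f x + grad g x)"
  by (rule C1I[of _ "\<lambda>x. grad f x + grad g x"],
      use assms in \<open>auto intro!: derivative_eq_intros C1_has_derivative continuous_intros C1_continuous_grad simp: inner_add_left\<close>)+

lemma C1_diff:
  assumes "f \<in> C1" "g \<in> C1"
  shows "(\<lambda>x. f x - g x) \<in> C1"
  by (rule C1I(1)[of _ "\<lambda>x. grad f x - grad g x"],
      use assms in \<open>auto intro!: derivative_eq_intros C1_has_derivative continuous_intros C1_continuous_grad simp: inner_diff_left\<close>)

lemma
  assumes "f \<in> C1" "g \<in> C1"
  shows C1_mult: "(\<lambda>x. f x * g x) \<in> C1"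
    and grad_mult: "grad (\<lambda>x. f x * g x) = (\<lambda>x. f x *\<^sub>R grad g x + g x *\<^sub>R grad f x)"
  by (rule C1I[of _ "\<lambda>x. f x *\<^sub>R grad g x + g x *\<^sub>R grad f x"],
      use assms in \<open>auto intro!: derivative_eq_intros C1_has_derivative continuous_intros C1_continuous_grad C1_continuous simp: inner_add_left\<close>)+

lemma
  assumes f: "f \<in> C1" and G: "\<And>s. (G has_real_derivative G' s) (at s)" "continuous_on UNIV G'"
  shows C1_compose: "(\<lambda>x. G (f x)) \<in> C1"
    and grad_compose: "grad (\<lambda>x. G (f x)) = (\<lambda>x. G' (f x) *\<^sub>R grad f x)"
proof -
  have 1: "((\<lambda>x. G (f x)) has_derivative (\<lambda>h. (G' (f x) *\<^sub>R grad f x) \<bullet> h)) (at x)" for x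
    using has_derivative_compose[OF C1_has_derivative[OF f] G(1)[unfolded has_field_derivative_def], of x]
    by simp
  have 2: "continuous_on UNIV (\<lambda>x. G' (f x) *\<^sub>R grad f x)"
    using continuous_on_compose2[OF G(2) C1_continuous[OF f]]
    by (intro continuous_intros C1_continuous_grad f) auto
  show "(\<lambda>x. G (f x)) \<in> C1" "grad (\<lambda>x. G (f x)) = (\<lambda>x. G' (f x) *\<^sub>R grad f x)"
    by (rule C1I[OF 1 2])+
qed

lemma C1_cmult: "f \<in> C1 \<Longrightarrow> (\<lambda>x. c * f x) \<in> C1"
  and grad_cmult: "f \<in> C1 \<Longrightarrow> grad (\<lambda>x. c * f x) = (\<lambda>x. c *\<^sub>R grad f x)"
  using C1_mult[OF C1_const[of c], of f] grad_mult[OF C1_const[of c], of f] by (auto simp: grad_const)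

lemma
  shows C1_inner: "(\<lambda>x. x \<bullet> a) \<in> C1" and grad_inner: "grad (\<lambda>x. x \<bullet> a) = (\<lambda>_. a)"
  by (rule C1I[of _ "\<lambda>_. a"], auto intro!: derivative_eq_intros simp: inner_commute)+

lemma
  assumes "f \<in> C1"
  shows C1_reflect: "(\<lambda>y. f (x - y)) \<in> C1" and grad_reflect: "grad (\<lambda>y. f (x - y)) = (\<lambda>y. - grad f (x - y))"
proof -
  have 1: "((\<lambda>y. f (x - y)) has_derivative (\<lambda>h. (- grad f (x - y)) \<bullet> h)) (at y)" for y
  proof -
    have "((\<lambda>y. x - y) has_derivative (\<lambda>h. - h)) (at y)"
      by (auto intro!: derivative_eq_intros)
    from has_derivative_compose[OF this C1_has_derivative[OF assms]] show ?thesis by simp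
  qed
  have 2: "continuous_on UNIV (\<lambda>y. - grad f (x - y))"
    by (intro continuous_intros continuous_on_compose2[OF C1_continuous_grad[OF assms, of UNIV]]) auto
  show "(\<lambda>y. f (x - y)) \<in> C1" "grad (\<lambda>y. f (x - y)) = (\<lambda>y. - grad f (x - y))"
    by (rule C1I[OF 1 2])+
qed

lemma C1_compact_reflect:
  assumes "f \<in> C1_compact UNIV"
  shows "(\<lambda>y. f (x - y)) \<in> C1_compact UNIV"
proof -
  obtain K where K: "f \<in> C1" "compact K" "\<forall>x. x \<notin> K \<longrightarrow> f x = 0"
    using assms by (auto simp: C1_compact_iff)
  have "compact ((\<lambda>y. x - y) ` K)"
    using K(2) by (intro compact_continuous_image) (auto intro!: continuous_intros)
  moreover have "f (x - y) = 0" if "y \<notin> (\<lambda>y. x - y) ` K" for y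
    using that K(3) by (metis diff_diff_eq2 add_diff_cancel_left' imageI)
  ultimately show ?thesis
    using C1_reflect[OF K(1)] by (auto simp: C1_compact_iff)
qed

lemma C1_compact_diff:
  "f \<in> C1_compact \<Omega> \<Longrightarrow> g \<in> C1_compact \<Omega> \<Longrightarrow> (\<lambda>x. f x - g x) \<in> C1_compact \<Omega>"
  unfolding C1_compact_iff
proof (elim conjE exE)
  fix K L assume *: "f \<in> C1" "g \<in> C1" "compact K" "compact L" "K \<subseteq> \<Omega>" "L \<subseteq> \<Omega>"
    "\<forall>x. x \<notin> K \<longrightarrow> f x = 0" "\<forall>x. x \<notin> L \<longrightarrow> g x = 0"
  then show "(\<lambda>x. f x - g x) \<in> C1 \<and> (\<exists>K. compact K \<and> K \<subseteq> \<Omega> \<and> (\<forall>x. x \<notin> K \<longrightarrow> f x - g x = 0))"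
    by (auto intro!: exI[of _ "K \<union> L"] C1_diff)
qed

lemma C1_compact_mult:
  "f \<in> C1_compact \<Omega> \<Longrightarrow> g \<in> C1 \<Longrightarrow> (\<lambda>x. f x * g x) \<in> C1_compact \<Omega>"
  unfolding C1_compact_iff by (auto intro!: C1_mult)

lemma C1_zero_outside_grad:
  assumes "f \<in> C1" "closed K" "\<And>x. x \<notin> K \<Longrightarrow> f x = 0" "x \<notin> K"
  shows "grad f x = 0"
proof -
  have "(f has_derivative (\<lambda>h. 0)) (at x)"
    by (rule has_derivative_transform_within_open[of "\<lambda>_. 0" _ _ _ "- K"]) (use assms in auto)
  then have "(\<lambda>h. grad f x \<bullet> h) = (\<lambda>h. 0)"
    using C1_has_derivative[OF assms(1)] has_derivative_unique by blast
  then show ?thesis by (metis inner_eq_zero_iff)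
qed

text \<open>By the mean value theorem it suffices that the gradient varies little over short
  distances, uniformly. Two points at distance below \<open>1\<close> lie either both in the ball of
  radius \<open>R + 1\<close>, where the gradient is uniformly continuous, or both beyond
  \<open>R\<close>, where it vanishes.\<close>

lemma C1_compact_uniform:
  assumes f: "f \<in> C1_compact UNIV" and e: "0 < e"
  shows "\<exists>d>0. \<forall>x k. norm k < d \<longrightarrow> \<bar>f (x + k) - f x - grad f x \<bullet> k\<bar> \<le> e * norm k"
proof -
  obtain K where K: "f \<in> C1" "compact K" "\<And>x. x \<notin> K \<Longrightarrow> f x = 0"
    using f by (auto simp: C1_compact_iff)
  obtain R where R: "\<And>x. x \<in> K \<Longrightarrow> norm x \<le> R"
    using compact_imp_bounded[OF K(2)] by (auto simp: bounded_iff)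
  have g0: "grad f x = 0" if "norm x > R" for x
    using C1_zero_outside_grad[OF K(1) compact_imp_closed[OF K(2)] K(3), of x] R[of x] that by fastforce
  have "uniformly_continuous_on (cball 0 (R + 1)) (grad f)"
    by (intro compact_uniformly_continuous C1_continuous_grad K) auto
  then obtain d where d: "d > 0" "\<And>x y. x \<in> cball 0 (R + 1) \<Longrightarrow> y \<in> cball 0 (R + 1) \<Longrightarrow> dist y x < d \<Longrightarrow> dist (grad f y) (grad f x) < e"
    unfolding uniformly_continuous_on_def using e by metis
  have close: "norm (grad f y - grad f x) \<le> e" if "norm (y - x) < min d 1" for x y
  proof (cases "norm x \<le> R + 1 \<and> norm y \<le> R + 1")
    case True
    then show ?thesis using d(2)[of x y] that by (auto simp: dist_norm)
  next
    case False
    then have "norm x > R \<and> norm y > R"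
      using that norm_triangle_ineq2[of x y] norm_triangle_ineq2[of y x] by (auto simp: norm_minus_commute)
    then show ?thesis using g0 e by simp
  qed
  show ?thesis
  proof (intro exI[of _ "min d 1"] conjI allI impI)
    fix x k :: 'a assume k: "norm k < min d 1"
    have "((\<lambda>s. f (x + s *\<^sub>R k)) has_derivative (\<lambda>h. grad f (x + s *\<^sub>R k) \<bullet> (h *\<^sub>R k))) (at s within {0..1})" for s
    proof -
      have "((\<lambda>s. x + s *\<^sub>R k) has_derivative (\<lambda>h. h *\<^sub>R k)) (at s within {0..1})"
        by (auto intro!: derivative_eq_intros)
      from has_derivative_compose[OF this C1_has_derivative[OF K(1)]] show ?thesis by simp
    qed
    then obtain s where s: "s \<in> {0..1}" "f (x + 1 *\<^sub>R k) - f (x + 0 *\<^sub>R k) = grad f (x + s *\<^sub>R k) \<bullet> ((1 - 0) *\<^sub>R k)"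
      using mvt_very_simple[of 0 1 "\<lambda>s. f (x + s *\<^sub>R k)" "\<lambda>s h. grad f (x + s *\<^sub>R k) \<bullet> (h *\<^sub>R k)"] by force
    have "norm (s *\<^sub>R k) \<le> norm k" using s by (simp add: mult_left_le_one_le)
    then have "norm (grad f (x + s *\<^sub>R k) - grad f x) \<le> e" using close[of "x + s *\<^sub>R k" x] k by simp
    then have "\<bar>(grad f (x + s *\<^sub>R k) - grad f x) \<bullet> k\<bar> \<le> e * norm k"
      using Cauchy_Schwarz_ineq2[of "grad f (x + s *\<^sub>R k) - grad f x" k] mult_right_mono[OF _ norm_ge_zero]
      by (meson order_trans)
    then show "\<bar>f (x + k) - f x - grad f x \<bullet> k\<bar> \<le> e * norm k"
      using s by (simp add: inner_diff_left)
  qed (use d in auto)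
qed

lemma C1_compact_bounded:
  assumes "f \<in> C1_compact UNIV"
  shows "\<exists>B R. 0 < B \<and> (\<forall>x. \<bar>f x\<bar> \<le> B \<and> norm (grad f x) \<le> B) \<and> (\<forall>x. R < norm x \<longrightarrow> f x = 0 \<and> grad f x = 0)"
proof -
  obtain K where K: "f \<in> C1" "compact K" "\<And>x. x \<notin> K \<Longrightarrow> f x = 0"
    using assms by (auto simp: C1_compact_iff)
  obtain R where R: "\<And>x. x \<in> K \<Longrightarrow> norm x \<le> R"
    using compact_imp_bounded[OF K(2)] by (auto simp: bounded_iff)
  have g0: "grad f x = 0" if "x \<notin> K" for x
    using C1_zero_outside_grad[OF K(1) compact_imp_closed[OF K(2)] K(3)] that by blast
  obtain B1 where B1: "\<And>x. x \<in> K \<Longrightarrow> norm (f x) \<le> B1"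
    using compact_imp_bounded[OF compact_continuous_image[OF C1_continuous[OF K(1)] K(2)]]
    by (auto simp: bounded_iff)
  obtain B2 where B2: "\<And>x. x \<in> K \<Longrightarrow> norm (grad f x) \<le> B2"
    using compact_imp_bounded[OF compact_continuous_image[OF C1_continuous_grad[OF K(1)] K(2)]]
    by (auto simp: bounded_iff)
  have "\<bar>f x\<bar> \<le> max 1 (max B1 B2) \<and> norm (grad f x) \<le> max 1 (max B1 B2)" for x
    by (cases "x \<in> K") (use B1[of x] B2[of x] g0[of x] K(3)[of x] in auto)
  moreover have "R < norm x \<longrightarrow> f x = 0 \<and> grad f x = 0" for x
    using R[of x] g0[of x] K(3)[of x] by force
  moreover have "0 < max 1 (max B1 B2)" by simp
  ultimately show ?thesis by blast
qed

lemma C1_compact_integrable: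
  fixes f :: "'a::euclidean_space \<Rightarrow> real"
  assumes "f \<in> C1_compact UNIV"
  shows "integrable lborel f" "integrable lborel (grad f)"
proof -
  obtain B R where B: "\<forall>x. \<bar>f x\<bar> \<le> B \<and> norm (grad f x) \<le> B" "\<forall>x. R < norm x \<longrightarrow> f x = 0 \<and> grad f x = 0"
    using C1_compact_bounded[OF assms] by blast
  have f: "f \<in> C1" using assms by (simp add: C1_compact_iff)
  have *: "integrable lborel (\<lambda>x::'a. indicator (cball 0 R) x * B)"
    by (intro integrable_mult_left integrable_real_indicator) (use emeasure_lborel_cball_finite[of "0::'a" R] in auto)
  have "AE x in lborel. norm (f x) \<le> norm (indicator (cball 0 R) x * B)"
       "AE x in lborel. norm (grad f x) \<le> norm (indicator (cball 0 R) x * B)"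
    using B by (auto intro!: AE_I2 simp: indicator_def intro: order_trans[OF _ abs_ge_self])
  then show "integrable lborel f" "integrable lborel (grad f)"
    by (auto intro!: Bochner_Integration.integrable_bound[OF *] C1_borel[OF f] C1_grad_borel[OF f])
qed

text \<open>The first-order remainder never exceeds \<open>(y - s)\<^sup>2\<close>, so
  \<open>e\<close> itself can be taken as the radius. This profile underlies both the bump functions
  and the smoothed positive part \<open>spos\<close>.\<close>

lemma pos_part_square_derivative:
  "((\<lambda>s::real. (max 0 s)\<^sup>2) has_real_derivative 2 * max 0 s) (at s)"
  unfolding has_field_derivative_def has_derivative_at_alt
proof (intro conjI allI impI)
  fix e :: real assume e: "0 < e"
  have "\<bar>(max 0 y)\<^sup>2 - (max 0 s)\<^sup>2 - 2 * max 0 s * (y - s)\<bar> \<le> (y - s)\<^sup>2" for y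
  proof (cases "0 \<le> y"; cases "0 \<le> s")
    assume "0 \<le> y" "\<not> 0 \<le> s"
    then have "y\<^sup>2 \<le> (y - s)\<^sup>2" by (intro power_mono) auto
    then show ?thesis using \<open>0 \<le> y\<close> \<open>\<not> 0 \<le> s\<close> by simp
  next
    assume *: "\<not> 0 \<le> y" "0 \<le> s"
    have "0 \<le> s * (s - 2 * y)" using * by (intro mult_nonneg_nonneg) auto
    then show ?thesis using * by (auto simp: power2_eq_square algebra_simps abs_if)
  next
    assume *: "0 \<le> y" "0 \<le> s"
    have "y\<^sup>2 - s\<^sup>2 - 2 * s * (y - s) = (y - s)\<^sup>2" by (simp add: power2_eq_square algebra_simps)
    then show ?thesis using * by simp
  qed simp
  then have "\<bar>(max 0 y)\<^sup>2 - (max 0 s)\<^sup>2 - 2 * max 0 s * (y - s)\<bar> \<le> e * \<bar>y - s\<bar>" if "\<bar>y - s\<bar> < e" for y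
    using mult_right_mono[OF less_imp_le[OF that] abs_ge_zero[of "y - s"]]
    by (metis order_trans power2_eq_square power2_abs)
  then show "\<exists>d>0. \<forall>y. norm (y - s) < d \<longrightarrow> norm ((max 0 y)\<^sup>2 - (max 0 s)\<^sup>2 - 2 * max 0 s * (y - s)) \<le> e * norm (y - s)"
    using e by auto
qed (rule bounded_linear_mult_right)

text \<open>The squared positive part of a quadratic that is positive exactly in the ball. Class
  \<open>C1\<close> is all that is asked of test functions here, so this profile suffices.\<close>

lemma C1_compact_bump:
  assumes "0 < r"
  shows "\<exists>f\<in>C1_compact (cball a r). (\<forall>x. 0 \<le> f x) \<and> (\<forall>x. 0 < f x \<longleftrightarrow> x \<in> ball a r)"
proof -
  define q where "q x = r\<^sup>2 + (-1) * ((x - a) \<bullet> (x - a))" for x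
  have "(\<lambda>x. (x - a) \<bullet> (x - a)) \<in> C1"
    by (rule C1I(1)[of _ "\<lambda>x. 2 *\<^sub>R (x - a)"]) (auto intro!: derivative_eq_intros continuous_intros simp: inner_commute)
  then have q: "q \<in> C1"
    unfolding q_def by (intro C1_add C1_const C1_cmult)
  define f where "f x = (max 0 (q x))\<^sup>2" for x
  have qp: "0 < q x \<longleftrightarrow> x \<in> ball a r" for x
  proof -
    have "0 < q x \<longleftrightarrow> (norm (x - a))\<^sup>2 < r\<^sup>2" by (simp add: q_def power2_norm_eq_inner)
    also have "\<dots> \<longleftrightarrow> norm (x - a) < r" using assms by (metis less_imp_le norm_ge_zero power_mono_iff not_le zero_less_numeral)
    finally show ?thesis by (simp add: dist_norm norm_minus_commute)
  qed
  have "f \<in> C1" unfolding f_def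
    by (rule C1_compose[OF q pos_part_square_derivative]) (auto intro!: continuous_intros)
  moreover have "f x = 0" if "x \<notin> cball a r" for x
    using qp[of x] that by (auto simp: f_def not_less max_def)
  moreover have "0 < f x \<longleftrightarrow> x \<in> ball a r" for x
    using qp[of x] by (auto simp: f_def max_def split: if_splits)
  ultimately show ?thesis
    by (intro bexI[of _ f]) (auto simp: C1_compact_iff f_def intro!: exI[of _ "cball a r"])
qed

text \<open>Not the rescalings of one kernel but all kernels of mass one that vanish at distance
  \<open>d\<close> and beyond: a kernel for \<open>min d1 d2\<close> then meets the demands of
  \<open>d1\<close> and of \<open>d2\<close> at once.\<close>

definition mollifier :: "real \<Rightarrow> ('a::euclidean_space \<Rightarrow> real) \<Rightarrow> bool" where
  "mollifier d \<eta> \<longleftrightarrow> \<eta> \<in> C1_compact UNIV \<and> (\<forall>x. 0 \<le> \<eta> x) \<and> (\<integral>x. \<eta> x \<partial>lborel) = 1 \<and>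
     (\<forall>x. \<eta> x \<noteq> 0 \<longrightarrow> norm x < d)"

lemma mollifier_exists:
  assumes "0 < d"
  shows "\<exists>\<eta>::'a::euclidean_space \<Rightarrow> real. mollifier d \<eta>"
proof -
  obtain f :: "'a \<Rightarrow> real" where f: "f \<in> C1_compact (cball 0 d)" "\<forall>x. 0 \<le> f x" "\<forall>x. 0 < f x \<longleftrightarrow> x \<in> ball 0 d"
    using C1_compact_bump[OF assms] by blast
  have fU: "f \<in> C1_compact UNIV" using f(1) C1_compact_mono by blast
  have "(\<integral>x. f x \<partial>lborel) \<noteq> 0"
  proof
    assume "(\<integral>x. f x \<partial>lborel) = 0"
    then have "AE x in lborel. f x = 0"
      using integral_nonneg_eq_0_iff_AE[OF C1_compact_integrable(1)[OF fU]] f(2) by auto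
    then have "AE x::'a in lborel. x \<notin> ball 0 d"
      by eventually_elim (use f(3) in force)
    then have "emeasure lborel (ball (0::'a) d) = 0"
      by (subst (asm) AE_iff_measurable[of "ball 0 d"]) auto
    then show False using content_ball_pos[OF assms, of "0::'a"] by (simp add: measure_def)
  qed
  then have pos: "(\<integral>x. f x \<partial>lborel) > 0"
    using Bochner_Integration.integral_nonneg[of lborel f] f(2) by (metis less_le)
  define \<eta> where "\<eta> x = inverse (\<integral>x. f x \<partial>lborel) * f x" for x
  have "\<eta> \<in> C1_compact UNIV"
    using C1_compact_mult[OF fU C1_const, of "inverse (\<integral>x. f x \<partial>lborel)"] by (simp add: \<eta>_def[abs_def] mult.commute)
  moreover have "(\<integral>x. \<eta> x \<partial>lborel) = 1" using pos by (simp add: \<eta>_def)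
  moreover have "norm x < d" if "\<eta> x \<noteq> 0" for x
  proof -
    have "f x > 0" using that f(2)[rule_format, of x] by (auto simp: \<eta>_def less_le)
    then show ?thesis using f(3) by auto
  qed
  moreover have "0 \<le> \<eta> x" for x using pos f(2) by (simp add: \<eta>_def)
  ultimately show ?thesis unfolding mollifier_def by blast
qed

section \<open>Mollification\<close>

lemma set_integrable_Lp:
  fixes f :: "'a::euclidean_space \<Rightarrow> 'b::euclidean_space"
  assumes [measurable]: "f \<in> borel_measurable borel" and p: "1 \<le> p"
    and f: "Lp_mass p lborel f < \<infinity>"
  shows "set_integrable lborel (cball 0 R) f"
  unfolding set_integrable_def
proof (rule Bochner_Integration.integrable_bound)
  have i1: "integrable lborel (\<lambda>x. norm (f x) powr p)"
    using f by (intro integrableI_bounded) auto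
  have i2: "integrable lborel (\<lambda>x::'a. indicator (cball 0 R) x :: real)"
    using emeasure_lborel_cball_finite[of "0::'a" R] by (intro integrable_real_indicator) auto
  show "integrable lborel (\<lambda>x. indicator (cball 0 R) x + norm (f x) powr p)"
    using i1 i2 by (rule Bochner_Integration.integrable_add[rotated])
  show "AE x in lborel. norm (indicator (cball 0 R) x *\<^sub>R f x) \<le> norm (indicator (cball 0 R) x + norm (f x) powr p)"
    using le_1_add_powr[OF norm_ge_zero p] by (intro AE_I2) (auto simp: indicator_def)
  show "(\<lambda>x. indicator (cball 0 R) x *\<^sub>R f x) \<in> borel_measurable lborel"
    by (intro borel_measurable_scaleR borel_measurable_indicator) auto
qed

lemma
  fixes f :: "'a::euclidean_space \<Rightarrow> 'b::euclidean_space"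
  assumes [measurable]: "f \<in> borel_measurable borel" "h \<in> borel_measurable borel"
    and f: "set_integrable lborel (cball 0 R) f"
    and h: "\<And>y. \<bar>h y\<bar> \<le> B" "\<And>y. R < norm y \<Longrightarrow> h y = 0"
  shows integrable_bounded_scaleR: "integrable lborel (\<lambda>y. h y *\<^sub>R f y)"
    and norm_integral_bounded_scaleR:
      "norm (\<integral>y. h y *\<^sub>R f y \<partial>lborel) \<le> B * (\<integral>y. norm (indicator (cball 0 R) y *\<^sub>R f y) \<partial>lborel)"
proof -
  have i: "integrable lborel (\<lambda>y. B * norm (indicator (cball 0 R) y *\<^sub>R f y))"
    using f unfolding set_integrable_def by (intro integrable_mult_right integrable_norm)
  have b: "norm (h y *\<^sub>R f y) \<le> B * norm (indicator (cball 0 R) y *\<^sub>R f y)" for y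
    using h(1)[of y] h(2)[of y] by (cases "norm y \<le> R") (auto intro: mult_right_mono)
  show ii: "integrable lborel (\<lambda>y. h y *\<^sub>R f y)"
    using b by (intro Bochner_Integration.integrable_bound[OF i]) (auto intro: order_trans[OF _ abs_ge_self])
  have "norm (\<integral>y. h y *\<^sub>R f y \<partial>lborel) \<le> (\<integral>y. norm (h y *\<^sub>R f y) \<partial>lborel)"
    by (rule integral_norm_bound)
  also have "\<dots> \<le> (\<integral>y. B * norm (indicator (cball 0 R) y *\<^sub>R f y) \<partial>lborel)"
    using b by (intro integral_mono integrable_norm ii i)
  finally show "norm (\<integral>y. h y *\<^sub>R f y \<partial>lborel) \<le> B * (\<integral>y. norm (indicator (cball 0 R) y *\<^sub>R f y) \<partial>lborel)"
    by simp
qed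

definition conv :: "('a::euclidean_space \<Rightarrow> real) \<Rightarrow> ('a \<Rightarrow> 'b::euclidean_space) \<Rightarrow> 'a \<Rightarrow> 'b" where
  "conv \<eta> f x = (\<integral>y. \<eta> (x - y) *\<^sub>R f y \<partial>lborel)"

text \<open>Differentiation under the integral: the Taylor remainder of \<open>\<eta>\<close> is
  uniformly small by \<open>C1_compact_uniform\<close>, and it only meets the finite integral of the
  norm of \<open>f\<close> over one fixed ball.\<close>

lemma conv_has_derivative:
  fixes f :: "'a::euclidean_space \<Rightarrow> 'b::euclidean_space"
  assumes f[measurable]: "f \<in> borel_measurable borel" and fi: "\<And>R. set_integrable lborel (cball 0 R) f"
    and \<eta>: "\<eta> \<in> C1_compact UNIV"
  shows "(conv \<eta> f has_derivative (\<lambda>k. \<integral>y. (grad \<eta> (x - y) \<bullet> k) *\<^sub>R f y \<partial>lborel)) (at x)"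
proof -
  have c1: "\<eta> \<in> C1" using \<eta> by (simp add: C1_compact_iff)
  have [measurable]: "\<eta> \<in> borel_measurable borel" "grad \<eta> \<in> borel_measurable borel"
    using c1 by (auto intro: C1_borel C1_grad_borel)
  obtain B R where B: "B > 0" "\<And>x. \<bar>\<eta> x\<bar> \<le> B" "\<And>x. norm (grad \<eta> x) \<le> B"
    "\<And>x. R < norm x \<Longrightarrow> \<eta> x = 0 \<and> grad \<eta> x = 0"
    using C1_compact_bounded[OF \<eta>] by blast
  \<comment> \<open>For every \<open>z\<close> within distance \<open>1\<close> of \<open>x\<close>
    the kernel \<open>\<eta> (z - y)\<close> vanishes once \<open>norm y\<close> exceeds this
    radius, so one ball serves the whole neighbourhood.\<close>
  define I where "I = (\<integral>y. norm (indicator (cball 0 (R + norm x + 1)) y *\<^sub>R f y) \<partial>lborel)"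
  have I: "0 \<le> I" by (simp add: I_def)
  have far: "\<eta> (z - y) = 0 \<and> grad \<eta> (z - y) = 0" if "norm (z - x) \<le> 1" "R + norm x + 1 < norm y" for y z
  proof -
    have "norm y \<le> norm (z - y) + (norm (z - x) + norm x)" by norm
    then show ?thesis using that by (intro B) auto
  qed
  have Db: "\<bar>grad \<eta> (x - y) \<bullet> k\<bar> \<le> B * norm k" for y k
    using order_trans[OF Cauchy_Schwarz_ineq2 mult_right_mono[OF B(3) norm_ge_zero]] .
  have Di: "integrable lborel (\<lambda>y. (grad \<eta> (x - y) \<bullet> k) *\<^sub>R f y)"
   and Dn: "norm (\<integral>y. (grad \<eta> (x - y) \<bullet> k) *\<^sub>R f y \<partial>lborel) \<le> B * norm k * I" for k
    unfolding I_def
    by (rule integrable_bounded_scaleR[OF _ _ fi[of "R + norm x + 1"], where B="B * norm k"]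
        norm_integral_bounded_scaleR[OF _ _ fi[of "R + norm x + 1"], where B="B * norm k"];
        (use Db far[of x] in \<open>auto\<close>))+
  have Ei: "integrable lborel (\<lambda>y. \<eta> (z - y) *\<^sub>R f y)" if "norm (z - x) \<le> 1" for z
    by (rule integrable_bounded_scaleR[OF _ _ fi[of "R + norm x + 1"], where B=B])
       (use B(2) far[OF that] in auto)
  show ?thesis
    unfolding has_derivative_at_alt
  proof (intro conjI allI impI)
    show "bounded_linear (\<lambda>k. \<integral>y. (grad \<eta> (x - y) \<bullet> k) *\<^sub>R f y \<partial>lborel)"
    proof (rule bounded_linear_intro[where K="B * I"])
      fix k l :: 'a and r :: real
      show "(\<integral>y. (grad \<eta> (x - y) \<bullet> (k + l)) *\<^sub>R f y \<partial>lborel)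
        = (\<integral>y. (grad \<eta> (x - y) \<bullet> k) *\<^sub>R f y \<partial>lborel) + (\<integral>y. (grad \<eta> (x - y) \<bullet> l) *\<^sub>R f y \<partial>lborel)"
        using Di by (simp add: inner_add_right scaleR_add_left)
      show "(\<integral>y. (grad \<eta> (x - y) \<bullet> (r *\<^sub>R k)) *\<^sub>R f y \<partial>lborel)
        = r *\<^sub>R (\<integral>y. (grad \<eta> (x - y) \<bullet> k) *\<^sub>R f y \<partial>lborel)"
        by (simp flip: scaleR_scaleR)
      show "norm (\<integral>y. (grad \<eta> (x - y) \<bullet> k) *\<^sub>R f y \<partial>lborel) \<le> norm k * (B * I)"
        using Dn[of k] by (simp add: algebra_simps)
    qed
    fix e :: real assume e: "0 < e"
    obtain d where d: "d > 0" "\<And>x k. norm k < d \<Longrightarrow> \<bar>\<eta> (x + k) - \<eta> x - grad \<eta> x \<bullet> k\<bar> \<le> e / (I + 1) * norm k"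
      using C1_compact_uniform[OF \<eta>, of "e / (I + 1)"] e I by auto
    show "\<exists>d>0. \<forall>z. norm (z - x) < d \<longrightarrow>
      norm (conv \<eta> f z - conv \<eta> f x - (\<integral>y. (grad \<eta> (x - y) \<bullet> (z - x)) *\<^sub>R f y \<partial>lborel)) \<le> e * norm (z - x)"
    proof (intro exI[of _ "min d 1"] conjI allI impI)
      fix z assume z: "norm (z - x) < min d 1"
      have "conv \<eta> f z - conv \<eta> f x - (\<integral>y. (grad \<eta> (x - y) \<bullet> (z - x)) *\<^sub>R f y \<partial>lborel)
        = (\<integral>y. (\<eta> (z - y) - \<eta> (x - y) - grad \<eta> (x - y) \<bullet> (z - x)) *\<^sub>R f y \<partial>lborel)"
        using Di Ei[of z] Ei[of x] z unfolding conv_def by (simp add: scaleR_diff_left)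
      also have "norm \<dots> \<le> e / (I + 1) * norm (z - x) * I"
        unfolding I_def
      proof (rule norm_integral_bounded_scaleR[OF _ _ fi])
        fix y
        show "\<bar>\<eta> (z - y) - \<eta> (x - y) - grad \<eta> (x - y) \<bullet> (z - x)\<bar> \<le> e / ((\<integral>y. norm (indicator (cball 0 (R + norm x + 1)) y *\<^sub>R f y) \<partial>lborel) + 1) * norm (z - x)"
          using d(2)[of "z - x" "x - y"] z by (simp add: I_def algebra_simps)
        show "R + norm x + 1 < norm y \<Longrightarrow> \<eta> (z - y) - \<eta> (x - y) - grad \<eta> (x - y) \<bullet> (z - x) = 0"
          using far[of z y] far[of x y] z by auto
      qed measurable
      also have "\<dots> \<le> e * norm (z - x)"
      proof -
        have "I / (I + 1) \<le> 1" using I by simp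
        then have "(I / (I + 1)) * (e * norm (z - x)) \<le> 1 * (e * norm (z - x))"
          using e by (intro mult_right_mono) auto
        then show ?thesis by (simp add: mult.commute mult.left_commute)
      qed
      finally show "norm (conv \<eta> f z - conv \<eta> f x - (\<integral>y. (grad \<eta> (x - y) \<bullet> (z - x)) *\<^sub>R f y \<partial>lborel)) \<le> e * norm (z - x)" .
    qed (use d in auto)
  qed
qed

lemma conv_integrable:
  fixes f :: "'a::euclidean_space \<Rightarrow> 'b::euclidean_space"
  assumes f[measurable]: "f \<in> borel_measurable borel" and fi: "\<And>R. set_integrable lborel (cball 0 R) f"
    and \<eta>: "\<eta> \<in> C1_compact UNIV"
  shows "integrable lborel (\<lambda>y. \<eta> (x - y) *\<^sub>R f y)" "integrable lborel (\<lambda>y. \<eta> y *\<^sub>R f (x - y))"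
    "conv \<eta> f x = (\<integral>y. \<eta> y *\<^sub>R f (x - y) \<partial>lborel)"
proof -
  have c1: "\<eta> \<in> C1" using \<eta> by (simp add: C1_compact_iff)
  have [measurable]: "\<eta> \<in> borel_measurable borel"
    using c1 by (auto intro: C1_borel)
  obtain B R where B: "\<And>x. \<bar>\<eta> x\<bar> \<le> B" "\<And>x. R < norm x \<Longrightarrow> \<eta> x = 0"
    using C1_compact_bounded[OF \<eta>] by blast
  show i: "integrable lborel (\<lambda>y. \<eta> (x - y) *\<^sub>R f y)"
  proof (rule integrable_bounded_scaleR[OF _ _ fi[of "R + norm x"], where B=B])
    fix y show "R + norm x < norm y \<Longrightarrow> \<eta> (x - y) = 0"
      using norm_triangle_ineq2[of y x] by (intro B) (auto simp: norm_minus_commute)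
  qed (use B in auto)
  have l: "lborel = distr lborel borel (\<lambda>y. x - y)"
    using lborel_affine[of "-1" x] by (simp add: density_1)
  show "integrable lborel (\<lambda>y. \<eta> y *\<^sub>R f (x - y))"
    using i by (subst (asm) l, subst (asm) integrable_distr_eq) auto
  show "conv \<eta> f x = (\<integral>y. \<eta> y *\<^sub>R f (x - y) \<partial>lborel)"
    unfolding conv_def by (subst l, subst integral_distr) auto
qed

text \<open>\<open>conv \<eta> f x - f x\<close> is the \<open>\<eta>\<close>-average of the
  differences \<open>f (x - y) - f x\<close>. Jensen moves the power inside, Fubini lets
  \<open>x\<close> be integrated first, and only shifts shorter than \<open>d\<close> carry
  weight.\<close>

lemma conv_Lp_approx:
  fixes f :: "'a::euclidean_space \<Rightarrow> 'b::euclidean_space"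
  assumes f[measurable]: "f \<in> borel_measurable borel" and p: "1 \<le> p"
    and fp: "Lp_mass p lborel f < \<infinity>" and e: "0 < e"
  shows "\<exists>d>0. \<forall>\<eta>. mollifier d \<eta> \<longrightarrow>
     Lp_mass p lborel (\<lambda>x. conv \<eta> f x - f x) < ennreal e"
proof -
  obtain d where d: "d > 0" "\<And>y. norm y < d \<Longrightarrow> Lp_mass p lborel (\<lambda>x. f (x - y) - f x) < ennreal (e / 2)"
    using continuous_translation_Lp[OF f p fp, of "e / 2"] e by auto
  note fi = set_integrable_Lp[OF f p fp]
  show ?thesis
  proof (intro exI[of _ d] conjI allI impI d)
    fix \<eta> :: "'a \<Rightarrow> real" assume "mollifier d \<eta>"
    then have \<eta>: "\<eta> \<in> C1_compact UNIV" "\<forall>x. 0 \<le> \<eta> x" "(\<integral>x. \<eta> x \<partial>lborel) = 1"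
      "\<forall>x. \<eta> x \<noteq> 0 \<longrightarrow> norm x < d"
      by (auto simp: mollifier_def)
    have c1: "\<eta> \<in> C1" using \<eta> by (simp add: C1_compact_iff)
    have [measurable]: "\<eta> \<in> borel_measurable borel"
      using c1 by (auto intro: C1_borel)
    note \<eta>i = C1_compact_integrable(1)[OF \<eta>(1)]
    have "Lp_mass p lborel (\<lambda>x. conv \<eta> f x - f x)
      \<le> (\<integral>\<^sup>+x. \<integral>\<^sup>+y. ennreal (\<eta> y * norm (f (x - y) - f x) powr p) \<partial>lborel \<partial>lborel)"
    proof (rule nn_integral_mono)
      fix x
      have "conv \<eta> f x - f x = (\<integral>y. \<eta> y *\<^sub>R f (x - y) \<partial>lborel) - (\<integral>y. \<eta> y *\<^sub>R f x \<partial>lborel)"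
        using \<eta>(3) \<eta>i by (simp add: conv_integrable(3)[OF f fi \<eta>(1)])
      also have "\<dots> = (\<integral>y. \<eta> y *\<^sub>R f (x - y) - \<eta> y *\<^sub>R f x \<partial>lborel)"
        using conv_integrable(2)[OF f fi \<eta>(1)] \<eta>i by (intro Bochner_Integration.integral_diff[symmetric]) auto
      also have "\<dots> = (\<integral>y. \<eta> y *\<^sub>R (f (x - y) - f x) \<partial>lborel)"
        by (simp add: scaleR_diff_right)
      finally show "ennreal (norm (conv \<eta> f x - f x) powr p) \<le> (\<integral>\<^sup>+y. ennreal (\<eta> y * norm (f (x - y) - f x) powr p) \<partial>lborel)"
        using jensen_norm_powr[of "\<lambda>y. f (x - y) - f x" lborel \<eta> p] \<eta> \<eta>i p by simp
    qed
    also have "\<dots> = (\<integral>\<^sup>+y. \<integral>\<^sup>+x. ennreal (\<eta> y * norm (f (x - y) - f x) powr p) \<partial>lborel \<partial>lborel)"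
      by (rule lborel_pair.Fubini') measurable
    also have "\<dots> = (\<integral>\<^sup>+y. ennreal (\<eta> y) * Lp_mass p lborel (\<lambda>x. f (x - y) - f x) \<partial>lborel)"
      using \<eta>(2) by (subst nn_integral_cmult[symmetric]) (auto simp: ennreal_mult')
    also have "\<dots> \<le> (\<integral>\<^sup>+y. ennreal (\<eta> y) * ennreal (e / 2) \<partial>lborel)"
    proof (rule nn_integral_mono)
      fix y
      show "ennreal (\<eta> y) * Lp_mass p lborel (\<lambda>x. f (x - y) - f x) \<le> ennreal (\<eta> y) * ennreal (e / 2)"
        using \<eta>(4) d(2)[of y] by (cases "\<eta> y = 0") (auto intro!: mult_left_mono)
    qed
    also have "\<dots> = ennreal (e / 2)"
      using \<eta>(2,3) \<eta>i by (simp add: nn_integral_multc nn_integral_eq_integral)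
    also have "\<dots> < ennreal e" using e by (simp add: ennreal_less_iff)
    finally show "Lp_mass p lborel (\<lambda>x. conv \<eta> f x - f x) < ennreal e" .
  qed
qed

text \<open>Testing the weak derivative with \<open>\<lambda>y. \<eta> (x - y)\<close> gives
  \<open>grad (conv \<eta> f) = conv \<eta> g\<close>; the sign from the reflection cancels the one
  from integration by parts. Averaging with a nonnegative kernel of mass one keeps the upper bound
  \<open>M\<close>.\<close>

lemma weak_derivative_approx:
  fixes f :: "'a::euclidean_space \<Rightarrow> real" and g :: "'a \<Rightarrow> 'a"
  assumes f[measurable]: "f \<in> borel_measurable borel" and g[measurable]: "g \<in> borel_measurable borel" and p: "1 \<le> p"
    and fp: "Lp_mass p lborel f < \<infinity>"
    and gp: "Lp_mass p lborel g < \<infinity>"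
    and wk: "\<And>\<psi> b. \<psi> \<in> C1_compact UNIV \<Longrightarrow> b \<in> Basis \<Longrightarrow>
        (\<integral>x. f x * partial_derivative b \<psi> x \<partial>lborel) = - (\<integral>x. (g x \<bullet> b) * \<psi> x \<partial>lborel)"
    and M: "AE x in lborel. f x \<le> M" and e: "0 < e"
  shows "\<exists>\<psi>\<in>C1. (\<forall>x. \<psi> x \<le> M) \<and> Lp_mass p lborel (\<lambda>x. \<psi> x - f x) < ennreal e
     \<and> Lp_mass p lborel (\<lambda>x. grad \<psi> x - g x) < ennreal e"
proof -
  obtain d1 where d1: "d1 > 0" "\<forall>\<eta>. mollifier d1 \<eta> \<longrightarrow>
     Lp_mass p lborel (\<lambda>x. conv \<eta> f x - f x) < ennreal e"
    using conv_Lp_approx[OF f p fp e] by blast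
  obtain d2 where d2: "d2 > 0" "\<forall>\<eta>. mollifier d2 \<eta> \<longrightarrow>
     Lp_mass p lborel (\<lambda>x. conv \<eta> g x - g x) < ennreal e"
    using conv_Lp_approx[OF g p gp e] by blast
  obtain \<eta> :: "'a \<Rightarrow> real" where mol: "mollifier (min d1 d2) \<eta>"
    using mollifier_exists[of "min d1 d2"] d1 d2 by auto
  then have \<eta>: "\<eta> \<in> C1_compact UNIV" "\<forall>x. 0 \<le> \<eta> x" "(\<integral>x. \<eta> x \<partial>lborel) = 1"
    and mols: "mollifier d1 \<eta>" "mollifier d2 \<eta>"
    by (auto simp: mollifier_def)
  have c1: "\<eta> \<in> C1" using \<eta> by (simp add: C1_compact_iff)
  have [measurable]: "\<eta> \<in> borel_measurable borel"
    using c1 by (auto intro: C1_borel)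
  note fi = set_integrable_Lp[OF f p fp] and gi = set_integrable_Lp[OF g p gp]
  have cont: "continuous_on UNIV (conv \<eta> g)"
    by (intro continuous_at_imp_continuous_on ballI has_derivative_continuous[OF conv_has_derivative[OF g gi \<eta>(1)]])
  have der: "(conv \<eta> f has_derivative (\<lambda>k. conv \<eta> g x \<bullet> k)) (at x)" for x
  proof -
    define D where "D k = (\<integral>y. (grad \<eta> (x - y) \<bullet> k) *\<^sub>R f y \<partial>lborel)" for k
    have hd: "(conv \<eta> f has_derivative D) (at x)"
      unfolding D_def by (rule conv_has_derivative[OF f fi \<eta>(1)])
    interpret D: linear D using hd by (rule has_derivative_linear)
    have b: "D b = conv \<eta> g x \<bullet> b" if "b \<in> Basis" for b
    proof -
      have "partial_derivative b (\<lambda>y. \<eta> (x - y)) y = - (grad \<eta> (x - y) \<bullet> b)" for y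
        using grad_inner_Basis[OF that, of "\<lambda>y. \<eta> (x - y)" y] by (simp add: grad_reflect[OF c1])
      then have "- D b = (\<integral>y. f y * partial_derivative b (\<lambda>y. \<eta> (x - y)) y \<partial>lborel)"
        by (simp add: D_def mult.commute)
      also have "\<dots> = - (\<integral>y. (g y \<bullet> b) * \<eta> (x - y) \<partial>lborel)"
        by (rule wk[OF C1_compact_reflect[OF \<eta>(1)] that])
      also have "(\<integral>y. (g y \<bullet> b) * \<eta> (x - y) \<partial>lborel) = (\<integral>y. (\<eta> (x - y) *\<^sub>R g y) \<bullet> b \<partial>lborel)"
        by (simp add: mult.commute)
      also have "\<dots> = conv \<eta> g x \<bullet> b"
        unfolding conv_def by (rule integral_inner_left) (use conv_integrable(1)[OF g gi \<eta>(1)] in auto)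
      finally show ?thesis by simp
    qed
    have "D k = conv \<eta> g x \<bullet> k" for k
    proof -
      have "D k = D (\<Sum>b\<in>Basis. (k \<bullet> b) *\<^sub>R b)" by (simp add: euclidean_representation)
      also have "\<dots> = (\<Sum>b\<in>Basis. (k \<bullet> b) * (conv \<eta> g x \<bullet> b))" by (simp add: D.sum D.scale b)
      also have "\<dots> = conv \<eta> g x \<bullet> k" by (subst (3) euclidean_inner) (simp add: mult.commute)
      finally show ?thesis .
    qed
    then have "D = (\<lambda>k. conv \<eta> g x \<bullet> k)" by auto
    with hd show ?thesis by simp
  qed
  have bound: "conv \<eta> f x \<le> M" for x
  proof -
    have l: "lborel = distr lborel borel (\<lambda>y. x - y)"
      using lborel_affine[of "-1" x] by (simp add: density_1)
    have "conv \<eta> f x = (\<integral>y. \<eta> (x - y) * f y \<partial>lborel)" by (simp add: conv_def)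
    also have "\<dots> \<le> (\<integral>y. \<eta> (x - y) * M \<partial>lborel)"
    proof (rule integral_mono_AE)
      show "integrable lborel (\<lambda>y. \<eta> (x - y) * f y)"
        using conv_integrable(1)[OF f fi \<eta>(1)] by simp
      show "integrable lborel (\<lambda>y. \<eta> (x - y) * M)"
        using C1_compact_integrable(1)[OF C1_compact_reflect[OF \<eta>(1)]] by auto
      show "AE y in lborel. \<eta> (x - y) * f y \<le> \<eta> (x - y) * M"
        using M by eventually_elim (use \<eta>(2) in \<open>auto intro: mult_left_mono\<close>)
    qed
    also have "\<dots> = (\<integral>y. \<eta> (x - y) \<partial>lborel) * M" by simp
    also have "(\<integral>y. \<eta> (x - y) \<partial>lborel) = (\<integral>y. \<eta> y \<partial>lborel)"
      by (subst (2) l, subst integral_distr) auto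
    finally show ?thesis using \<eta>(3) by simp
  qed
  show ?thesis
  proof (intro bexI[of _ "conv \<eta> f"] conjI allI bound)
    show "conv \<eta> f \<in> C1" by (rule C1I(1)[OF der cont])
    have "grad (conv \<eta> f) = conv \<eta> g" by (rule C1I(2)[OF der cont])
    then show "Lp_mass p lborel (\<lambda>x. grad (conv \<eta> f) x - g x) < ennreal e"
      using d2 mols by auto
    show "Lp_mass p lborel (\<lambda>x. conv \<eta> f x - f x) < ennreal e"
      using d1 mols by auto
  qed
qed

section \<open>Uniqueness of weak gradients\<close>

text \<open>The convolution lemmas speak of Borel functions, while the function spaces consist of
  Lebesgue measurable ones; the coordinates are replaced one at a time.\<close>

lemma lebesgue_ex_borel:
  fixes f :: "'a::euclidean_space \<Rightarrow> 'b::euclidean_space"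
  assumes "f \<in> borel_measurable lebesgue"
  shows "\<exists>f'\<in>borel_measurable borel. AE x in lborel. f x = f' x"
proof -
  have "\<exists>h\<in>borel_measurable lborel. AE x in lborel. f x \<bullet> b = h x" for b
    using assms by (intro completion_ex_borel_measurable_real) auto
  then obtain h where h: "\<And>b. h b \<in> borel_measurable lborel" "\<And>b. AE x in lborel. f x \<bullet> b = h b x"
    by metis
  have [measurable]: "h b \<in> borel_measurable borel" for b using h(1) by simp
  have "AE x in lborel. \<forall>b\<in>Basis. f x \<bullet> b = h b x"
    using h(2) by (intro AE_finite_allI) auto
  then have "AE x in lborel. f x = (\<Sum>b\<in>Basis. h b x *\<^sub>R b)"
    by eventually_elim (subst euclidean_representation[symmetric], rule sum.cong, auto)
  then show ?thesis
    by (intro bexI[of _ "\<lambda>x. \<Sum>b\<in>Basis. h b x *\<^sub>R b"]) auto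
qed

lemma integral_lebesgue_on_eq_lborel:
  fixes f :: "'a::euclidean_space \<Rightarrow> 'b::euclidean_space"
  assumes "S \<in> sets lebesgue" "f \<in> borel_measurable borel" "\<And>x. x \<notin> S \<Longrightarrow> f x = 0"
  shows "(\<integral>x. f x \<partial>lebesgue_on S) = (\<integral>x. f x \<partial>lborel)"
proof -
  have "(\<integral>x. f x \<partial>lebesgue_on S) = (\<integral>x. indicator S x *\<^sub>R f x \<partial>lebesgue)"
    using assms by (intro integral_restrict_space) auto
  also have "\<dots> = (\<integral>x. f x \<partial>lebesgue)"
    using assms(3) by (intro Bochner_Integration.integral_cong) (auto simp: indicator_def)
  also have "\<dots> = (\<integral>x. f x \<partial>lborel)"
    using assms(2) by (intro integral_completion) auto
  finally show ?thesis .
qed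

lemma integral_translate_lborel:
  fixes f :: "'a::euclidean_space \<Rightarrow> 'b::euclidean_space"
  assumes [measurable]: "f \<in> borel_measurable borel"
  shows "(\<integral>x. f (x + y) \<partial>lborel) = (\<integral>x. f x \<partial>lborel)"
proof -
  have "(\<integral>x. f x \<partial>lborel) = (\<integral>x. f x \<partial>distr lborel borel ((+) y))"
    by (simp add: lborel_distr_plus)
  also have "\<dots> = (\<integral>x. f (y + x) \<partial>lborel)"
    by (subst integral_distr) auto
  finally show ?thesis by (simp add: add.commute)
qed

text \<open>By translation invariance every difference \<open>f (x + s *\<^sub>R b) - f x\<close>
  has integral zero; comparing it with the derivative through the uniform Taylor bound and dividing
  by the step leaves at most \<open>e * V\<close>.\<close>

lemma integral_grad_C1_compact:
  fixes f :: "'a::euclidean_space \<Rightarrow> real"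
  assumes f: "f \<in> C1_compact UNIV"
  shows "(\<integral>x. grad f x \<partial>lborel) = 0"
proof -
  obtain B R where B: "B > 0" "\<And>x. \<bar>f x\<bar> \<le> B" "\<And>x. norm (grad f x) \<le> B"
    "\<And>x. R < norm x \<Longrightarrow> f x = 0 \<and> grad f x = 0"
    using C1_compact_bounded[OF f] by blast
  note i = C1_compact_integrable[OF f]
  have [measurable]: "f \<in> borel_measurable borel"
    using f by (auto simp: C1_compact_iff intro: C1_borel)
  define V where "V = measure lborel (cball (0::'a) (R + 1))"
  have V: "V \<ge> 0" by (simp add: V_def)
  have small: "\<bar>(\<integral>x. grad f x \<partial>lborel) \<bullet> b\<bar> \<le> e * V" if b: "b \<in> Basis" and e: "0 < e" for b e
  proof -
    obtain d where d: "d > 0" "\<And>x k. norm k < d \<Longrightarrow> \<bar>f (x + k) - f x - grad f x \<bullet> k\<bar> \<le> e * norm k"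
      using C1_compact_uniform[OF f e] by blast
    \<comment> \<open>The bound \<open>s \<le> 1\<close> keeps \<open>f\<close> and its shift zero
      outside the ball of radius \<open>R + 1\<close>, whose volume is \<open>V\<close>.\<close>
    define s where "s = min (d / 2) 1"
    have s: "s > 0" "s < d" "s \<le> 1" using d(1) by (auto simp: s_def)
    have ns: "norm (s *\<^sub>R b) = s" using s b by simp
    have i1: "integrable lborel (\<lambda>x. f (x + s *\<^sub>R b))"
      using i(1) integrable_distr_eq[of "(+) (s *\<^sub>R b)" lborel borel f] by (simp add: lborel_distr_plus add.commute)
    have "s * ((\<integral>x. grad f x \<partial>lborel) \<bullet> b) = (\<integral>x. grad f x \<bullet> (s *\<^sub>R b) \<partial>lborel)"
      using i(2) by simp
    also have "\<dots> = (\<integral>x. grad f x \<bullet> (s *\<^sub>R b) - (f (x + s *\<^sub>R b) - f x) \<partial>lborel)"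
      using i i1 by (simp add: integral_translate_lborel)
    also have "\<bar>\<dots>\<bar> \<le> (\<integral>x. e * s * indicator (cball (0::'a) (R + 1)) x \<partial>lborel)"
      unfolding real_norm_def[symmetric]
    proof (rule order_trans[OF integral_norm_bound integral_mono])
      show "integrable lborel (\<lambda>x. norm (grad f x \<bullet> (s *\<^sub>R b) - (f (x + s *\<^sub>R b) - f x)))"
        using i i1 by (intro integrable_norm) auto
      show "integrable lborel (\<lambda>x. e * s * indicator (cball (0::'a) (R + 1)) x)"
        using emeasure_lborel_cball_finite[of "0::'a" "R + 1"]
        by (intro integrable_mult_right integrable_real_indicator) auto
      fix x :: 'a
      show "norm (grad f x \<bullet> (s *\<^sub>R b) - (f (x + s *\<^sub>R b) - f x)) \<le> e * s * indicator (cball 0 (R + 1)) x"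
      proof (cases "norm x \<le> R + 1")
        case True
        then show ?thesis using d(2)[of "s *\<^sub>R b" x] s ns by (simp add: abs_minus_commute)
      next
        case False
        have "norm x \<le> norm (x + s *\<^sub>R b) + norm (s *\<^sub>R b)"
          using norm_triangle_ineq4[of "x + s *\<^sub>R b" "s *\<^sub>R b"] by simp
        then have "R < norm (x + s *\<^sub>R b)" using False s ns by linarith
        then show ?thesis using False B(4)[of x] B(4)[of "x + s *\<^sub>R b"] by simp
      qed
    qed
    also have "\<dots> = s * (e * V)" by (simp add: V_def)
    finally show ?thesis using s by (simp add: abs_mult)
  qed
  have "(\<integral>x. grad f x \<partial>lborel) \<bullet> b = 0" if b: "b \<in> Basis" for b
  proof -
    have "\<bar>(\<integral>x. grad f x \<partial>lborel) \<bullet> b\<bar> \<le> e" if "0 < e" for e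
    proof -
      have "\<bar>(\<integral>x. grad f x \<partial>lborel) \<bullet> b\<bar> \<le> e / (V + 1) * V"
        using that V by (intro small b) auto
      also have "\<dots> \<le> e" using that V by (simp add: field_simps)
      finally show ?thesis .
    qed
    then show ?thesis by (metis abs_ge_zero abs_le_zero_iff field_le_epsilon add_0)
  qed
  then show ?thesis by (metis euclidean_all_zero_iff)
qed

lemma locally_integrable_scaleR:
  fixes f :: "'a::euclidean_space \<Rightarrow> 'b::euclidean_space"
  assumes S: "open S" and f: "locally_integrable S f" and K: "compact K" "K \<subseteq> S"
    and [measurable]: "q \<in> borel_measurable borel" and q: "\<And>x. \<bar>q x\<bar> \<le> B" "\<And>x. x \<notin> K \<Longrightarrow> q x = 0"
  shows "integrable (lebesgue_on S) (\<lambda>x. q x *\<^sub>R f x)"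
proof -
  have [measurable]: "K \<in> sets lebesgue" "S \<in> sets lebesgue"
    using K S by (auto intro: lmeasurable_compact fmeasurableD)
  have "integrable (lebesgue_on K) f" using f K by (auto simp: locally_integrable_def)
  then have i: "integrable lebesgue (\<lambda>x. indicator K x *\<^sub>R f x)"
    by (subst (asm) integrable_restrict_space) auto
  have "q \<in> borel_measurable lebesgue"
    by (intro measurable_completion) simp
  then have "integrable lebesgue (\<lambda>x. q x *\<^sub>R (indicator K x *\<^sub>R f x))"
  proof (intro Bochner_Integration.integrable_bound[OF integrable_mult_right[OF integrable_norm[OF i], of B]] AE_I2)
    show "(\<lambda>x. q x *\<^sub>R (indicator K x *\<^sub>R f x)) \<in> borel_measurable lebesgue" if "q \<in> borel_measurable lebesgue"
      by (intro borel_measurable_scaleR that borel_measurable_integrable[OF i])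
    fix x
    have "\<bar>q x\<bar> * norm (indicator K x *\<^sub>R f x) \<le> B * norm (indicator K x *\<^sub>R f x)"
      by (intro mult_right_mono q) auto
    then show "norm (q x *\<^sub>R (indicator K x *\<^sub>R f x)) \<le> norm (B * norm (indicator K x *\<^sub>R f x))"
      using abs_ge_self[of "B * norm (indicator K x *\<^sub>R f x)"] by (simp only: norm_scaleR real_norm_def)
  qed
  also have "(\<lambda>x. q x *\<^sub>R (indicator K x *\<^sub>R f x)) = (\<lambda>x. indicator S x *\<^sub>R (q x *\<^sub>R f x))"
    using q(2) K(2) by (auto simp: indicator_def fun_eq_iff)
  finally show ?thesis
    by (subst integrable_restrict_space) auto
qed

lemma
  assumes S: "open S" and f: "locally_integrable S f" and \<psi>: "\<psi> \<in> C1_compact S"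
  shows locally_integrable_mult_C1_compact: "integrable (lebesgue_on S) (\<lambda>x. \<psi> x *\<^sub>R f x)"
    and locally_integrable_mult_partial_derivative:
      "b \<in> Basis \<Longrightarrow> integrable (lebesgue_on S) (\<lambda>x. partial_derivative b \<psi> x *\<^sub>R f x)"
proof -
  obtain K where K: "compact K" "K \<subseteq> S" "\<And>x. x \<notin> K \<Longrightarrow> \<psi> x = 0" and c: "\<psi> \<in> C1"
    using \<psi> by (auto simp: C1_compact_iff)
  obtain B where B: "\<And>x. \<bar>\<psi> x\<bar> \<le> B" "\<And>x. norm (grad \<psi> x) \<le> B"
    using C1_compact_bounded[of \<psi>] \<psi> C1_compact_mono[of S UNIV] by blast
  show "integrable (lebesgue_on S) (\<lambda>x. \<psi> x *\<^sub>R f x)"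
    by (rule locally_integrable_scaleR[OF S f K(1,2) C1_borel[OF c] B(1) K(3)])
  assume b: "b \<in> Basis"
  have e: "partial_derivative b \<psi> = (\<lambda>x. grad \<psi> x \<bullet> b)" using grad_inner_Basis[OF b] by auto
  have [measurable]: "grad \<psi> \<in> borel_measurable borel" by (rule C1_grad_borel[OF c])
  show "integrable (lebesgue_on S) (\<lambda>x. partial_derivative b \<psi> x *\<^sub>R f x)"
    unfolding e
  proof (rule locally_integrable_scaleR[OF S f K(1,2), where B=B])
    show "\<bar>grad \<psi> x \<bullet> b\<bar> \<le> B" for x
      using Basis_le_norm[OF b, of "grad \<psi> x"] B(2)[of x] by linarith
    show "grad \<psi> x \<bullet> b = 0" if "x \<notin> K" for x
      using C1_zero_outside_grad[OF c compact_imp_closed[OF K(1)] K(3)] that by simp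
  qed measurable
qed

text \<open>Localise with a bump \<open>\<theta>\<close>: the product \<open>k\<close> of
  \<open>\<theta>\<close> and \<open>h\<close> is integrable on the whole space, and
  \<open>\<lambda>y. \<theta> y * \<eta> (x - y)\<close> is a legitimate test function, so every
  mollification of \<open>k\<close> is zero. Since mollifications converge to \<open>k\<close> in
  L^1, \<open>k\<close> vanishes almost everywhere, and so does \<open>h\<close> where
  \<open>\<theta>\<close> is positive.\<close>

lemma fundamental_lemma_calculus_of_variations:
  fixes h :: "'a::euclidean_space \<Rightarrow> real"
  assumes S: "open S" and h: "locally_integrable S h"
    and z: "\<And>\<psi>. \<psi> \<in> C1_compact S \<Longrightarrow> (\<integral>x. h x * \<psi> x \<partial>lebesgue_on S) = 0"
  shows "AE x in lebesgue_on S. h x = 0"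
proof -
  have ball: "negligible {x \<in> ball a r. h x \<noteq> 0}" if r: "0 < r" and sub: "cball a r \<subseteq> S" for a r
  proof -
    obtain \<theta> where \<theta>: "\<theta> \<in> C1_compact (cball a r)" "\<And>x. 0 < \<theta> x \<longleftrightarrow> x \<in> ball a r"
      using C1_compact_bump[OF r] by blast
    have \<theta>S: "\<theta> \<in> C1_compact S" using \<theta>(1) C1_compact_mono[OF sub] by blast
    have [measurable]: "S \<in> sets lebesgue" using S by auto
    have [measurable]: "\<theta> \<in> borel_measurable borel" using \<theta>S by (auto simp: C1_compact_iff intro: C1_borel)
    define k where "k x = indicator S x *\<^sub>R (\<theta> x * h x)" for x
    have ik: "integrable lebesgue k"
      using locally_integrable_mult_C1_compact[OF S h \<theta>S] unfolding k_def
      by (subst (asm) integrable_restrict_space) auto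
    obtain k' where k'[measurable]: "k' \<in> borel_measurable borel" and kk': "AE x in lborel. k x = k' x"
      using lebesgue_ex_borel[of k] ik by auto
    have "integrable lebesgue k'"
      using ik kk' by (subst integrable_cong_AE[where g=k]) (auto intro: measurable_completion AE_completion)
    then have ik': "integrable lborel k'"
      by (simp add: integrable_completion)
    then have fin: "Lp_mass 1 lborel k' < \<infinity>"
      by (simp add: integrable_iff_bounded)
    have small: "(\<integral>\<^sup>+x. ennreal (norm (k' x)) \<partial>lborel) \<le> ennreal e" if e: "0 < e" for e
    proof -
      obtain d where d: "d > 0" "\<forall>\<eta>. mollifier d \<eta> \<longrightarrow>
         Lp_mass 1 lborel (\<lambda>x. conv \<eta> k' x - k' x) < ennreal e"
        using conv_Lp_approx[OF k' order_refl fin e] by blast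
      obtain \<eta> :: "'a \<Rightarrow> real" where mol: "mollifier d \<eta>"
        using mollifier_exists[OF d(1)] by auto
      then have \<eta>: "\<eta> \<in> C1_compact UNIV" by (simp add: mollifier_def)
      have [measurable]: "\<eta> \<in> borel_measurable borel" using \<eta> by (auto simp: C1_compact_iff intro: C1_borel)
      have "conv \<eta> k' x = 0" for x
      proof -
        have 1: "(\<lambda>y. \<theta> y * \<eta> (x - y)) \<in> C1_compact S"
          using \<eta> by (intro C1_compact_mult[OF \<theta>S] C1_reflect) (auto simp: C1_compact_iff)
        have "conv \<eta> k' x = (\<integral>y. \<eta> (x - y) * k' y \<partial>lebesgue)"
          unfolding conv_def by (subst integral_completion) auto
        also have "\<dots> = (\<integral>y. \<eta> (x - y) * k y \<partial>lebesgue)"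
        proof (intro integral_cong_AE borel_measurable_times)
          show "AE y in lebesgue. \<eta> (x - y) * k' y = \<eta> (x - y) * k y"
            using AE_completion[OF kk'] by eventually_elim simp
        qed (use ik in \<open>auto intro!: measurable_completion\<close>)
        also have "\<dots> = (\<integral>y. indicator S y *\<^sub>R (h y * (\<theta> y * \<eta> (x - y))) \<partial>lebesgue)"
          by (intro Bochner_Integration.integral_cong) (auto simp: k_def)
        also have "\<dots> = (\<integral>y. h y * (\<theta> y * \<eta> (x - y)) \<partial>lebesgue_on S)"
          by (subst integral_restrict_space) auto
        also have "\<dots> = 0" by (rule z[OF 1])
        finally show ?thesis .
      qed
      then show ?thesis using d(2) mol by (auto intro: less_imp_le)
    qed
    have "(\<integral>\<^sup>+x. ennreal (norm (k' x)) \<partial>lborel) \<le> 0"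
    proof (rule ennreal_le_epsilon)
      fix e :: real assume "0 < e"
      from small[OF this] show "(\<integral>\<^sup>+x. ennreal (norm (k' x)) \<partial>lborel) \<le> 0 + ennreal e"
        by (simp only: add_0)
    qed
    then have "(\<integral>\<^sup>+x. ennreal (norm (k' x)) \<partial>lborel) = 0" by (simp only: le_zero_eq)
    then have "AE x in lborel. ennreal (norm (k' x)) = 0"
      by (subst (asm) nn_integral_0_iff_AE) measurable
    then have "AE x in lborel. k' x = 0" by eventually_elim simp
    with kk' have "AE x in lborel. k x = 0" by eventually_elim simp
    then have "AE x in lborel. \<not> (x \<in> ball a r \<and> h x \<noteq> 0)"
    proof eventually_elim
      case (elim x)
      show ?case
      proof
        assume *: "x \<in> ball a r \<and> h x \<noteq> 0"
        then have "x \<in> S" "\<theta> x > 0" using sub \<theta>(2) by auto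
        then show False using elim * by (simp add: k_def)
      qed
    qed
    then have "AE x in lebesgue. \<not> (x \<in> ball a r \<and> h x \<noteq> 0)" by (rule AE_completion)
    then obtain N where "N \<in> null_sets lebesgue" "{x \<in> ball a r. h x \<noteq> 0} \<subseteq> N"
      unfolding eventually_ae_filter by auto
    then show ?thesis
      using negligible_iff_null_sets negligible_subset by blast
  qed
  \<comment> \<open>Countably many of these balls cover \<open>S\<close>, so the null sets found on
    single balls unite to a null set.\<close>
  define F where "F = {ball a r | a r. 0 < r \<and> cball a r \<subseteq> S}"
  have "\<And>U. U \<in> F \<Longrightarrow> open U" by (auto simp: F_def)
  then obtain F' where F': "F' \<subseteq> F" "countable F'" "\<Union>F' = \<Union>F" by (rule Lindelof)
  have "S \<subseteq> \<Union>F"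
  proof
    fix x assume "x \<in> S"
    then obtain r where "r > 0" "cball x r \<subseteq> S" using S open_contains_cball by blast
    then have "ball x r \<in> F" "x \<in> ball x r" by (auto simp: F_def)
    then show "x \<in> \<Union>F" by blast
  qed
  moreover have "negligible (\<Union>U\<in>F'. {x \<in> U. h x \<noteq> 0})"
    using F'(1,2) ball by (intro negligible_countable_Union countable_image) (auto simp: F_def)
  ultimately have "negligible {x \<in> S. h x \<noteq> 0}"
    using F'(3) by (elim negligible_subset) auto
  then have "{x \<in> S. h x \<noteq> 0} \<in> null_sets lebesgue" by (simp add: negligible_iff_null_sets)
  then have "AE x in lebesgue. x \<notin> {x \<in> S. h x \<noteq> 0}" by (rule AE_not_in)
  then show ?thesis
    using S by (subst AE_restrict_space_iff) (auto elim!: eventually_mono)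
qed

text \<open>Gives a definite meaning to \<open>weak_gradient\<close>, which selects some weak
  gradient by \<open>SOME\<close>.\<close>

lemma weak_gradient_unique:
  fixes u :: "'a::euclidean_space \<Rightarrow> real"
  assumes S: "open S" and g1: "has_weak_gradient S u g1" and g2: "has_weak_gradient S u g2"
  shows "AE x in lebesgue_on S. g1 x = g2 x"
proof -
  have l1: "locally_integrable S g1" and l2: "locally_integrable S g2"
    using g1 g2 by (auto simp: has_weak_gradient_def)
  have l: "locally_integrable S (\<lambda>x. g1 x \<bullet> b)" "locally_integrable S (\<lambda>x. g2 x \<bullet> b)" for b
    using l1 l2 by (auto simp: locally_integrable_def)
  have "AE x in lebesgue_on S. (g1 x \<bullet> b) - (g2 x \<bullet> b) = 0" if b: "b \<in> Basis" for b
  proof (rule fundamental_lemma_calculus_of_variations[OF S])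
    show "locally_integrable S (\<lambda>x. (g1 x \<bullet> b) - (g2 x \<bullet> b))"
      using l unfolding locally_integrable_def by auto
    fix \<psi> assume \<psi>: "\<psi> \<in> C1_compact S"
    have "(\<integral>x. (g1 x \<bullet> b) * \<psi> x \<partial>lebesgue_on S) = (\<integral>x. (g2 x \<bullet> b) * \<psi> x \<partial>lebesgue_on S)"
    proof -
      have "(\<integral>x. u x * partial_derivative b \<psi> x \<partial>lebesgue_on S) = - (\<integral>x. (g1 x \<bullet> b) * \<psi> x \<partial>lebesgue_on S)"
        using g1 \<psi> b unfolding has_weak_gradient_def by blast
      moreover have "(\<integral>x. u x * partial_derivative b \<psi> x \<partial>lebesgue_on S) = - (\<integral>x. (g2 x \<bullet> b) * \<psi> x \<partial>lebesgue_on S)"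
        using g2 \<psi> b unfolding has_weak_gradient_def by blast
      ultimately show ?thesis by linarith
    qed
    moreover have "integrable (lebesgue_on S) (\<lambda>x. (g1 x \<bullet> b) * \<psi> x)" "integrable (lebesgue_on S) (\<lambda>x. (g2 x \<bullet> b) * \<psi> x)"
      using locally_integrable_mult_C1_compact[OF S l(1) \<psi>] locally_integrable_mult_C1_compact[OF S l(2) \<psi>]
      by (simp_all add: mult.commute)
    ultimately show "(\<integral>x. ((g1 x \<bullet> b) - (g2 x \<bullet> b)) * \<psi> x \<partial>lebesgue_on S) = 0"
      by (simp add: left_diff_distrib)
  qed
  then have "AE x in lebesgue_on S. \<forall>b\<in>Basis. (g1 x \<bullet> b) - (g2 x \<bullet> b) = 0"
    by (intro AE_finite_allI) auto
  then show ?thesis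
    by eventually_elim (auto intro: euclidean_eqI)
qed

section \<open>Strong approximation by \<open>C\<^sup>1\<close> functions\<close>

text \<open>The p-th power of the L^p distance, possibly infinite; it satisfies the triangle
  inequality only up to the factor \<open>2 powr p\<close>.\<close>

definition Lpd :: "real \<Rightarrow> 'a::euclidean_space set \<Rightarrow> ('a \<Rightarrow> 'b::euclidean_space) \<Rightarrow> ('a \<Rightarrow> 'b) \<Rightarrow> ennreal" where
  "Lpd p \<Omega> f g = Lp_mass p (lebesgue_on \<Omega>) (\<lambda>x. f x - g x)"

text \<open>The pair lies in the L^p closure of the graph of \<open>grad\<close> over
  \<open>S\<close>. Conditions at the boundary live in the choice of \<open>S\<close>, and the
  explicit witness \<open>g\<close> lets pairs be manipulated without weak derivatives.\<close>

definition approx :: "real \<Rightarrow> 'a::euclidean_space set \<Rightarrow> ('a \<Rightarrow> real) set \<Rightarrow> ('a \<Rightarrow> real) \<Rightarrow> ('a \<Rightarrow> 'a) \<Rightarrow> bool" where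
  "approx p \<Omega> S f g \<longleftrightarrow> f \<in> borel_measurable (lebesgue_on \<Omega>) \<and> g \<in> borel_measurable (lebesgue_on \<Omega>) \<and>
     (\<forall>e>0. \<exists>\<psi>\<in>S. Lpd p \<Omega> \<psi> f < ennreal e \<and> Lpd p \<Omega> (grad \<psi>) g < ennreal e)"

lemma Lpd_commute: "Lpd p \<Omega> f g = Lpd p \<Omega> g f"
  by (simp add: Lpd_def norm_minus_commute)

section \<open>Distances and closure properties of approximable pairs on the domain\<close>

locale bounded_domain =
  fixes \<Omega> :: "'a::euclidean_space set" and p :: real
  assumes open_domain: "open \<Omega>" and bounded_domain: "bounded \<Omega>" and p: "1 \<le> p"
begin

abbreviation \<mu> where "\<mu> \<equiv> lebesgue_on \<Omega>"
abbreviation D where "D f g \<equiv> Lpd p \<Omega> f g"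

lemma domain_lebesgue [measurable]: "\<Omega> \<in> sets lebesgue"
  using open_domain by auto

lemma finite_measure_domain: "finite_measure \<mu>"
  using open_domain bounded_domain by (intro finite_measure_lebesgue_on lmeasurable_open)

lemma borel_measurable_domain: "f \<in> borel_measurable borel \<Longrightarrow> f \<in> borel_measurable \<mu>"
  by (intro measurable_restrict_space1 measurable_completion) simp

lemma Lpd_triangle:
  assumes [measurable]: "f \<in> borel_measurable \<mu>" "g \<in> borel_measurable \<mu>" "h \<in> borel_measurable \<mu>"
  shows "D f h \<le> ennreal (2 powr p) * (D f g + D g h)"
  using nn_integral_norm_add_powr_le[of "\<lambda>x. f x - g x" \<mu> "\<lambda>x. g x - h x" p] p
  by (simp add: Lpd_def)

text \<open>Origin of the thresholds \<open>e / (2 * 2 powr p)\<close>: two such errors, multiplied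
  by the constant of the triangle inequality, give \<open>e\<close>.\<close>

lemma Lpd_less:
  assumes "f \<in> borel_measurable \<mu>" "g \<in> borel_measurable \<mu>" "h \<in> borel_measurable \<mu>"
    and "D f g < ennreal (e / (2 * 2 powr p))" "D g h < ennreal (e / (2 * 2 powr p))"
  shows "D f h < ennreal e"
proof -
  have e: "0 < e"
    using assms(4) by (cases "0 < e") (auto simp: ennreal_neg divide_nonpos_pos not_less)
  have "D f h \<le> ennreal (2 powr p) * (D f g + D g h)"
    by (rule Lpd_triangle assms)+
  also have "\<dots> < ennreal (2 powr p) * (ennreal (e / (2 * 2 powr p)) + ennreal (e / (2 * 2 powr p)))"
    by (intro ennreal_mult_strict_left_mono add_strict_mono assms) auto
  also have "\<dots> = ennreal e"
    using e by (simp flip: ennreal_plus ennreal_mult)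
  finally show ?thesis .
qed

lemma Lpd_comb:
  assumes [measurable]: "a \<in> borel_measurable \<mu>" "b \<in> borel_measurable \<mu>" "f \<in> borel_measurable \<mu>" "g \<in> borel_measurable \<mu>"
  shows "D (\<lambda>x. a x + c *\<^sub>R b x) (\<lambda>x. f x + c *\<^sub>R g x) \<le> ennreal (2 powr p) * (D a f + ennreal (\<bar>c\<bar> powr p) * D b g)"
proof -
  have "D (\<lambda>x. a x + c *\<^sub>R b x) (\<lambda>x. f x + c *\<^sub>R g x)
      = Lp_mass p \<mu> (\<lambda>x. (a x - f x) + c *\<^sub>R (b x - g x))"
    by (simp add: Lpd_def algebra_simps)
  also have "\<dots> \<le> ennreal (2 powr p) * (Lp_mass p \<mu> (\<lambda>x. a x - f x)
        + Lp_mass p \<mu> (\<lambda>x. c *\<^sub>R (b x - g x)))"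
    using p by (intro nn_integral_norm_add_powr_le) auto
  also have "Lp_mass p \<mu> (\<lambda>x. c *\<^sub>R (b x - g x)) = ennreal (\<bar>c\<bar> powr p) * D b g"
    unfolding Lpd_def by (subst nn_integral_cmult[symmetric]) (auto simp: powr_mult ennreal_mult')
  finally show ?thesis by (simp add: Lpd_def)
qed

lemma Lpd_dominated:
  assumes [measurable]: "\<And>n. F n \<in> borel_measurable \<mu>" "f \<in> borel_measurable \<mu>" "w \<in> borel_measurable \<mu>"
    and lim: "\<And>x. x \<in> \<Omega> \<Longrightarrow> (\<lambda>n. F n x) \<longlonglongrightarrow> f x"
    and dom: "\<And>n x. x \<in> \<Omega> \<Longrightarrow> norm (F n x - f x) \<le> norm (w x)"
    and w: "Lp_mass p \<mu> w < \<infinity>"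
  shows "(\<lambda>n. D (F n) f) \<longlonglongrightarrow> 0"
proof -
  have "(\<lambda>n. \<integral>\<^sup>+x. ennreal (norm (F n x - f x) powr p) \<partial>\<mu>) \<longlonglongrightarrow> (\<integral>\<^sup>+x. 0 \<partial>\<mu>)"
  proof (rule nn_integral_dominated_convergence[where w="\<lambda>x. ennreal (norm (w x) powr p)"])
    show "AE x in \<mu>. ennreal (norm (F n x - f x) powr p) \<le> ennreal (norm (w x) powr p)" for n
      using dom p by (intro AE_I2 ennreal_leI powr_mono2) auto
    show "AE x in \<mu>. (\<lambda>n. ennreal (norm (F n x - f x) powr p)) \<longlonglongrightarrow> 0"
    proof (rule AE_I2)
      fix x assume "x \<in> space \<mu>"
      then have "(\<lambda>n. norm (F n x - f x)) \<longlonglongrightarrow> 0"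
        using lim[of x] by (simp add: LIM_zero tendsto_norm_zero)
      then have "(\<lambda>n. norm (F n x - f x) powr p) \<longlonglongrightarrow> 0 powr p"
        using p by (intro tendsto_powr2) auto
      then show "(\<lambda>n. ennreal (norm (F n x - f x) powr p)) \<longlonglongrightarrow> 0"
        using p tendsto_ennrealI by fastforce
    qed
  qed (use w in auto)
  then show ?thesis by (simp add: Lpd_def)
qed

lemma Lp_spaceI:
  assumes "f \<in> borel_measurable \<mu>" "Lp_mass p \<mu> f < \<infinity>"
  shows "f \<in> Lp_space p \<Omega>"
  using assms by (auto simp: Lp_space_def intro!: integrableI_bounded)

lemma Lp_spaceD:
  assumes "f \<in> Lp_space p \<Omega>"
  shows "f \<in> borel_measurable \<mu>" "Lp_mass p \<mu> f < \<infinity>"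
    "D f (\<lambda>_. 0) < \<infinity>" "integrable \<mu> f"
proof -
  show m[measurable]: "f \<in> borel_measurable \<mu>" and i: "Lp_mass p \<mu> f < \<infinity>"
    using assms by (auto simp: Lp_space_def integrable_iff_bounded)
  then show "D f (\<lambda>_. 0) < \<infinity>" by (simp add: Lpd_def)
  interpret finite_measure \<mu> by (rule finite_measure_domain)
  show "integrable \<mu> f"
  proof (rule Bochner_Integration.integrable_bound)
    show "integrable \<mu> (\<lambda>x. 1 + norm (f x) powr p)"
      using assms by (auto simp: Lp_space_def)
    show "AE x in \<mu>. norm (f x) \<le> norm (1 + norm (f x) powr p)"
      using le_1_add_powr[OF norm_ge_zero p] by (intro AE_I2) auto
  qed measurable
qed

lemma bounded_Lp_space:
  assumes "f \<in> borel_measurable \<mu>" "\<And>x. x \<in> \<Omega> \<Longrightarrow> norm (f x) \<le> B"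
  shows "f \<in> Lp_space p \<Omega>"
proof -
  interpret finite_measure \<mu> by (rule finite_measure_domain)
  have "integrable \<mu> (\<lambda>x. norm (f x) powr p)"
  proof (rule integrable_const_bound[where B="\<bar>B\<bar> powr p"])
    show "AE x in \<mu>. norm (norm (f x) powr p) \<le> \<bar>B\<bar> powr p"
      using assms(2) p by (intro AE_I2) (auto intro!: powr_mono2 order_trans[OF assms(2) abs_ge_self])
  qed (use assms(1) in measurable)
  then show ?thesis using assms(1) by (simp add: Lp_space_def)
qed

lemma Lp_space_near:
  assumes f: "f \<in> Lp_space p \<Omega>" and g: "g \<in> borel_measurable \<mu>" and "D f g < \<infinity>"
  shows "g \<in> Lp_space p \<Omega>"
proof -
  have "D g (\<lambda>_. 0) \<le> ennreal (2 powr p) * (D g f + D f (\<lambda>_. 0))"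
    using Lp_spaceD[OF f] g by (intro Lpd_triangle) auto
  also have "\<dots> < \<infinity>"
    using assms(3) Lp_spaceD(3)[OF f] by (auto simp: Lpd_commute[of _ _ g] ennreal_mult_less_top)
  finally show ?thesis using g by (intro Lp_spaceI) (auto simp: Lpd_def)
qed

lemma continuous_Lp_space:
  assumes "continuous_on UNIV f"
  shows "f \<in> Lp_space p \<Omega>"
proof -
  have "compact (f ` closure \<Omega>)"
    using assms bounded_domain
    by (intro compact_continuous_image) (auto intro: continuous_on_subset simp: compact_closure)
  then obtain B where B: "\<And>x. x \<in> closure \<Omega> \<Longrightarrow> norm (f x) \<le> B"
    using compact_imp_bounded bounded_iff by (metis imageI)
  show ?thesis
    using B closure_subset[of \<Omega>] assms
    by (intro bounded_Lp_space[of _ B] borel_measurable_domain borel_measurable_continuous_onI) auto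
qed

lemma C1_Lp_space: "f \<in> C1 \<Longrightarrow> f \<in> Lp_space p \<Omega>" "f \<in> C1 \<Longrightarrow> grad f \<in> Lp_space p \<Omega>"
  by (auto intro: continuous_Lp_space C1_continuous C1_continuous_grad)

lemma C1_measurable_domain: "f \<in> C1 \<Longrightarrow> f \<in> borel_measurable \<mu>" "f \<in> C1 \<Longrightarrow> grad f \<in> borel_measurable \<mu>"
  using C1_Lp_space Lp_spaceD(1) by blast+

lemma approx_Lp_space:
  assumes "approx p \<Omega> S f g" "S \<subseteq> C1"
  shows "f \<in> Lp_space p \<Omega>" "g \<in> Lp_space p \<Omega>"
proof -
  obtain \<psi> where "\<psi> \<in> C1" "D \<psi> f < ennreal 1" "D (grad \<psi>) g < ennreal 1"
    using assms unfolding approx_def by (meson subsetD zero_less_one)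
  moreover from this have "D \<psi> f < \<infinity>" "D (grad \<psi>) g < \<infinity>"
    by (auto elim: order.strict_trans)
  ultimately show "f \<in> Lp_space p \<Omega>" "g \<in> Lp_space p \<Omega>"
    using assms(1) C1_Lp_space[of \<psi>] Lp_space_near[of \<psi> f] Lp_space_near[of "grad \<psi>" g]
    by (auto simp: approx_def)
qed

lemma approx_closed:
  assumes "f \<in> borel_measurable \<mu>" "g \<in> borel_measurable \<mu>" "S \<subseteq> C1"
    and "\<And>e. 0 < e \<Longrightarrow> \<exists>f' g'. approx p \<Omega> S f' g' \<and> D f' f < ennreal e \<and> D g' g < ennreal e"
  shows "approx p \<Omega> S f g"
  unfolding approx_def
proof (intro conjI allI impI assms(1,2))
  fix e :: real assume "0 < e"
  define e1 where "e1 = e / (2 * 2 powr p)"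
  have e1: "0 < e1" using \<open>0 < e\<close> by (simp add: e1_def)
  obtain f' g' where *: "approx p \<Omega> S f' g'" "D f' f < ennreal e1" "D g' g < ennreal e1"
    using assms(4)[OF e1] by blast
  then obtain \<psi> where **: "\<psi> \<in> S" "D \<psi> f' < ennreal e1" "D (grad \<psi>) g' < ennreal e1"
    using e1 unfolding approx_def by blast
  have "D \<psi> f < ennreal e" "D (grad \<psi>) g < ennreal e"
    using * ** assms C1_measurable_domain[of \<psi>]
    by (auto simp: e1_def approx_def intro: Lpd_less)
  then show "\<exists>\<psi>\<in>S. D \<psi> f < ennreal e \<and> D (grad \<psi>) g < ennreal e"
    using **(1) by blast
qed

lemma approx_closed_seq:
  assumes "f \<in> borel_measurable \<mu>" "g \<in> borel_measurable \<mu>" "S \<subseteq> C1"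
    and "\<And>n. approx p \<Omega> S (F n) (G n)" "(\<lambda>n. D (F n) f) \<longlonglongrightarrow> 0" "(\<lambda>n. D (G n) g) \<longlonglongrightarrow> 0"
  shows "approx p \<Omega> S f g"
proof (rule approx_closed[OF assms(1-3)])
  fix e :: real assume "0 < e"
  then have "eventually (\<lambda>n. D (F n) f < ennreal e) sequentially" "eventually (\<lambda>n. D (G n) g < ennreal e) sequentially"
    by (intro order_tendstoD(2)[OF assms(5)] order_tendstoD(2)[OF assms(6)]; simp)+
  then have "eventually (\<lambda>n. D (F n) f < ennreal e \<and> D (G n) g < ennreal e) sequentially"
    by (rule eventually_conj)
  then show "\<exists>f' g'. approx p \<Omega> S f' g' \<and> D f' f < ennreal e \<and> D g' g < ennreal e"
    using assms(4) by (auto simp: eventually_sequentially)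
qed

lemma approx_self:
  assumes "f \<in> S" "S \<subseteq> C1"
  shows "approx p \<Omega> S f (grad f)"
  using assms C1_measurable_domain[of f] p
  by (auto simp: approx_def Lpd_def intro!: bexI[of _ f])

text \<open>The classes of the two summands may differ and are tied to \<open>U\<close> only by the
  rule \<open>cl\<close>: adding a compactly supported function to one bounded by \<open>M\<close>,
  or subtracting a nonnegative wave, are instances.\<close>

lemma approx_comb:
  assumes f: "approx p \<Omega> S f f'" and g: "approx p \<Omega> T g g'" and ST: "S \<subseteq> C1" "T \<subseteq> C1"
    and cl: "\<And>a b. a \<in> S \<Longrightarrow> b \<in> T \<Longrightarrow> (\<lambda>x. a x + c * b x) \<in> U"
  shows "approx p \<Omega> U (\<lambda>x. f x + c * g x) (\<lambda>x. f' x + c *\<^sub>R g' x)"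
  unfolding approx_def
proof (intro conjI allI impI)
  have m[measurable]: "f \<in> borel_measurable \<mu>" "f' \<in> borel_measurable \<mu>" "g \<in> borel_measurable \<mu>" "g' \<in> borel_measurable \<mu>"
    using f g by (auto simp: approx_def)
  show "(\<lambda>x. f x + c * g x) \<in> borel_measurable \<mu>" "(\<lambda>x. f' x + c *\<^sub>R g' x) \<in> borel_measurable \<mu>"
    by measurable
  fix e :: real assume e: "0 < e"
  define k where "k = 1 + \<bar>c\<bar> powr p"
  have k: "k > 0" by (auto simp: k_def add_pos_nonneg)
  define e1 where "e1 = e / (2 * (2 powr p * k))"
  have e1: "0 < e1" using e k by (simp add: e1_def)
  obtain a where a: "a \<in> S" "D a f < ennreal e1" "D (grad a) f' < ennreal e1"
    using f e1 unfolding approx_def by blast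
  obtain b where b: "b \<in> T" "D b g < ennreal e1" "D (grad b) g' < ennreal e1"
    using g e1 unfolding approx_def by blast
  have ab: "a \<in> C1" "b \<in> C1" using a b ST by auto
  have gr: "grad (\<lambda>x. a x + c * b x) = (\<lambda>x. grad a x + c *\<^sub>R grad b x)"
    using grad_add[OF ab(1) C1_cmult[OF ab(2)]] grad_cmult[OF ab(2)] by simp
  have bound: "ennreal (2 powr p) * (X + ennreal (\<bar>c\<bar> powr p) * Y) < ennreal e"
    if "X < ennreal e1" "Y < ennreal e1" for X Y
  proof -
    have "ennreal (2 powr p) * (X + ennreal (\<bar>c\<bar> powr p) * Y)
      \<le> ennreal (2 powr p) * (ennreal e1 + ennreal (\<bar>c\<bar> powr p) * ennreal e1)"
      using that by (intro mult_left_mono add_mono) auto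
    also have "\<dots> = ennreal (2 powr p * (e1 + \<bar>c\<bar> powr p * e1))"
      using e1 by (simp flip: ennreal_plus ennreal_mult)
    also have "2 powr p * (e1 + \<bar>c\<bar> powr p * e1) = (2 powr p * k) * e1"
      by (simp add: k_def algebra_simps)
    also have "\<dots> = e / 2" using k by (simp add: e1_def)
    also have "ennreal (e / 2) < ennreal e" using e by (simp add: ennreal_less_iff)
    finally show ?thesis .
  qed
  show "\<exists>\<psi>\<in>U. D \<psi> (\<lambda>x. f x + c * g x) < ennreal e \<and> D (grad \<psi>) (\<lambda>x. f' x + c *\<^sub>R g' x) < ennreal e"
  proof (intro bexI[of _ "\<lambda>x. a x + c * b x"] conjI cl a b)
    show "D (\<lambda>x. a x + c * b x) (\<lambda>x. f x + c * g x) < ennreal e"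
      using Lpd_comb[of a b f g c] bound[OF a(2) b(2)] m C1_measurable_domain ab by (auto intro: order.strict_trans1)
    show "D (grad (\<lambda>x. a x + c * b x)) (\<lambda>x. f' x + c *\<^sub>R g' x) < ennreal e"
      unfolding gr
      using Lpd_comb[of "grad a" "grad b" f' g' c] bound[OF a(3) b(3)] m C1_measurable_domain ab by (auto intro: order.strict_trans1)
  qed
qed

lemma Lpd_imp_L1:
  assumes e: "0 < e"
  shows "\<exists>e'>0. \<forall>(f :: 'a \<Rightarrow> 'b::euclidean_space) g. f \<in> borel_measurable \<mu> \<longrightarrow> g \<in> borel_measurable \<mu> \<longrightarrow> D f g < ennreal e' \<longrightarrow>
    (\<integral>\<^sup>+x. ennreal (norm (f x - g x)) \<partial>\<mu>) < ennreal e"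
proof -
  interpret finite_measure \<mu> by (rule finite_measure_domain)
  define V where "V = measure \<mu> \<Omega>"
  have V: "V \<ge> 0" "emeasure \<mu> \<Omega> = ennreal V" by (auto simp: V_def emeasure_eq_measure)
  \<comment> \<open>The constant part costs at most \<open>d * V \<le> e / 4\<close>, and the
    threshold \<open>e / (4 * c)\<close> allows the power part another \<open>e / 4\<close>;
    \<open>V + 1\<close> avoids a division by zero.\<close>
  define d where "d = e / (4 * (V + 1))"
  have d: "d > 0" using e V by (simp add: d_def)
  have dV: "d * V \<le> e / 4" using e V by (simp add: d_def field_simps)
  define c where "c = d powr (1 - p)"
  have c: "c > 0" using d by (simp add: c_def)
  show ?thesis
  proof (intro exI[of _ "e / (4 * c)"] conjI allI impI)
    fix f g :: "'a \<Rightarrow> 'b" assume [measurable]: "f \<in> borel_measurable \<mu>" "g \<in> borel_measurable \<mu>" and fg: "D f g < ennreal (e / (4 * c))"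
    have "(\<integral>\<^sup>+x. ennreal (norm (f x - g x)) \<partial>\<mu>) \<le> (\<integral>\<^sup>+x. ennreal d + ennreal c * ennreal (norm (f x - g x) powr p) \<partial>\<mu>)"
      using le_small_add_powr[OF norm_ge_zero p d] d c
      by (intro nn_integral_mono) (auto simp: c_def simp flip: ennreal_plus ennreal_mult intro!: ennreal_leI)
    also have "\<dots> = ennreal d * emeasure \<mu> \<Omega> + ennreal c * D f g"
      by (simp add: nn_integral_add nn_integral_cmult Lpd_def)
    also have "\<dots> \<le> ennreal d * ennreal V + ennreal c * ennreal (e / (4 * c))"
      using fg by (auto simp: V intro!: add_mono mult_left_mono)
    also have "\<dots> = ennreal (d * V + e / 4)"
      using d c V e by (simp flip: ennreal_plus ennreal_mult)
    also have "\<dots> < ennreal e" using dV e by (intro ennreal_lessI) auto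
    finally show "(\<integral>\<^sup>+x. ennreal (norm (f x - g x)) \<partial>\<mu>) < ennreal e" .
  qed (use e c in auto)
qed

lemma integrable_domain_mult_bounded:
  fixes f :: "'a \<Rightarrow> 'b::euclidean_space"
  assumes f: "integrable \<mu> f" and q: "q \<in> borel_measurable borel" "\<And>x. \<bar>q x\<bar> \<le> B"
  shows "integrable \<mu> (\<lambda>x. q x *\<^sub>R f x)"
proof (rule Bochner_Integration.integrable_bound[OF integrable_mult_right[OF integrable_norm[OF f], of B]])
  show "(\<lambda>x. q x *\<^sub>R f x) \<in> borel_measurable \<mu>"
    by (intro borel_measurable_scaleR borel_measurable_domain q borel_measurable_integrable f)
  have "\<bar>q x\<bar> * norm (f x) \<le> B * norm (f x)" for x
    by (intro mult_right_mono q) auto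
  then show "AE x in \<mu>. norm (q x *\<^sub>R f x) \<le> norm (B * norm (f x))"
    by (intro AE_I2) (auto intro: order_trans[OF _ abs_ge_self])
qed

text \<open>For \<open>F\<close> of class \<open>C1\<close> the formula says that the gradient of
  the compactly supported product of \<open>\<psi>\<close> and \<open>F\<close> has integral zero.
  Both sides are continuous in L^1 because \<open>\<psi>\<close> and its gradient are bounded, so
  the formula survives the limit.\<close>

lemma approx_has_weak_gradient:
  assumes a: "approx p \<Omega> S f g" and S: "S \<subseteq> C1"
  shows "has_weak_gradient \<Omega> f g"
proof -
  note Lp = approx_Lp_space[OF a S]
  note m[measurable] = Lp_spaceD(1)[OF Lp(1)] Lp_spaceD(1)[OF Lp(2)]
  note i = Lp_spaceD(4)[OF Lp(1)] Lp_spaceD(4)[OF Lp(2)]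
  have loc: "locally_integrable \<Omega> h" if "integrable \<mu> h" for h :: "'a \<Rightarrow> 'b::euclidean_space"
    unfolding locally_integrable_def
  proof (intro allI impI)
    fix K assume K: "compact K \<and> K \<subseteq> \<Omega>"
    have [measurable]: "K \<in> sets lebesgue" using K by (auto intro: fmeasurableD lmeasurable_compact)
    have "integrable lebesgue (\<lambda>x. indicator \<Omega> x *\<^sub>R h x)"
      using that by (subst (asm) integrable_restrict_space) auto
    then have "integrable lebesgue (\<lambda>x. indicator K x *\<^sub>R (indicator \<Omega> x *\<^sub>R h x))"
      by (rule integrable_mult_indicator[rotated]) auto
    also have "(\<lambda>x. indicator K x *\<^sub>R (indicator \<Omega> x *\<^sub>R h x)) = (\<lambda>x. indicator K x *\<^sub>R h x)"
      using K by (auto simp: indicator_def fun_eq_iff)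
    finally show "integrable (lebesgue_on K) h"
      by (subst integrable_restrict_space) auto
  qed
  have "(\<integral>x. f x * partial_derivative b \<psi> x \<partial>\<mu>) = - (\<integral>x. (g x \<bullet> b) * \<psi> x \<partial>\<mu>)"
    if \<psi>: "\<psi> \<in> C1_compact \<Omega>" and b: "b \<in> Basis" for \<psi> b
  proof -
    have c: "\<psi> \<in> C1" using \<psi> by (simp add: C1_compact_iff)
    have \<psi>U: "\<psi> \<in> C1_compact UNIV" using \<psi> C1_compact_mono[of \<Omega> UNIV] by blast
    obtain B where B: "B > 0" "\<And>x. \<bar>\<psi> x\<bar> \<le> B" "\<And>x. norm (grad \<psi> x) \<le> B"
      using C1_compact_bounded[OF \<psi>U] by blast
    define q where "q x = grad \<psi> x \<bullet> b" for x
    have q: "partial_derivative b \<psi> = q" using grad_inner_Basis[OF b] by (auto simp: q_def)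
    have [measurable]: "\<psi> \<in> borel_measurable borel" "grad \<psi> \<in> borel_measurable borel"
      using c by (auto intro: C1_borel C1_grad_borel)
    then have [measurable]: "q \<in> borel_measurable borel" unfolding q_def by measurable
    have qB: "\<bar>q x\<bar> \<le> B" for x
      using Basis_le_norm[OF b, of "grad \<psi> x"] B(3)[of x] unfolding q_def by linarith
    have int: "integrable \<mu> (\<lambda>x. q x * h x)" if "integrable \<mu> h" for h :: "'a \<Rightarrow> real"
      using integrable_domain_mult_bounded[OF that _ qB] by simp
    have int': "integrable \<mu> (\<lambda>x. \<psi> x * h x)" if "integrable \<mu> h" for h :: "'a \<Rightarrow> real"
      using integrable_domain_mult_bounded[OF that _ B(2)] by simp
    define I where "I = (\<integral>x. q x * f x \<partial>\<mu>) + (\<integral>x. \<psi> x * (g x \<bullet> b) \<partial>\<mu>)"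
    have "\<bar>I\<bar> \<le> e" if e: "0 < e" for e
    proof -
      define e1 where "e1 = e / (2 * B)"
      have e1: "e1 > 0" using e B by (simp add: e1_def)
      obtain ea where ea: "ea > 0" "\<forall>f g::'a \<Rightarrow> real. f \<in> borel_measurable \<mu> \<longrightarrow> g \<in> borel_measurable \<mu> \<longrightarrow> D f g < ennreal ea \<longrightarrow>
          (\<integral>\<^sup>+x. ennreal (norm (f x - g x)) \<partial>\<mu>) < ennreal e1"
        using Lpd_imp_L1[OF e1] by blast
      obtain eb where eb: "eb > 0" "\<forall>f g::'a \<Rightarrow> 'a. f \<in> borel_measurable \<mu> \<longrightarrow> g \<in> borel_measurable \<mu> \<longrightarrow> D f g < ennreal eb \<longrightarrow>
          (\<integral>\<^sup>+x. ennreal (norm (f x - g x)) \<partial>\<mu>) < ennreal e1"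
        using Lpd_imp_L1[OF e1] by blast
      obtain F where F: "F \<in> S" "D F f < ennreal (min ea eb)" "D (grad F) g < ennreal (min ea eb)"
        using a ea(1) eb(1) unfolding approx_def by (metis min_less_iff_conj)
      have FC: "F \<in> C1" using F S by auto
      note mF = C1_measurable_domain[OF FC]
      note iF = Lp_spaceD(4)[OF C1_Lp_space(1)[OF FC]] Lp_spaceD(4)[OF C1_Lp_space(2)[OF FC]]
      have "D F f < ennreal ea" "D (grad F) g < ennreal eb"
        using F(2,3) by (auto elim!: order.strict_trans2 intro: ennreal_leI)
      then have "(\<integral>\<^sup>+x. ennreal (norm (F x - f x)) \<partial>\<mu>) < ennreal e1" "(\<integral>\<^sup>+x. ennreal (norm (grad F x - g x)) \<partial>\<mu>) < ennreal e1"
        using ea(2) eb(2) mF m by auto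
      then have n: "(\<integral>x. norm (F x - f x) \<partial>\<mu>) < e1" "(\<integral>x. norm (grad F x - g x) \<partial>\<mu>) < e1"
        using iF i e1 by (auto simp: nn_integral_eq_integral ennreal_less_iff)
      have z: "(\<integral>x. q x * F x \<partial>\<mu>) + (\<integral>x. \<psi> x * (grad F x \<bullet> b) \<partial>\<mu>) = 0"
      proof -
        have P: "(\<lambda>x. \<psi> x * F x) \<in> C1_compact UNIV" by (rule C1_compact_mult[OF \<psi>U FC])
        obtain K where K: "compact K" "K \<subseteq> \<Omega>" "\<And>x. x \<notin> K \<Longrightarrow> \<psi> x = 0" using \<psi> by (auto simp: C1_compact_iff)
        have gz: "grad \<psi> x = 0" if "x \<notin> K" for x
          by (rule C1_zero_outside_grad[OF c compact_imp_closed[OF K(1)] K(3) that])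
        have [measurable]: "F \<in> borel_measurable borel" "grad F \<in> borel_measurable borel"
          using FC by (auto intro: C1_borel C1_grad_borel)
        have "(\<integral>x. q x * F x \<partial>\<mu>) + (\<integral>x. \<psi> x * (grad F x \<bullet> b) \<partial>\<mu>) = (\<integral>x. q x * F x + \<psi> x * (grad F x \<bullet> b) \<partial>\<mu>)"
          using int[OF iF(1)] int'[of "\<lambda>x. grad F x \<bullet> b"] iF(2) by simp
        also have "\<dots> = (\<integral>x. q x * F x + \<psi> x * (grad F x \<bullet> b) \<partial>lborel)"
        proof (rule integral_lebesgue_on_eq_lborel)
          fix x assume "x \<notin> \<Omega>"
          then have "x \<notin> K" using K(2) by blast
          then show "q x * F x + \<psi> x * (grad F x \<bullet> b) = 0" using K(3) gz by (simp add: q_def)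
        qed measurable
        also have "\<dots> = (\<integral>x. grad (\<lambda>x. \<psi> x * F x) x \<bullet> b \<partial>lborel)"
          by (simp add: grad_mult[OF c FC] q_def inner_add_left) (simp add: algebra_simps)
        also have "\<dots> = 0"
          using integral_grad_C1_compact[OF P] C1_compact_integrable(2)[OF P] by simp
        finally show ?thesis .
      qed
      have "I = (\<integral>x. q x * (f x - F x) + \<psi> x * ((g x - grad F x) \<bullet> b) \<partial>\<mu>)"
      proof -
        have "(\<integral>x. q x * (f x - F x) + \<psi> x * ((g x - grad F x) \<bullet> b) \<partial>\<mu>)
          = (\<integral>x. (q x * f x - q x * F x) + (\<psi> x * (g x \<bullet> b) - \<psi> x * (grad F x \<bullet> b)) \<partial>\<mu>)"
          by (simp add: algebra_simps)
        also have "\<dots> = I - ((\<integral>x. q x * F x \<partial>\<mu>) + (\<integral>x. \<psi> x * (grad F x \<bullet> b) \<partial>\<mu>))"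
          unfolding I_def using int[OF iF(1)] int[OF i(1)] int'[of "\<lambda>x. grad F x \<bullet> b"] int'[of "\<lambda>x. g x \<bullet> b"] iF(2) i(2) by simp
        finally show ?thesis using z by simp
      qed
      also have "\<bar>\<dots>\<bar> \<le> (\<integral>x. B * norm (F x - f x) + B * norm (grad F x - g x) \<partial>\<mu>)"
        unfolding real_norm_def[symmetric]
      proof (rule order_trans[OF integral_norm_bound integral_mono])
        have "integrable \<mu> (\<lambda>x. q x * (f x - F x) + \<psi> x * ((g x - grad F x) \<bullet> b))"
          using i iF by (intro Bochner_Integration.integrable_add int int') auto
        then show "integrable \<mu> (\<lambda>x. norm (q x * (f x - F x) + \<psi> x * ((g x - grad F x) \<bullet> b)))"
          by (rule integrable_norm)
        show "integrable \<mu> (\<lambda>x. B * norm (F x - f x) + B * norm (grad F x - g x))"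
          using i iF by auto
        fix x
        have 1: "\<bar>q x * (f x - F x)\<bar> \<le> B * norm (F x - f x)"
          unfolding abs_mult real_norm_def by (subst abs_minus_commute) (intro mult_right_mono qB abs_ge_zero)
        have "\<bar>(g x - grad F x) \<bullet> b\<bar> \<le> norm (grad F x - g x)"
          using Basis_le_norm[OF b, of "g x - grad F x"] by (simp add: norm_minus_commute)
        then have 2: "\<bar>\<psi> x * ((g x - grad F x) \<bullet> b)\<bar> \<le> B * norm (grad F x - g x)"
          unfolding abs_mult using B by (intro mult_mono) auto
        show "norm (q x * (f x - F x) + \<psi> x * ((g x - grad F x) \<bullet> b)) \<le> B * norm (F x - f x) + B * norm (grad F x - g x)"
          using 1 2 by simp
      qed
      also have "\<dots> = B * (\<integral>x. norm (F x - f x) \<partial>\<mu>) + B * (\<integral>x. norm (grad F x - g x) \<partial>\<mu>)"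
        using i iF by simp
      also have "\<dots> \<le> B * e1 + B * e1" using n B by (intro add_mono mult_left_mono) auto
      also have "\<dots> = e" using B by (simp add: e1_def)
      finally show ?thesis .
    qed
    then have "I = 0" by (metis abs_ge_zero abs_le_zero_iff field_le_epsilon add_0)
    then show ?thesis unfolding I_def q by (simp add: mult.commute)
  qed
  then show ?thesis
    using loc[OF i(1)] loc[OF i(2)] by (simp add: has_weak_gradient_def)
qed

end

section \<open>Positive parts and triangular waves\<close>

text \<open>A \<open>C1\<close> positive part: \<open>0\<close> for \<open>s \<le> 0\<close>,
  \<open>s\<^sup>2 / (2 * d)\<close> between \<open>0\<close> and \<open>d\<close>, and
  \<open>s - d / 2\<close> beyond. The corner is rounded to the right of \<open>0\<close>, so a
  function that is nonpositive off a compact set is mapped to one that vanishes off this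
  set.\<close>

definition spos :: "real \<Rightarrow> real \<Rightarrow> real" where
  "spos d s = ((max 0 s)\<^sup>2 - (max 0 (s - d))\<^sup>2) / (2 * d)"

definition spos' :: "real \<Rightarrow> real \<Rightarrow> real" where
  "spos' d s = (max 0 s - max 0 (s - d)) / d"

lemma spos_derivative:
  assumes "0 < d"
  shows "(spos d has_real_derivative spos' d s) (at s)"
proof -
  have 1: "((\<lambda>s. (max 0 (s - d))\<^sup>2) has_real_derivative 2 * max 0 (s - d)) (at s)"
  proof -
    have "((\<lambda>s. s - d) has_real_derivative 1) (at s)" by (auto intro!: derivative_eq_intros)
    from DERIV_chain2[where f="\<lambda>s. (max 0 s)\<^sup>2" and g="\<lambda>s. s - d", OF pos_part_square_derivative this]
    show ?thesis by simp
  qed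
  show ?thesis
    unfolding spos_def[abs_def] spos'_def
    by (rule derivative_eq_intros pos_part_square_derivative 1 refl | use assms in \<open>simp add: field_simps\<close>)+
qed

lemma continuous_spos': "0 < d \<Longrightarrow> continuous_on A (spos' d)"
  unfolding spos'_def by (intro continuous_intros) auto

lemma spos'_bounds:
  assumes "0 < d"
  shows "0 \<le> spos' d s" "spos' d s \<le> 1" "s \<le> 0 \<Longrightarrow> spos' d s = 0" "d \<le> s \<Longrightarrow> spos' d s = 1"
  using assms by (auto simp: spos'_def max_def field_simps)

lemma spos'_lipschitz:
  assumes "0 < d"
  shows "\<bar>spos' d a - spos' d b\<bar> \<le> \<bar>a - b\<bar> / d"
proof -
  have "\<bar>(max 0 a - max 0 (a - d)) - (max 0 b - max 0 (b - d))\<bar> \<le> \<bar>a - b\<bar>"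
    using assms by (auto simp: max_def abs_if)
  then show ?thesis
    using assms unfolding spos'_def diff_divide_distrib[symmetric] abs_divide by (simp add: divide_right_mono)
qed

lemma spos_lipschitz:
  assumes "0 < d"
  shows "\<bar>spos d a - spos d b\<bar> \<le> \<bar>a - b\<bar>"
  using field_differentiable_bound[of UNIV "spos d" "spos' d" 1 a b] spos_derivative[OF assms] spos'_bounds[OF assms]
  by auto

lemma spos_nonpos: "0 < d \<Longrightarrow> s \<le> 0 \<Longrightarrow> spos d s = 0"
  by (simp add: spos_def)

lemma spos_approx:
  assumes "0 < d"
  shows "\<bar>spos d s - max 0 s\<bar> \<le> d"
proof (cases "s \<le> 0 \<or> s \<ge> d")
  case True
  then show ?thesis using assms by (auto simp: spos_def max_def power2_eq_square field_simps)
next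
  case False
  then have "s * s \<le> d * s" "0 \<le> s * s" by (auto intro: mult_right_mono)
  then have "spos d s \<ge> 0" "spos d s \<le> s / 2" "s < d" using False assms by (auto simp: spos_def power2_eq_square field_simps)
  then show ?thesis using False by auto
qed

context bounded_domain
begin

text \<open>Encodes boundary values at most \<open>M\<close> without traces: \<open>M\<close> is
  exceeded only inside a compact part of the domain, so a smoothed positive part above
  \<open>M\<close> is compactly supported.\<close>

definition C1_le :: "real \<Rightarrow> ('a \<Rightarrow> real) set" where
  "C1_le M = {f \<in> C1. \<exists>K. compact K \<and> K \<subseteq> \<Omega> \<and> (\<forall>x. x \<notin> K \<longrightarrow> f x \<le> M)}"

lemma C1_le_subset: "C1_le M \<subseteq> C1" and C1_compact_subset: "C1_compact S \<subseteq> C1"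
  by (auto simp: C1_le_def C1_compact_iff)

lemma spos_C1_compact:
  assumes "f \<in> C1_le 0" "0 < d"
  shows "(\<lambda>x. spos d (f x)) \<in> C1_compact \<Omega>" "grad (\<lambda>x. spos d (f x)) = (\<lambda>x. spos' d (f x) *\<^sub>R grad f x)"
proof -
  obtain K where K: "f \<in> C1" "compact K" "K \<subseteq> \<Omega>" "\<And>x. x \<notin> K \<Longrightarrow> f x \<le> 0"
    using assms(1) by (auto simp: C1_le_def)
  show "grad (\<lambda>x. spos d (f x)) = (\<lambda>x. spos' d (f x) *\<^sub>R grad f x)"
    by (rule grad_compose[OF K(1) spos_derivative continuous_spos']; fact)
  have "(\<lambda>x. spos d (f x)) \<in> C1"
    by (rule C1_compose[OF K(1) spos_derivative continuous_spos']; fact)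
  then show "(\<lambda>x. spos d (f x)) \<in> C1_compact \<Omega>"
    using K spos_nonpos[OF assms(2)] by (auto simp: C1_compact_iff)
qed

lemma Lpd_mono:
  assumes "\<And>x. x \<in> \<Omega> \<Longrightarrow> norm (f x - g x) \<le> norm (h x - k x)"
  shows "D f g \<le> D h k"
  unfolding Lpd_def using assms p by (intro nn_integral_mono ennreal_leI powr_mono2) auto

text \<open>The passage from \<open>F\<close> to \<open>f\<close> is split: first the gradient is
  replaced under the bounded factor \<open>spos' d (F x)\<close>, then the argument of that factor
  is changed against the fixed function \<open>g\<close>.\<close>

lemma approx_spos:
  assumes a: "approx p \<Omega> (C1_le 0) f g" and d: "0 < d"
  shows "approx p \<Omega> (C1_compact \<Omega>) (\<lambda>x. spos d (f x)) (\<lambda>x. spos' d (f x) *\<^sub>R g x)"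
  unfolding approx_def
proof (intro conjI allI impI)
  have fm[measurable]: "f \<in> borel_measurable \<mu>" and gm[measurable]: "g \<in> borel_measurable \<mu>"
    using a by (auto simp: approx_def)
  have [measurable]: "spos' d \<in> borel_measurable borel" "spos d \<in> borel_measurable borel"
    using continuous_spos'[OF d] DERIV_continuous_on[of UNIV "spos d" "spos' d"] spos_derivative[OF d]
    by (auto intro!: borel_measurable_continuous_onI)
  show "(\<lambda>x. spos d (f x)) \<in> borel_measurable \<mu>" by measurable
  show sg: "(\<lambda>x. spos' d (f x) *\<^sub>R g x) \<in> borel_measurable \<mu>" by measurable
  note gL = approx_Lp_space(2)[OF a C1_le_subset]
  fix e :: real assume e: "0 < e"
  define e1 where "e1 = e / (2 * 2 powr p)"
  have e1: "e1 > 0" using e by (simp add: e1_def)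
  \<comment> \<open>cutting \<open>g\<close> at height \<open>n\<close> turns the Lipschitz bound for \<open>spos' d\<close> into an \<open>L\<^sup>p\<close> bound, so that no
    almost everywhere convergent subsequence is needed\<close>
  define gn where "gn n x = (if norm (g x) \<le> real n then g x else 0)" for n :: nat and x
  have gnm[measurable]: "gn n \<in> borel_measurable \<mu>" for n unfolding gn_def by measurable
  have "(\<lambda>n. D (gn n) g) \<longlonglongrightarrow> 0"
  proof (rule Lpd_dominated[where w=g])
    fix x
    obtain N where "norm (g x) \<le> real N" using real_arch_simple by blast
    then have "gn n x = g x" if "n \<ge> N" for n using that by (simp add: gn_def)
    then show "(\<lambda>n. gn n x) \<longlonglongrightarrow> g x" by (intro tendsto_eventually) (auto simp: eventually_sequentially)
  qed (use Lp_spaceD[OF gL] in \<open>auto simp: gn_def\<close>)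
  then have "eventually (\<lambda>n. D (gn n) g < ennreal (e1 / 2)) sequentially"
    using e1 by (intro order_tendstoD(2)) auto
  then obtain n where n: "D (gn n) g < ennreal (e1 / 2)" by (auto simp: eventually_sequentially)
  define c where "c = (real n / d) powr p"
  have c: "c \<ge> 0" by (simp add: c_def)
  \<comment> \<open>Small enough that the factor \<open>c\<close> from the Lipschitz bound at height
    \<open>n\<close> costs less than \<open>e1 / 2\<close>; the summand \<open>1\<close> allows for
    \<open>c = 0\<close>.\<close>
  define e2 where "e2 = e1 / 2 / (1 + c)"
  have e2: "e2 > 0" using e1 c by (auto simp: e2_def)
  obtain F where F: "F \<in> C1_le 0" "D F f < ennreal (min e (min e1 e2))" "D (grad F) g < ennreal (min e (min e1 e2))"
    using a e e1 e2 unfolding approx_def by (metis min_less_iff_conj)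
  have FC: "F \<in> C1" using F(1) C1_le_subset by auto
  note Fm[measurable] = C1_measurable_domain[OF FC]
  have Fe: "D F f < ennreal e" "D F f < ennreal e2" "D (grad F) g < ennreal e1"
    using F(2,3) by (auto elim!: order.strict_trans2 intro: ennreal_leI)
  show "\<exists>\<psi>\<in>C1_compact \<Omega>. D \<psi> (\<lambda>x. spos d (f x)) < ennreal e \<and> D (grad \<psi>) (\<lambda>x. spos' d (f x) *\<^sub>R g x) < ennreal e"
  proof (intro bexI[of _ "\<lambda>x. spos d (F x)"] conjI spos_C1_compact(1)[OF F(1) d])
    have "D (\<lambda>x. spos d (F x)) (\<lambda>x. spos d (f x)) \<le> D F f"
      using spos_lipschitz[OF d] by (intro Lpd_mono) auto
    then show "D (\<lambda>x. spos d (F x)) (\<lambda>x. spos d (f x)) < ennreal e" using Fe(1) by (rule order.strict_trans1)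
    show "D (grad (\<lambda>x. spos d (F x))) (\<lambda>x. spos' d (f x) *\<^sub>R g x) < ennreal e"
      unfolding spos_C1_compact(2)[OF F(1) d]
    proof (rule Lpd_less)
      have "D (\<lambda>x. spos' d (F x) *\<^sub>R grad F x) (\<lambda>x. spos' d (F x) *\<^sub>R g x) \<le> D (grad F) g"
        using spos'_bounds[OF d]
        by (intro Lpd_mono) (auto simp flip: scaleR_diff_right simp: mult_left_le_one_le)
      then show "D (\<lambda>x. spos' d (F x) *\<^sub>R grad F x) (\<lambda>x. spos' d (F x) *\<^sub>R g x) < ennreal (e / (2 * 2 powr p))"
        using Fe(3) unfolding e1_def by (rule order.strict_trans1)
      \<comment> \<open>Where \<open>g\<close> is below height \<open>n\<close> the Lipschitz bound
        applies; elsewhere \<open>gn n x = 0\<close>, and the difference is at most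
        \<open>norm (g x)\<close>, which is the first term on the right.\<close>
      have pw: "norm (spos' d (F x) *\<^sub>R g x - spos' d (f x) *\<^sub>R g x) powr p
         \<le> norm (gn n x - g x) powr p + c * norm (F x - f x) powr p" for x
      proof (cases "norm (g x) \<le> real n")
        case True
        have "norm (spos' d (F x) *\<^sub>R g x - spos' d (f x) *\<^sub>R g x) \<le> (\<bar>F x - f x\<bar> / d) * real n"
          unfolding scaleR_diff_left[symmetric] norm_scaleR
          using d True by (intro mult_mono spos'_lipschitz) auto
        then have "norm (spos' d (F x) *\<^sub>R g x - spos' d (f x) *\<^sub>R g x) powr p \<le> ((real n / d) * norm (F x - f x)) powr p"
          using p by (intro powr_mono2) (auto simp: mult.commute)
        also have "\<dots> = c * norm (F x - f x) powr p"
          unfolding c_def by (subst powr_mult) (use d in auto)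
        finally show ?thesis by (simp add: add_increasing)
      next
        case False
        have "\<bar>spos' d (F x) - spos' d (f x)\<bar> \<le> 1"
          using spos'_bounds[OF d, of "F x"] spos'_bounds[OF d, of "f x"] by linarith
        then have "norm (spos' d (F x) *\<^sub>R g x - spos' d (f x) *\<^sub>R g x) \<le> norm (g x)"
          unfolding scaleR_diff_left[symmetric] norm_scaleR by (intro mult_left_le_one_le) auto
        then have "norm (spos' d (F x) *\<^sub>R g x - spos' d (f x) *\<^sub>R g x) powr p \<le> norm (gn n x - g x) powr p"
          using p False by (intro powr_mono2) (auto simp: gn_def)
        then show ?thesis using c by (simp add: add_increasing2)
      qed
      have "D (\<lambda>x. spos' d (F x) *\<^sub>R g x) (\<lambda>x. spos' d (f x) *\<^sub>R g x)
        \<le> (\<integral>\<^sup>+x. ennreal (norm (gn n x - g x) powr p) + ennreal c * ennreal (norm (F x - f x) powr p) \<partial>\<mu>)"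
        unfolding Lpd_def using pw c
        by (intro nn_integral_mono) (auto simp flip: ennreal_plus ennreal_mult intro!: ennreal_leI)
      also have "\<dots> = D (gn n) g + ennreal c * D F f"
        by (simp add: nn_integral_add nn_integral_cmult Lpd_def)
      also have "\<dots> < ennreal (e1 / 2) + ennreal (e1 / 2)"
      proof (rule add_strict_mono[OF n])
        have "ennreal c * D F f \<le> ennreal c * ennreal e2" using Fe(2) by (intro mult_left_mono) auto
        also have "\<dots> = ennreal (c * e2)" using c e2 by (simp add: ennreal_mult)
        also have "c * e2 < e1 / 2"
        proof -
          have "1 + c > 0" using c by simp
          then have "(1 + c) * e2 = e1 / 2" unfolding e2_def by (subst nonzero_mult_div_cancel_left[symmetric, of "1 + c"]) auto
          moreover have "c * e2 < (1 + c) * e2" using e2 by (intro mult_strict_right_mono) auto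
          ultimately show ?thesis by simp
        qed
        then have "ennreal (c * e2) < ennreal (e1 / 2)" using e1 by (intro ennreal_lessI) auto
        finally show "ennreal c * D F f < ennreal (e1 / 2)" .
      qed
      also have "\<dots> = ennreal e1" using e1 by (simp flip: ennreal_plus)
      finally show "D (\<lambda>x. spos' d (F x) *\<^sub>R g x) (\<lambda>x. spos' d (f x) *\<^sub>R g x) < ennreal (e / (2 * 2 powr p))"
        by (simp add: e1_def)
      have sF: "(\<lambda>x. spos' d (F x)) \<in> borel_measurable \<mu>"
        by (rule measurable_compose[OF Fm(1)]) simp
      show "(\<lambda>x. spos' d (F x) *\<^sub>R grad F x) \<in> borel_measurable \<mu>" "(\<lambda>x. spos' d (F x) *\<^sub>R g x) \<in> borel_measurable \<mu>"
        by (intro borel_measurable_scaleR sF Fm(2) gm)+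
    qed (rule sg)
  qed
qed

lemma nn_integral_const_powr_finite: "Lp_mass p \<mu> (\<lambda>x. c :: 'b::euclidean_space) < \<infinity>"
proof -
  interpret finite_measure \<mu> by (rule finite_measure_domain)
  show ?thesis by (simp add: ennreal_mult_less_top emeasure_eq_measure)
qed

text \<open>
  Letting \<open>d \<rightarrow> 0\<close> only after the approximants have converged to \<open>f\<close> avoids the fact that \<open>\<nabla>f = 0\<close>
  almost everywhere on \<open>{f = 0}\<close>, because \<open>spos' d\<close> vanishes at \<open>0\<close>.
\<close>
lemma approx_pos_part:
  assumes a: "approx p \<Omega> (C1_le 0) f g"
  shows "approx p \<Omega> (C1_compact \<Omega>) (\<lambda>x. max 0 (f x)) (\<lambda>x. if 0 < f x then g x else 0)"
proof (rule approx_closed_seq[OF _ _ C1_compact_subset])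
  define d where "d n = 1 / real (Suc n)" for n
  have d: "d n > 0" "d n \<le> 1" for n by (auto simp: d_def)
  have d0: "d \<longlonglongrightarrow> 0" unfolding d_def by (rule LIMSEQ_Suc[OF lim_1_over_n])
  have fm[measurable]: "f \<in> borel_measurable \<mu>" and gm[measurable]: "g \<in> borel_measurable \<mu>"
    using a by (auto simp: approx_def)
  show m1: "(\<lambda>x. max 0 (f x)) \<in> borel_measurable \<mu>" by measurable
  show m2: "(\<lambda>x. if 0 < f x then g x else 0) \<in> borel_measurable \<mu>" by measurable
  show ap: "approx p \<Omega> (C1_compact \<Omega>) (\<lambda>x. spos (d n) (f x)) (\<lambda>x. spos' (d n) (f x) *\<^sub>R g x)" for n
    by (rule approx_spos[OF a d(1)])
  then have ms: "(\<lambda>x. spos (d n) (f x)) \<in> borel_measurable \<mu>" "(\<lambda>x. spos' (d n) (f x) *\<^sub>R g x) \<in> borel_measurable \<mu>" for n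
    unfolding approx_def by blast+
  note gL = approx_Lp_space(2)[OF a C1_le_subset]
  show "(\<lambda>n. D (\<lambda>x. spos (d n) (f x)) (\<lambda>x. max 0 (f x))) \<longlonglongrightarrow> 0"
  proof (rule Lpd_dominated[where w="\<lambda>_. 1 :: real"])
    show "(\<lambda>n. spos (d n) (f x)) \<longlonglongrightarrow> max 0 (f x)" for x
    proof (rule LIM_zero_cancel, rule tendsto_rabs_zero_cancel, rule tendsto_sandwich[OF _ _ tendsto_const d0])
      show "eventually (\<lambda>n. \<bar>spos (d n) (f x) - max 0 (f x)\<bar> \<le> d n) sequentially"
        using spos_approx[OF d(1)] by (intro always_eventually) auto
    qed auto
    show "norm (spos (d n) (f x) - max 0 (f x)) \<le> norm (1::real)" for n x
      using spos_approx[OF d(1), of n "f x"] d(2)[of n] by simp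
  qed (use ms m1 nn_integral_const_powr_finite[of "1::real"] in auto)
  show "(\<lambda>n. D (\<lambda>x. spos' (d n) (f x) *\<^sub>R g x) (\<lambda>x. if 0 < f x then g x else 0)) \<longlonglongrightarrow> 0"
  proof (rule Lpd_dominated[where w=g])
    show "(\<lambda>n. spos' (d n) (f x) *\<^sub>R g x) \<longlonglongrightarrow> (if 0 < f x then g x else 0)" for x
    proof (cases "0 < f x")
      case True
      then have "eventually (\<lambda>n. d n < f x) sequentially" by (rule order_tendstoD(2)[OF d0])
      then have "eventually (\<lambda>n. spos' (d n) (f x) *\<^sub>R g x = g x) sequentially"
        by eventually_elim (use spos'_bounds(4)[OF d(1)] in auto)
      then show ?thesis using True by (auto intro: tendsto_eventually)
    qed (use spos'_bounds(3)[OF d(1)] in auto)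
    show "norm (spos' (d n) (f x) *\<^sub>R g x - (if 0 < f x then g x else 0)) \<le> norm (g x)" for n x
    proof (cases "0 < f x")
      case True
      have "spos' (d n) (f x) *\<^sub>R g x - g x = (spos' (d n) (f x) - 1) *\<^sub>R g x" by (simp add: scaleR_diff_left)
      then show ?thesis
        using True spos'_bounds(1,2)[OF d(1)[of n], of "f x"] by (simp add: mult_left_le_one_le)
    qed (use spos'_bounds(3)[OF d(1)] in auto)
  qed (use ms m2 gm Lp_spaceD[OF gL] in auto)
qed

text \<open>\<open>arccos (cos s)\<close> is the distance from \<open>s\<close> to the nearest
  multiple of \<open>2 * pi\<close>. This makes a triangular wave with values between
  \<open>0\<close> and \<open>a * pi\<close> whose slopes do not depend on the amplitude.\<close>

definition wave :: "real \<Rightarrow> 'a \<Rightarrow> 'a \<Rightarrow> real" where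
  "wave a \<xi> x = a * arccos (cos (x \<bullet> \<xi> / a))"

definition wave_grad :: "real \<Rightarrow> 'a \<Rightarrow> 'a \<Rightarrow> 'a" where
  "wave_grad a \<xi> x = sgn (sin (x \<bullet> \<xi> / a)) *\<^sub>R \<xi>"

lemma wave_bounds: "0 < a \<Longrightarrow> 0 \<le> wave a \<xi> x \<and> wave a \<xi> x \<le> a * pi"
  by (auto simp: wave_def arccos_lbound arccos_ubound)

text \<open>The kinks lie on countably many hyperplanes. For \<open>\<xi> = 0\<close> the wave is
  identically \<open>0\<close>, and cutting with it is plain truncation.\<close>

lemma AE_wave_grad:
  assumes "0 < a"
  shows "AE x in \<mu>. wave_grad a \<xi> x \<in> {\<xi>, - \<xi>}"
proof (cases "\<xi> = 0")
  case False
  have "negligible (\<Union>i\<in>(UNIV::int set). {x. \<xi> \<bullet> x = a * (of_int i * pi)})"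
    using False by (intro negligible_countable_Union countable_image) (auto simp: negligible_hyperplane)
  then have "(\<Union>i\<in>(UNIV::int set). {x. \<xi> \<bullet> x = a * (of_int i * pi)}) \<in> null_sets lebesgue"
    by (simp add: negligible_iff_null_sets)
  then have "AE x in lebesgue. x \<notin> (\<Union>i\<in>(UNIV::int set). {x. \<xi> \<bullet> x = a * (of_int i * pi)})"
    by (rule AE_not_in)
  then have "AE x in lebesgue. wave_grad a \<xi> x \<in> {\<xi>, - \<xi>}"
  proof eventually_elim
    case (elim x)
    have "sin (x \<bullet> \<xi> / a) \<noteq> 0"
    proof
      assume "sin (x \<bullet> \<xi> / a) = 0"
      then obtain i :: int where "x \<bullet> \<xi> / a = of_int i * pi" by (auto simp: sin_zero_iff_int2)
      then have "\<xi> \<bullet> x = a * (of_int i * pi)" using assms by (simp add: field_simps inner_commute)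
      then show False using elim by blast
    qed
    then show ?case by (auto simp: wave_grad_def sgn_if)
  qed
  then show ?thesis by (subst AE_restrict_space_iff) (auto elim!: eventually_mono)
qed (simp add: wave_grad_def)

text \<open>Shrinking the cosine by a factor \<open>r n < 1\<close> keeps its values away from
  \<open>1\<close> and \<open>-1\<close>, where \<open>arccos\<close> has infinite slope. The
  derivatives of the resulting profiles are bounded by \<open>1\<close> and converge everywhere to
  \<open>sgn (sin s)\<close>, even at the zeros of the sine, where they all vanish.\<close>

lemma approx_wave:
  assumes a: "0 < a"
  shows "approx p \<Omega> {f \<in> C1. \<forall>x. 0 \<le> f x} (wave a \<xi>) (wave_grad a \<xi>)"
proof (rule approx_closed_seq)
  \<comment> \<open>The shift by two gives \<open>r 0 = 1 / 2\<close>, so that all factors are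
    strictly positive.\<close>
  define r where "r n = 1 - 1 / real (Suc (Suc n))" for n
  have r: "0 < r n" "r n < 1" for n by (auto simp: r_def)
  have "(\<lambda>n. 1 / real (Suc (Suc n))) \<longlonglongrightarrow> 0"
    by (rule LIMSEQ_Suc[OF LIMSEQ_Suc[OF lim_1_over_n]])
  then have r1: "r \<longlonglongrightarrow> 1" unfolding r_def using tendsto_diff[OF tendsto_const, of _ 0 _ "1 :: real"] by fastforce
  define \<theta> where "\<theta> n s = arccos (r n * cos s)" for n s
  define \<theta>' where "\<theta>' n s = r n * sin s / sqrt (1 - (r n * cos s)\<^sup>2)" for n s
  have b: "-1 < r n * cos s" "r n * cos s < 1" for n s
  proof -
    have "\<bar>r n * cos s\<bar> \<le> r n * 1" unfolding abs_mult using r[of n] by (intro mult_mono) auto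
    then show "-1 < r n * cos s" "r n * cos s < 1" using r(2)[of n] by linarith+
  qed
  have sq: "(r n * cos s)\<^sup>2 < 1" for n s using b[of n s] by (simp add: abs_square_less_1)
  have der: "(\<theta> n has_real_derivative \<theta>' n s) (at s)" for n s
    unfolding \<theta>_def[abs_def] \<theta>'_def
    using b[of n s] by (auto intro!: derivative_eq_intros simp: field_simps)
  have cont: "continuous_on UNIV (\<theta>' n)" for n
    unfolding \<theta>'_def[abs_def] using sq by (intro continuous_intros) (auto simp: less_imp_neq)
  have le1: "\<bar>\<theta>' n s\<bar> \<le> 1" for n s
  proof -
    have "(r n * sin s)\<^sup>2 + (r n * cos s)\<^sup>2 = (r n)\<^sup>2"
      by (simp add: power_mult_distrib flip: distrib_left)
    also have "\<dots> \<le> 1" using r[of n] by (simp add: power_le_one)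
    finally have "\<bar>r n * sin s\<bar> \<le> sqrt (1 - (r n * cos s)\<^sup>2)"
      by (intro real_le_rsqrt) (simp add: power2_eq_square)
    then show ?thesis using sq[of n s] by (simp add: \<theta>'_def abs_mult)
  qed
  have lin: "(\<lambda>x. x \<bullet> \<xi> / a) \<in> C1" and glin: "grad (\<lambda>x. x \<bullet> \<xi> / a) = (\<lambda>_. (1 / a) *\<^sub>R \<xi>)"
    using C1_inner[of "(1 / a) *\<^sub>R \<xi>"] grad_inner[of "(1 / a) *\<^sub>R \<xi>"] by simp_all
  have C: "(\<lambda>x. \<theta> n (x \<bullet> \<xi> / a)) \<in> C1" and G: "grad (\<lambda>x. \<theta> n (x \<bullet> \<xi> / a)) = (\<lambda>x. \<theta>' n (x \<bullet> \<xi> / a) *\<^sub>R (1 / a) *\<^sub>R \<xi>)" for n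
    using C1_compose[OF lin der cont] grad_compose[OF lin der cont]
    by (simp_all add: glin)
  define F where "F n x = a * \<theta> n (x \<bullet> \<xi> / a)" for n x
  have FC: "F n \<in> C1" and FG: "grad (F n) = (\<lambda>x. \<theta>' n (x \<bullet> \<xi> / a) *\<^sub>R \<xi>)" for n
    unfolding F_def[abs_def] using C1_cmult[OF C] grad_cmult[OF C] a by (simp_all add: G)
  show "{f \<in> C1. \<forall>x. 0 \<le> f x} \<subseteq> (C1 :: ('a \<Rightarrow> real) set)" by auto
  have "F n \<in> {f \<in> C1. \<forall>x. 0 \<le> f x}" for n
  proof -
    have "0 \<le> arccos (r n * cos s)" for s
      using b[of n s] by (intro arccos_lbound) auto
    then show ?thesis using FC a by (auto simp: F_def \<theta>_def)
  qed
  then show "approx p \<Omega> {f \<in> C1. \<forall>x. 0 \<le> f x} (F n) (grad (F n))" for n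
    by (rule approx_self) auto
  show m1: "wave a \<xi> \<in> borel_measurable \<mu>"
    unfolding wave_def[abs_def]
    by (intro borel_measurable_domain borel_measurable_continuous_onI continuous_intros) (use a in auto)
  show m2: "wave_grad a \<xi> \<in> borel_measurable \<mu>"
    unfolding wave_grad_def[abs_def] by (intro borel_measurable_domain) measurable
  note mF = C1_measurable_domain[OF FC]
  show "(\<lambda>n. D (F n) (wave a \<xi>)) \<longlonglongrightarrow> 0"
  proof (rule Lpd_dominated[where w="\<lambda>_. a * pi"])
    show "(\<lambda>n. F n x) \<longlonglongrightarrow> wave a \<xi> x" for x
    proof -
      have "(\<lambda>n. r n * cos (x \<bullet> \<xi> / a)) \<longlonglongrightarrow> cos (x \<bullet> \<xi> / a)"
        using tendsto_mult[OF r1 tendsto_const] by simp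
      then have "(\<lambda>n. arccos (r n * cos (x \<bullet> \<xi> / a))) \<longlonglongrightarrow> arccos (cos (x \<bullet> \<xi> / a))"
        by (rule continuous_on_tendsto_compose[OF continuous_on_arccos', of "\<lambda>n. r n * cos (x \<bullet> \<xi> / a)"])
           (use b in \<open>auto intro!: always_eventually less_imp_le\<close>)
      then show ?thesis unfolding F_def \<theta>_def wave_def by (rule tendsto_mult_left)
    qed
    show "norm (F n x - wave a \<xi> x) \<le> norm (a * pi)" for n x
    proof -
      have "0 \<le> \<theta> n s" "\<theta> n s \<le> pi" for s
        unfolding \<theta>_def using b[of n s] by (auto intro!: arccos_lbound arccos_ubound)
      then have "0 \<le> F n x" "F n x \<le> a * pi" using a by (auto simp: F_def)
      then show ?thesis using wave_bounds[OF a, of \<xi> x] by auto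
    qed
  qed (use mF m1 nn_integral_const_powr_finite[of "a * pi"] in auto)
  show "(\<lambda>n. D (grad (F n)) (wave_grad a \<xi>)) \<longlonglongrightarrow> 0"
  proof (rule Lpd_dominated[where w="\<lambda>_. 2 *\<^sub>R \<xi>"])
    show "(\<lambda>n. grad (F n) x) \<longlonglongrightarrow> wave_grad a \<xi> x" for x
      unfolding FG wave_grad_def
    proof (rule tendsto_scaleR[OF _ tendsto_const])
      define s where "s = x \<bullet> \<xi> / a"
      have "(\<lambda>n. \<theta>' n s) \<longlonglongrightarrow> sgn (sin s)"
      proof (cases "sin s = 0")
        case False
        have "(\<lambda>n. sqrt (1 - (r n * cos s)\<^sup>2)) \<longlonglongrightarrow> sqrt (1 - (1 * cos s)\<^sup>2)"
          by (intro tendsto_intros r1)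
        also have "sqrt (1 - (1 * cos s)\<^sup>2) = \<bar>sin s\<bar>"
          by (simp add: sin_squared_eq[symmetric])
        finally have "(\<lambda>n. \<theta>' n s) \<longlonglongrightarrow> 1 * sin s / \<bar>sin s\<bar>"
          unfolding \<theta>'_def using False by (intro tendsto_divide tendsto_mult r1 tendsto_const) auto
        then show ?thesis by (simp add: sgn_real_def abs_if split: if_splits)
      qed (simp add: \<theta>'_def)
      then show "(\<lambda>n. \<theta>' n (x \<bullet> \<xi> / a)) \<longlonglongrightarrow> sgn (sin (x \<bullet> \<xi> / a))" by (simp add: s_def)
    qed
    show "norm (grad (F n) x - wave_grad a \<xi> x) \<le> norm (2 *\<^sub>R \<xi>)" for n x
    proof -
      have "norm (grad (F n) x) \<le> norm \<xi>" unfolding FG using le1 by (simp add: mult_left_le_one_le)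
      moreover have "norm (wave_grad a \<xi> x) \<le> norm \<xi>" by (auto simp: wave_grad_def sgn_if)
      ultimately show ?thesis using norm_triangle_ineq4[of "grad (F n) x" "wave_grad a \<xi> x"] by simp
    qed
  qed (use mF m2 nn_integral_const_powr_finite[of "2 *\<^sub>R \<xi>"] in auto)
qed


section \<open>Sobolev spaces\<close>

text \<open>Lebesgue measure is complete, so measurability survives changes on null sets. This is
  how the function chosen by \<open>weak_gradient\<close> becomes measurable.\<close>

lemma borel_measurable_domain_AE:
  fixes f g :: "'a \<Rightarrow> 'b::euclidean_space"
  assumes "f \<in> borel_measurable \<mu>" "AE x in \<mu>. f x = g x"
  shows "g \<in> borel_measurable \<mu>"
proof -
  have "(\<lambda>x. indicator \<Omega> x *\<^sub>R f x) \<in> borel_measurable lebesgue"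
    using assms(1) by (subst (asm) borel_measurable_restrict_space_iff) auto
  moreover have "AE x in lebesgue. indicator \<Omega> x *\<^sub>R f x = indicator \<Omega> x *\<^sub>R g x"
    using assms(2) by (subst (asm) AE_restrict_space_iff) (auto elim!: eventually_mono simp: indicator_def)
  ultimately have "(\<lambda>x. indicator \<Omega> x *\<^sub>R g x) \<in> borel_measurable lebesgue"
    by (rule borel_measurable_AE)
  then show ?thesis by (subst borel_measurable_restrict_space_iff) auto
qed

lemma weak_gradient_eq:
  assumes h: "has_weak_gradient \<Omega> f g" and g: "g \<in> borel_measurable \<mu>"
  shows "AE x in \<mu>. g x = weak_gradient \<Omega> f x" "weak_gradient \<Omega> f \<in> borel_measurable \<mu>"
proof -
  have "has_weak_gradient \<Omega> f (weak_gradient \<Omega> f)"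
    unfolding weak_gradient_def by (rule someI[of "has_weak_gradient \<Omega> f", OF h])
  then show "AE x in \<mu>. g x = weak_gradient \<Omega> f x"
    by (rule weak_gradient_unique[OF open_domain h])
  then show "weak_gradient \<Omega> f \<in> borel_measurable \<mu>"
    by (rule borel_measurable_domain_AE[OF g])
qed

lemma has_weak_gradient_diff:
  assumes f: "has_weak_gradient \<Omega> f g" and f': "has_weak_gradient \<Omega> f' g'"
  shows "has_weak_gradient \<Omega> (\<lambda>x. f x - f' x) (\<lambda>x. g x - g' x)"
proof -
  have l: "locally_integrable \<Omega> f" "locally_integrable \<Omega> f'" "locally_integrable \<Omega> g" "locally_integrable \<Omega> g'"
    using f f' by (auto simp: has_weak_gradient_def)
  then have lb: "locally_integrable \<Omega> (\<lambda>x. g x \<bullet> b)" "locally_integrable \<Omega> (\<lambda>x. g' x \<bullet> b)" for b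
    by (auto simp: locally_integrable_def)
  have "(\<integral>x. (f x - f' x) * partial_derivative b \<psi> x \<partial>\<mu>) = - (\<integral>x. ((g x - g' x) \<bullet> b) * \<psi> x \<partial>\<mu>)"
    if \<psi>: "\<psi> \<in> C1_compact \<Omega>" and b: "b \<in> Basis" for \<psi> b
  proof -
    have i: "integrable \<mu> (\<lambda>x. f x * partial_derivative b \<psi> x)" "integrable \<mu> (\<lambda>x. f' x * partial_derivative b \<psi> x)"
      using locally_integrable_mult_partial_derivative[OF open_domain l(1) \<psi> b]
        locally_integrable_mult_partial_derivative[OF open_domain l(2) \<psi> b] by (simp_all add: mult.commute)
    have j: "integrable \<mu> (\<lambda>x. (g x \<bullet> b) * \<psi> x)" "integrable \<mu> (\<lambda>x. (g' x \<bullet> b) * \<psi> x)"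
      using locally_integrable_mult_C1_compact[OF open_domain lb(1) \<psi>]
        locally_integrable_mult_C1_compact[OF open_domain lb(2) \<psi>] by (simp_all add: mult.commute)
    have "(\<integral>x. f x * partial_derivative b \<psi> x \<partial>\<mu>) = - (\<integral>x. (g x \<bullet> b) * \<psi> x \<partial>\<mu>)"
      "(\<integral>x. f' x * partial_derivative b \<psi> x \<partial>\<mu>) = - (\<integral>x. (g' x \<bullet> b) * \<psi> x \<partial>\<mu>)"
      using f f' \<psi> b unfolding has_weak_gradient_def by blast+
    then show ?thesis using i j by (simp add: left_diff_distrib inner_diff_left)
  qed
  then show ?thesis
    using l by (auto simp: has_weak_gradient_def locally_integrable_def)
qed

text \<open>Bridge between the given norm and the distance without root: a radius \<open>e\<close>
  on one side is \<open>e powr p\<close> on the other.\<close>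

lemma Lp_norm_less_iff:
  assumes f: "f \<in> Lp_space p \<Omega>" and e: "0 < e"
  shows "Lp_norm p \<Omega> f < e \<longleftrightarrow> D f (\<lambda>_. 0) < ennreal (e powr p)"
proof -
  define I where "I = (\<integral>x. norm (f x) powr p \<partial>\<mu>)"
  have I: "0 \<le> I" by (simp add: I_def)
  have D: "D f (\<lambda>_. 0) = ennreal I"
    using f unfolding Lpd_def I_def Lp_space_def by (subst nn_integral_eq_integral) auto
  have "I powr (1 / p) < e \<longleftrightarrow> I < e powr p"
  proof
    assume "I powr (1 / p) < e"
    then have "(I powr (1 / p)) powr p < e powr p" using p by (intro powr_less_mono2) auto
    then show "I < e powr p" using I p by (simp add: powr_powr)
  next
    assume "I < e powr p"
    then have "I powr (1 / p) < (e powr p) powr (1 / p)" using p I by (intro powr_less_mono2) auto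
    then show "I powr (1 / p) < e" using e p by (simp add: powr_powr)
  qed
  then show ?thesis using I by (simp add: D Lp_norm_def I_def ennreal_less_iff)
qed

lemma Lp_norm_cong:
  assumes "f \<in> borel_measurable \<mu>" "g \<in> borel_measurable \<mu>" "AE x in \<mu>. f x = g x"
  shows "Lp_norm q \<Omega> f = Lp_norm q \<Omega> g"
proof -
  have "(\<integral>x. norm (f x) powr q \<partial>\<mu>) = (\<integral>x. norm (g x) powr q \<partial>\<mu>)"
    using assms(3) by (intro integral_cong_AE) (use assms(1,2) in \<open>measurable, auto elim!: eventually_mono\<close>)
  then show ?thesis by (simp add: Lp_norm_def)
qed

text \<open>\<open>W1p_norm\<close> refers to the gradient chosen for the difference; uniqueness
  identifies it almost everywhere with the difference of the explicit witnesses.\<close>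

lemma W1p_norm_diff:
  assumes f: "has_weak_gradient \<Omega> f g" and g: "g \<in> borel_measurable \<mu>"
    and h: "has_weak_gradient \<Omega> h k" and k: "k \<in> borel_measurable \<mu>"
  shows "W1p_norm p \<Omega> (\<lambda>x. f x - h x) = Lp_norm p \<Omega> (\<lambda>x. f x - h x) + Lp_norm p \<Omega> (\<lambda>x. g x - k x)"
proof -
  have m: "(\<lambda>x. g x - k x) \<in> borel_measurable \<mu>" using g k by measurable
  note w = weak_gradient_eq[OF has_weak_gradient_diff[OF f h] m]
  show ?thesis unfolding W1p_norm_def using Lp_norm_cong[OF m w(2,1)] by simp
qed

lemma Lpd_diff_zero: "D (\<lambda>x. f x - h x) (\<lambda>_. 0) = D f h"
  by (simp add: Lpd_def)

lemma Lp_norm_nonneg: "0 \<le> Lp_norm q \<Omega> f"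
  by (simp add: Lp_norm_def)

lemma Lp_space_diff:
  assumes "f \<in> Lp_space p \<Omega>" "g \<in> Lp_space p \<Omega>"
  shows "(\<lambda>x. f x - g x) \<in> Lp_space p \<Omega>"
proof -
  note m[measurable] = Lp_spaceD(1)[OF assms(1)] Lp_spaceD(1)[OF assms(2)]
  have "D f g \<le> ennreal (2 powr p) * (D f (\<lambda>_. 0) + D (\<lambda>_. 0) g)"
    by (intro Lpd_triangle) auto
  also have "\<dots> < \<infinity>"
    using Lp_spaceD(3)[OF assms(1)] Lp_spaceD(3)[OF assms(2)]
    by (auto simp: Lpd_commute[of _ _ "\<lambda>_. 0"] ennreal_mult_less_top)
  finally show ?thesis by (intro Lp_spaceI) (auto simp: Lpd_def)
qed

lemma W1p_norm_diff_less:
  assumes f: "has_weak_gradient \<Omega> f g" and h: "has_weak_gradient \<Omega> h k"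
    and Lp: "f \<in> Lp_space p \<Omega>" "g \<in> Lp_space p \<Omega>" "h \<in> Lp_space p \<Omega>" "k \<in> Lp_space p \<Omega>"
    and e: "0 < e" and D: "D f h < ennreal ((e / 2) powr p)" "D g k < ennreal ((e / 2) powr p)"
  shows "W1p_norm p \<Omega> (\<lambda>x. f x - h x) < e"
proof -
  have "Lp_norm p \<Omega> (\<lambda>x. f x - h x) < e / 2" "Lp_norm p \<Omega> (\<lambda>x. g x - k x) < e / 2"
    using e by (auto intro!: Lp_norm_less_iff[THEN iffD2] Lp_space_diff Lp D simp only: Lpd_diff_zero half_gt_zero_iff)
  then show ?thesis
    using W1p_norm_diff[OF f Lp_spaceD(1)[OF Lp(2)] h Lp_spaceD(1)[OF Lp(4)]] by simp
qed

lemma C1_has_weak_gradient: "f \<in> C1 \<Longrightarrow> has_weak_gradient \<Omega> f (grad f)"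
  using approx_has_weak_gradient[OF approx_self[of f C1]] by simp

section \<open>Boundary conditions expressed through approximable pairs\<close>

lemma W1p0_space_approx:
  assumes "v \<in> W1p0_space p \<Omega>"
  shows "\<exists>g. approx p \<Omega> (C1_compact \<Omega>) v g"
proof -
  obtain g where vL: "v \<in> Lp_space p \<Omega>" and g: "g \<in> Lp_space p \<Omega>" "has_weak_gradient \<Omega> v g"
    using assms by (auto simp: W1p0_space_def W1p_space_def)
  have "approx p \<Omega> (C1_compact \<Omega>) v g"
    unfolding approx_def
  proof (intro conjI allI impI Lp_spaceD(1)[OF vL] Lp_spaceD(1)[OF g(1)])
    fix e :: real assume e: "0 < e"
    define e1 where "e1 = e powr (1 / p)"
    have e1: "e1 > 0" "e1 powr p = e" using e p by (auto simp: e1_def powr_powr)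
    obtain \<psi> where \<psi>: "\<psi> \<in> C1_compact \<Omega>" "W1p_norm p \<Omega> (\<lambda>x. v x - \<psi> x) < e1"
      using assms e1(1) by (auto simp: W1p0_space_def)
    have c: "\<psi> \<in> C1" using \<psi> C1_compact_subset by blast
    have "Lp_norm p \<Omega> (\<lambda>x. v x - \<psi> x) + Lp_norm p \<Omega> (\<lambda>x. g x - grad \<psi> x) < e1"
      using \<psi>(2) W1p_norm_diff[OF g(2) Lp_spaceD(1)[OF g(1)] C1_has_weak_gradient[OF c]] C1_measurable_domain[OF c] by simp
    then have "Lp_norm p \<Omega> (\<lambda>x. v x - \<psi> x) < e1" "Lp_norm p \<Omega> (\<lambda>x. g x - grad \<psi> x) < e1"
      using Lp_norm_nonneg[of p "\<lambda>x. v x - \<psi> x"] Lp_norm_nonneg[of p "\<lambda>x. g x - grad \<psi> x"] by linarith+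
    then have "D v \<psi> < ennreal e" "D g (grad \<psi>) < ennreal e"
      using e1 vL g C1_Lp_space[OF c] by (simp_all add: Lp_norm_less_iff Lp_space_diff Lpd_diff_zero)
    then show "\<exists>\<psi>\<in>C1_compact \<Omega>. D \<psi> v < ennreal e \<and> D (grad \<psi>) g < ennreal e"
      using \<psi>(1) by (auto simp: Lpd_commute)
  qed
  then show ?thesis by blast
qed

lemma approx_W1p0_space:
  assumes a: "approx p \<Omega> (C1_compact \<Omega>) v g"
  shows "v \<in> W1p0_space p \<Omega>"
proof -
  note L = approx_Lp_space[OF a C1_compact_subset]
  note w = approx_has_weak_gradient[OF a C1_compact_subset]
  have "\<exists>\<psi>\<in>C1_compact \<Omega>. W1p_norm p \<Omega> (\<lambda>x. v x - \<psi> x) < e" if e: "0 < e" for e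
  proof -
    have "(e / 2) powr p > 0" using e by simp
    then obtain \<psi> where \<psi>: "\<psi> \<in> C1_compact \<Omega>" "D \<psi> v < ennreal ((e / 2) powr p)" "D (grad \<psi>) g < ennreal ((e / 2) powr p)"
      using a unfolding approx_def by blast
    have c: "\<psi> \<in> C1" using \<psi> C1_compact_subset by blast
    show ?thesis
      using W1p_norm_diff_less[OF w C1_has_weak_gradient[OF c] L C1_Lp_space[OF c] e] \<psi> by (auto simp: Lpd_commute)
  qed
  then show ?thesis
    using L w by (auto simp: W1p0_space_def W1p_space_def)
qed

text \<open>Mollification near the boundary of the domain uses values outside it, so
  \<open>\<phi>\<close> is approximated on the whole space and the result restricted afterwards. The
  approximants respect the bound \<open>M\<close> at every point, not only almost
  everywhere.\<close>

lemma W1p_UNIV_approx: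
  assumes \<phi>: "\<phi> \<in> Lp_space p UNIV" and g: "g \<in> Lp_space p UNIV" and w: "has_weak_gradient UNIV \<phi> g"
    and M: "AE x in lebesgue. \<phi> x \<le> M"
  shows "approx p \<Omega> {f \<in> C1. \<forall>x. f x \<le> M} \<phi> g"
proof -
  have m: "\<phi> \<in> borel_measurable lebesgue" "g \<in> borel_measurable lebesgue"
    using \<phi> g by (auto simp: Lp_space_def lebesgue_on_UNIV_eq)
  obtain \<phi>' where \<phi>'[measurable]: "\<phi>' \<in> borel_measurable borel" and e1: "AE x in lborel. \<phi> x = \<phi>' x"
    using lebesgue_ex_borel[OF m(1)] by blast
  obtain g' where g'[measurable]: "g' \<in> borel_measurable borel" and e2: "AE x in lborel. g x = g' x"
    using lebesgue_ex_borel[OF m(2)] by blast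
  note e1' = AE_completion[OF e1] and e2' = AE_completion[OF e2]
  have fin: "(Lp_mass p lborel h') < \<infinity>"
    if "h \<in> Lp_space p UNIV" "AE x in lborel. h x = h' x" "h' \<in> borel_measurable borel" for h h' :: "'a \<Rightarrow> 'b::euclidean_space"
  proof -
    have [measurable]: "h' \<in> borel_measurable borel" by fact
    have "(Lp_mass p lborel h') = (Lp_mass p lebesgue h')"
      by (subst nn_integral_completion) auto
    also have "\<dots> = (Lp_mass p lebesgue h)"
      using AE_completion[OF that(2)] by (intro nn_integral_cong_AE) (auto elim!: eventually_mono)
    also have "\<dots> < \<infinity>"
      using that(1) by (auto simp: Lp_space_def lebesgue_on_UNIV_eq integrable_iff_bounded)
    finally show ?thesis .
  qed
  have wk: "(\<integral>x. \<phi>' x * partial_derivative b \<psi> x \<partial>lborel) = - (\<integral>x. (g' x \<bullet> b) * \<psi> x \<partial>lborel)"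
    if \<psi>: "\<psi> \<in> C1_compact UNIV" and b: "b \<in> Basis" for \<psi> b
  proof -
    have c: "\<psi> \<in> C1" using \<psi> by (simp add: C1_compact_iff)
    have pd: "partial_derivative b \<psi> = (\<lambda>x. grad \<psi> x \<bullet> b)" using grad_inner_Basis[OF b] by auto
    have [measurable]: "\<psi> \<in> borel_measurable borel" "grad \<psi> \<in> borel_measurable borel"
      using c by (auto intro: C1_borel C1_grad_borel)
    have [measurable]: "\<phi> \<in> borel_measurable lebesgue" "g \<in> borel_measurable lebesgue"
      "\<psi> \<in> borel_measurable lebesgue" "grad \<psi> \<in> borel_measurable lebesgue"
      "\<phi>' \<in> borel_measurable lebesgue" "g' \<in> borel_measurable lebesgue"
      using m by (auto intro!: measurable_completion)
    have "(\<integral>x. \<phi>' x * partial_derivative b \<psi> x \<partial>lborel) = (\<integral>x. \<phi>' x * (grad \<psi> x \<bullet> b) \<partial>lebesgue)"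
      unfolding pd by (subst integral_completion) auto
    also have "\<dots> = (\<integral>x. \<phi> x * (grad \<psi> x \<bullet> b) \<partial>lebesgue)"
      by (rule integral_cong_AE) (measurable, use e1' in \<open>auto elim!: eventually_mono\<close>)
    also have "\<dots> = - (\<integral>x. (g x \<bullet> b) * \<psi> x \<partial>lebesgue)"
    proof -
      have "(\<integral>x. \<phi> x * partial_derivative b \<psi> x \<partial>lebesgue) = - (\<integral>x. (g x \<bullet> b) * \<psi> x \<partial>lebesgue)"
        using w \<psi> b unfolding has_weak_gradient_def lebesgue_on_UNIV_eq by blast
      then show ?thesis by (simp only: pd)
    qed
    also have "(\<integral>x. (g x \<bullet> b) * \<psi> x \<partial>lebesgue) = (\<integral>x. (g' x \<bullet> b) * \<psi> x \<partial>lebesgue)"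
      by (rule integral_cong_AE) (measurable, use e2' in \<open>auto elim!: eventually_mono\<close>)
    also have "\<dots> = (\<integral>x. (g' x \<bullet> b) * \<psi> x \<partial>lborel)"
      by (subst integral_completion) auto
    finally show ?thesis .
  qed
  have M': "AE x in lborel. \<phi>' x \<le> M"
  proof -
    have "AE x in lebesgue. \<phi>' x \<le> M" using M e1' by eventually_elim simp
    then show ?thesis by (subst (asm) AE_completion_iff) auto
  qed
  have dom: "D f h \<le> Lp_mass p lborel (\<lambda>x. f x - h' x)"
    if [measurable]: "f \<in> borel_measurable borel" "h' \<in> borel_measurable borel" and eq: "AE x in lborel. h x = h' x"
    for f h h' :: "'a \<Rightarrow> 'b::euclidean_space"
  proof -
    have "D f h = (\<integral>\<^sup>+x. ennreal (norm (f x - h x) powr p) * indicator \<Omega> x \<partial>lebesgue)"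
      unfolding Lpd_def by (subst nn_integral_restrict_space) auto
    also have "\<dots> \<le> (Lp_mass p lebesgue (\<lambda>x. f x - h' x))"
      using AE_completion[OF eq] by (intro nn_integral_mono_AE) (auto elim!: eventually_mono simp: indicator_def)
    also have "\<dots> = Lp_mass p lborel (\<lambda>x. f x - h' x)"
      by (subst nn_integral_completion) auto
    finally show ?thesis .
  qed
  show ?thesis
    unfolding approx_def
  proof (intro conjI allI impI)
    show "\<phi> \<in> borel_measurable \<mu>" "g \<in> borel_measurable \<mu>"
      using m by (auto intro: measurable_restrict_space1)
    fix e :: real assume e: "0 < e"
    obtain \<psi> where \<psi>: "\<psi> \<in> C1" "\<forall>x. \<psi> x \<le> M" "Lp_mass p lborel (\<lambda>x. \<psi> x - \<phi>' x) < ennreal e"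
      "Lp_mass p lborel (\<lambda>x. grad \<psi> x - g' x) < ennreal e"
      using weak_derivative_approx[OF \<phi>' g' p fin[OF \<phi> e1 \<phi>'] fin[OF g e2 g'] wk M' e] by blast
    show "\<exists>\<psi>\<in>{f \<in> C1. \<forall>x. f x \<le> M}. D \<psi> \<phi> < ennreal e \<and> D (grad \<psi>) g < ennreal e"
      using \<psi> dom[OF C1_borel[OF \<psi>(1)] \<phi>' e1] dom[OF C1_grad_borel[OF \<psi>(1)] g' e2]
      by (intro bexI[of _ \<psi>]) (auto intro: order.strict_trans1)
  qed
qed

text \<open>\<open>u x - min (u x) s\<close> is the positive part of \<open>u x - s\<close>. Off a
  compact part of the domain the approximants of \<open>u\<close> are at most \<open>M\<close>,
  those of the shifted wave at least \<open>t\<close>, and \<open>M \<le> t\<close>; so the positive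
  part is approximable with compact support and the boundary data do not change.\<close>

lemma approx_truncate:
  assumes u: "approx p \<Omega> (C1_le M) u g" and t: "M \<le> t" and a: "0 < a"
  shows "approx p \<Omega> (C1_compact \<Omega>) (\<lambda>x. u x - min (u x) (t + wave a \<xi> x))
     (\<lambda>x. g x - (if t + wave a \<xi> x < u x then wave_grad a \<xi> x else g x))"
proof -
  have "approx p \<Omega> {f \<in> C1. \<forall>x. t \<le> f x} (\<lambda>x. t + 1 * wave a \<xi> x) (\<lambda>x. grad (\<lambda>_. t) x + 1 *\<^sub>R wave_grad a \<xi> x)"
    by (rule approx_comb[OF approx_self[of "\<lambda>_. t" "{\<lambda>_. t}"] approx_wave[OF a]]) (auto intro: C1_const C1_add)
  then have z: "approx p \<Omega> {f \<in> C1. \<forall>x. t \<le> f x} (\<lambda>x. t + wave a \<xi> x) (wave_grad a \<xi>)"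
    by (simp add: grad_const)
  have "approx p \<Omega> (C1_le 0) (\<lambda>x. u x + (-1) * (t + wave a \<xi> x)) (\<lambda>x. g x + (-1) *\<^sub>R wave_grad a \<xi> x)"
  proof (rule approx_comb[OF u z C1_le_subset])
    fix f h :: "'a \<Rightarrow> real" assume f: "f \<in> C1_le M" and h: "h \<in> {f \<in> C1. \<forall>x. t \<le> f x}"
    obtain K where K: "f \<in> C1" "compact K" "K \<subseteq> \<Omega>" "\<And>x. x \<notin> K \<Longrightarrow> f x \<le> M" using f by (auto simp: C1_le_def)
    have "f x - h x \<le> 0" if "x \<notin> K" for x using K(4)[OF that] h t by (simp add: order_trans)
    then show "(\<lambda>x. f x + (-1) * h x) \<in> C1_le 0"
      using K h by (auto simp: C1_le_def intro!: C1_diff)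
  qed auto
  from approx_pos_part[OF this]
  show ?thesis
  proof (rule arg_cong2[where f="approx p \<Omega> (C1_compact \<Omega>)", THEN iffD1, rotated 2])
    show "(\<lambda>x. max 0 (u x + (-1) * (t + wave a \<xi> x))) = (\<lambda>x. u x - min (u x) (t + wave a \<xi> x))"
      by (auto simp: max_def min_def)
    show "(\<lambda>x. if 0 < u x + (-1) * (t + wave a \<xi> x) then g x + (-1) *\<^sub>R wave_grad a \<xi> x else 0)
      = (\<lambda>x. g x - (if t + wave a \<xi> x < u x then wave_grad a \<xi> x else g x))"
      by auto
  qed
qed


section \<open>Cheap levels\<close>

text \<open>The identity for compactly supported \<open>C1\<close> functions passes to the limit
  because closeness in L^p on the bounded domain implies closeness in L^1.\<close>

lemma approx_compact_integral_zero:
  assumes a: "approx p \<Omega> (C1_compact \<Omega>) f g"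
  shows "(\<integral>x. g x \<partial>\<mu>) = 0"
proof -
  note L = approx_Lp_space(2)[OF a C1_compact_subset]
  have "norm (\<integral>x. g x \<partial>\<mu>) \<le> 0 + e" if e: "0 < e" for e
  proof -
    obtain e' where e': "e' > 0" "\<forall>f h::'a \<Rightarrow> 'a. f \<in> borel_measurable \<mu> \<longrightarrow> h \<in> borel_measurable \<mu> \<longrightarrow> D f h < ennreal e' \<longrightarrow>
          (\<integral>\<^sup>+x. ennreal (norm (f x - h x)) \<partial>\<mu>) < ennreal e"
      using Lpd_imp_L1[OF e] by blast
    obtain \<psi> where \<psi>: "\<psi> \<in> C1_compact \<Omega>" "D (grad \<psi>) g < ennreal e'"
      using a e'(1) unfolding approx_def by blast
    have c: "\<psi> \<in> C1" using \<psi> C1_compact_subset by blast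
    note cL = C1_Lp_space(2)[OF c]
    note i = Lp_spaceD(4)[OF cL] Lp_spaceD(4)[OF L]
    have \<psi>U: "\<psi> \<in> C1_compact UNIV" using \<psi>(1) C1_compact_mono[of \<Omega> UNIV] by blast
    obtain K where K: "compact K" "K \<subseteq> \<Omega>" "\<And>x. x \<notin> K \<Longrightarrow> \<psi> x = 0" using \<psi>(1) by (auto simp: C1_compact_iff)
    have gz: "grad \<psi> x = 0" if "x \<notin> \<Omega>" for x
      using C1_zero_outside_grad[OF c compact_imp_closed[OF K(1)] K(3), of x] that K(2) by blast
    have "(\<integral>x. grad \<psi> x \<partial>\<mu>) = (\<integral>x. grad \<psi> x \<partial>lborel)"
      by (rule integral_lebesgue_on_eq_lborel) (use gz C1_grad_borel[OF c] in auto)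
    also have "\<dots> = 0" by (rule integral_grad_C1_compact[OF \<psi>U])
    finally have z: "(\<integral>x. grad \<psi> x \<partial>\<mu>) = 0" .
    have "norm (\<integral>x. g x \<partial>\<mu>) = norm (\<integral>x. grad \<psi> x - g x \<partial>\<mu>)"
      using i z by simp
    also have "\<dots> \<le> (\<integral>x. norm (grad \<psi> x - g x) \<partial>\<mu>)" by (rule integral_norm_bound)
    also have "\<dots> \<le> e"
    proof -
      have "(\<integral>\<^sup>+x. ennreal (norm (grad \<psi> x - g x)) \<partial>\<mu>) < ennreal e"
        using e'(2) \<psi>(2) Lp_spaceD(1)[OF cL] Lp_spaceD(1)[OF L] by blast
      also have "(\<integral>\<^sup>+x. ennreal (norm (grad \<psi> x - g x)) \<partial>\<mu>) = ennreal (\<integral>x. norm (grad \<psi> x - g x) \<partial>\<mu>)"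
        using i by (intro nn_integral_eq_integral) auto
      finally show ?thesis using e by (simp add: ennreal_less_iff less_imp_le)
    qed
    finally show ?thesis by simp
  qed
  then have "norm (\<integral>x. g x \<partial>\<mu>) \<le> 0" by (rule field_le_epsilon)
  then show ?thesis by simp
qed

text \<open>The integrand is the gradient witness of the positive part of \<open>u - t\<close>,
  which is approximable with compact support.\<close>

lemma integral_gradient_superlevel:
  assumes u: "approx p \<Omega> (C1_le M) u g" and t: "M \<le> t"
  shows "(\<integral>x. (if t < u x then g x else 0) \<partial>\<mu>) = 0"
proof -
  have "approx p \<Omega> (C1_le 0) (\<lambda>x. u x + (-1) * t) (\<lambda>x. g x + (-1) *\<^sub>R grad (\<lambda>_. t) x)"
  proof (rule approx_comb[OF u approx_self[of "\<lambda>_. t" "{\<lambda>_. t}"] C1_le_subset])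
    fix f h :: "'a \<Rightarrow> real" assume f: "f \<in> C1_le M" and h: "h \<in> {\<lambda>_. t}"
    obtain K where K: "f \<in> C1" "compact K" "K \<subseteq> \<Omega>" "\<And>x. x \<notin> K \<Longrightarrow> f x \<le> M" using f by (auto simp: C1_le_def)
    have "f x - h x \<le> 0" if "x \<notin> K" for x using K(4)[OF that] h t by simp
    then show "(\<lambda>x. f x + (-1) * h x) \<in> C1_le 0"
      using K h by (auto simp: C1_le_def intro!: C1_diff C1_const)
  qed (auto intro: C1_const)
  from approx_compact_integral_zero[OF approx_pos_part[OF this]]
  show ?thesis by (simp add: grad_const cong: if_cong)
qed

text \<open>
  The vector measure \<open>B \<mapsto> \<integral>\<^bsub>u\<in>B\<^esub> \<nabla>u\<close> vanishes on half-lines above the boundary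
  values, hence on all Borel sets; this replaces the chain rule for \<open>Z(u)\<close> with \<open>Z'\<close> merely measurable.
\<close>
lemma integral_gradient_preimage:
  assumes u: "approx p \<Omega> (C1_le M) u g" and B: "B \<in> sets borel"
  shows "(LINT x:{x \<in> \<Omega>. u x \<in> B \<and> M < u x}|\<mu>. g x) = 0"
proof -
  have [measurable]: "u \<in> borel_measurable \<mu>" "g \<in> borel_measurable \<mu>" using u by (auto simp: approx_def)
  have gi: "integrable \<mu> g" using Lp_spaceD(4)[OF approx_Lp_space(2)[OF u C1_le_subset]] .
  \<comment> \<open>Keeping \<open>M < u x\<close> in the definition makes complements relative to
    the set where \<open>u\<close> exceeds \<open>M\<close>, over which the integral is itself zero;
    the complement step of the induction rests on this.\<close>
  define E where "E B = {x \<in> \<Omega>. u x \<in> B \<and> M < u x}" for B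
  have E: "E B \<in> sets \<mu>" if "B \<in> sets borel" for B
  proof -
    have [measurable]: "B \<in> sets borel" by fact
    have "{x \<in> space \<mu>. u x \<in> B \<and> M < u x} \<in> sets \<mu>" by measurable
    then show ?thesis by (simp add: E_def)
  qed
  have si: "set_integrable \<mu> (E B) g" if "B \<in> sets borel" for B
    unfolding set_integrable_def using E[OF that] gi by (rule integrable_mult_indicator)
  have gen: "(LINT x:E {t<..}|\<mu>. g x) = 0" for t
  proof -
    have "(LINT x:E {t<..}|\<mu>. g x) = (\<integral>x. (if max M t < u x then g x else 0) \<partial>\<mu>)"
      unfolding set_lebesgue_integral_def by (intro Bochner_Integration.integral_cong) (auto simp: E_def indicator_def)
    also have "\<dots> = 0" by (rule integral_gradient_superlevel[OF u]) simp
    finally show ?thesis .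
  qed
  have all: "(LINT x:E UNIV|\<mu>. g x) = 0"
  proof -
    have "E UNIV = E {M<..}" by (auto simp: E_def)
    then show ?thesis using gen[of M] by simp
  qed
  have "Int_stable (range (\<lambda>t::real. {t<..}))"
  proof -
    have "{a<..} \<inter> {b<..} = {max a b<..}" for a b :: real by auto
    then show ?thesis by (auto simp: Int_stable_def)
  qed
  moreover have "range (\<lambda>t::real. {t<..}) \<subseteq> Pow UNIV" by simp
  moreover have "B \<in> sigma_sets UNIV (range (\<lambda>t::real. {t<..}))"
    using B unfolding borel_Ioi by simp
  ultimately have "(LINT x:E B|\<mu>. g x) = 0"
  proof (induction rule: sigma_sets_induct_disjoint)
    case (basic A)
    then show ?case using gen by auto
  next
    case empty
    then show ?case by (simp add: E_def set_lebesgue_integral_def)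
  next
    case (compl A)
    then have A: "A \<in> sets borel" unfolding borel_Ioi by simp
    have "E UNIV = E A \<union> E (UNIV - A)" "E A \<inter> E (UNIV - A) = {}" by (auto simp: E_def)
    then have "(LINT x:E UNIV|\<mu>. g x) = (LINT x:E A|\<mu>. g x) + (LINT x:E (UNIV - A)|\<mu>. g x)"
      using si[OF A] si[of "UNIV - A"] A by (auto intro!: set_integral_Un)
    then show ?case using all compl by simp
  next
    case (union A)
    then have A: "A i \<in> sets borel" for i unfolding borel_Ioi by auto
    have "E (\<Union>i. A i) = (\<Union>i. E (A i))" by (auto simp: E_def)
    moreover have "(LINT x:(\<Union>i. E (A i))|\<mu>. g x) = (\<Sum>i. (LINT x:E (A i)|\<mu>. g x))"
    proof (rule lebesgue_integral_countable_add)
      show "set_integrable \<mu> (\<Union>i. E (A i)) g"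
        using si[of "\<Union>i. A i"] A by (simp add: \<open>E (\<Union>i. A i) = (\<Union>i. E (A i))\<close>)
      show "i \<noteq> j \<Longrightarrow> E (A i) \<inter> E (A j) = {}" for i j
        using disjoint_family_onD[OF union(1), of i j] by (auto simp: E_def)
    qed (use E A in auto)
    ultimately show ?case using union(3) by simp
  qed
  then show ?thesis by (simp add: E_def)
qed

lemma measurable_integrand:
  fixes H :: "real \<Rightarrow> 'a \<Rightarrow> real"
  assumes H: "continuous_on UNIV (\<lambda>(t, \<xi>). H t \<xi>)" and "u \<in> borel_measurable \<mu>" "g \<in> borel_measurable \<mu>"
  shows "(\<lambda>x. H (u x) (g x)) \<in> borel_measurable \<mu>"
  using borel_measurable_continuous_on[OF H borel_measurable_Pair[OF assms(2,3)]] by simp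

lemma continuous_integrand:
  fixes H :: "real \<Rightarrow> 'a \<Rightarrow> real" and A :: "'b::topological_space set"
  assumes H: "continuous_on UNIV (\<lambda>(t, \<xi>). H t \<xi>)"
    and "continuous_on A a" "continuous_on A b"
  shows "continuous_on A (\<lambda>x. H (a x) (b x))"
proof -
  have "continuous_on A (\<lambda>x. (\<lambda>(t, \<xi>). H t \<xi>) (a x, b x))"
    by (rule continuous_on_compose2[OF H]) (auto intro!: continuous_intros assms)
  then show ?thesis by simp
qed

text \<open>Where \<open>u\<close> takes values in one Borel piece, one fixed \<open>z j\<close>
  replaces the subgradient and its linear term integrates to zero. What remains is bounded by the
  integral of \<open>H (u x) (g x) + norm (g x)\<close> over the same piece, with no constant
  depending on \<open>j\<close>, so the pieces can be summed.\<close>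

lemma nn_integral_subgradient_bound:
  fixes H :: "real \<Rightarrow> 'a \<Rightarrow> real"
  assumes u: "approx p \<Omega> (C1_le M) u g"
    and H: "continuous_on UNIV (\<lambda>(t, \<xi>). H t \<xi>)" and nn: "\<And>t \<xi>. 0 \<le> H t \<xi>"
    and A: "\<And>t. \<exists>\<zeta>. \<forall>\<xi>. H t 0 + \<zeta> \<bullet> \<xi> \<le> H t \<xi>"
    and i: "integrable \<mu> (\<lambda>x. H (u x) (g x))"
  shows "(\<integral>\<^sup>+x. ennreal (if M < u x then H (u x) 0 else 0) \<partial>\<mu>) < \<infinity>"
proof -
  have m[measurable]: "u \<in> borel_measurable \<mu>" "g \<in> borel_measurable \<mu>" using u by (auto simp: approx_def)
  have gi: "integrable \<mu> g" using Lp_spaceD(4)[OF approx_Lp_space(2)[OF u C1_le_subset]] .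
  have m0[measurable]: "(\<lambda>x. H (u x) 0) \<in> borel_measurable \<mu>"
    by (rule measurable_integrand[OF H]) measurable
  obtain Q :: "'a set" where Q: "countable Q" "\<And>X. open X \<Longrightarrow> X \<noteq> {} \<Longrightarrow> \<exists>d\<in>Q. d \<in> X"
    using countable_dense_exists by blast
  have Qne: "Q \<noteq> {}" using Q(2)[of UNIV] by auto
  define z where "z = from_nat_into Q"
  have rz: "range z = Q" unfolding z_def by (rule range_from_nat_into[OF Qne Q(1)])
  \<comment> \<open>Levels at which \<open>z j\<close> is a subgradient up to the error
    \<open>norm \<xi>\<close>. The slack pays for replacing a true subgradient by a point of the
    dense set at distance below \<open>1\<close>; continuity of \<open>H\<close> makes the set
    closed, hence Borel.\<close>
  define B where "B j = {t. \<forall>\<xi>. H t 0 + z j \<bullet> \<xi> \<le> H t \<xi> + norm \<xi>}" for j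
  have Bc: "closed (B j)" for j
    unfolding B_def
    by (intro closed_Collect_all closed_Collect_le continuous_intros continuous_integrand[OF H])
  have cover: "(\<Union>j. B j) = UNIV"
  proof -
    have "\<exists>j. t \<in> B j" for t
    proof -
      obtain \<zeta> where \<zeta>: "\<And>\<xi>. H t 0 + \<zeta> \<bullet> \<xi> \<le> H t \<xi>" using A by blast
      obtain d where d: "d \<in> Q" "d \<in> ball \<zeta> 1" using Q(2)[of "ball \<zeta> 1"] by auto
      then obtain j where j: "d = z j" using rz by auto
      have "H t 0 + z j \<bullet> \<xi> \<le> H t \<xi> + norm \<xi>" for \<xi>
      proof -
        have "(z j - \<zeta>) \<bullet> \<xi> \<le> norm (z j - \<zeta>) * norm \<xi>" by (rule norm_cauchy_schwarz)
        also have "\<dots> \<le> 1 * norm \<xi>"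
          using d j by (intro mult_right_mono) (auto simp: dist_norm norm_minus_commute)
        finally show ?thesis using \<zeta>[of \<xi>] by (simp add: inner_diff_left)
      qed
      then show ?thesis by (auto simp: B_def)
    qed
    then show ?thesis by auto
  qed
  \<comment> \<open>Disjoint pieces assign exactly one \<open>z j\<close> to each level.\<close>
  define C where "C = disjointed B"
  have C: "C j \<in> sets borel" "C j \<subseteq> B j" for j
    using sets.range_disjointed_sets[of B borel] Bc disjointed_subset[of B j] by (auto simp: C_def image_subset_iff)
  have Cd: "disjoint_family C" and CU: "(\<Union>j. C j) = UNIV"
    using disjoint_family_disjointed[of B] UN_disjointed_eq[of B] cover by (auto simp: C_def)
  define E where "E j = {x \<in> \<Omega>. u x \<in> C j \<and> M < u x}" for j
  have E[measurable]: "E j \<in> sets \<mu>" for j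
  proof -
    have [measurable]: "C j \<in> sets borel" by (rule C)
    have "{x \<in> space \<mu>. u x \<in> C j \<and> M < u x} \<in> sets \<mu>" by measurable
    then show ?thesis by (simp add: E_def)
  qed
  have Ed: "disjoint_family E" using Cd unfolding disjoint_family_on_def E_def by blast
  have sub: "(\<integral>\<^sup>+x. ennreal (H (u x) 0) * indicator (E j) x \<partial>\<mu>)
     \<le> (\<integral>\<^sup>+x. ennreal (H (u x) (g x) + norm (g x)) * indicator (E j) x \<partial>\<mu>)" for j
  proof -
    define r where "r x = indicator (E j) x *\<^sub>R (H (u x) (g x) + norm (g x))" for x
    have ri: "integrable \<mu> r" unfolding r_def using i gi by (intro integrable_mult_indicator) auto
    have gE: "integrable \<mu> (\<lambda>x. indicator (E j) x *\<^sub>R g x)" using gi by (intro integrable_mult_indicator) auto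
    have g0: "(\<integral>x. indicator (E j) x *\<^sub>R g x \<partial>\<mu>) = 0"
      using integral_gradient_preimage[OF u C(1)[of j]] by (simp add: set_lebesgue_integral_def E_def)
    have i2: "integrable \<mu> (\<lambda>x. r x - z j \<bullet> (indicator (E j) x *\<^sub>R g x))"
      using ri gE by (intro Bochner_Integration.integrable_diff integrable_inner_right) auto
    have le: "H (u x) 0 * indicator (E j) x \<le> r x - z j \<bullet> (indicator (E j) x *\<^sub>R g x)" for x
    proof (cases "x \<in> E j")
      case True
      then have "u x \<in> B j" using C(2) by (auto simp: E_def)
      then have "H (u x) 0 + z j \<bullet> g x \<le> H (u x) (g x) + norm (g x)" by (auto simp: B_def)
      then show ?thesis using True by (simp add: r_def)
    qed (simp add: r_def)
    have "(\<integral>\<^sup>+x. ennreal (H (u x) 0) * indicator (E j) x \<partial>\<mu>) \<le> (\<integral>\<^sup>+x. ennreal (r x - z j \<bullet> (indicator (E j) x *\<^sub>R g x)) \<partial>\<mu>)"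
    proof (rule nn_integral_mono)
      fix x
      show "ennreal (H (u x) 0) * indicator (E j) x \<le> ennreal (r x - z j \<bullet> (indicator (E j) x *\<^sub>R g x))"
        using le[of x] by (cases "x \<in> E j") (auto intro: ennreal_leI)
    qed
    also have "\<dots> = ennreal (\<integral>x. r x - z j \<bullet> (indicator (E j) x *\<^sub>R g x) \<partial>\<mu>)"
    proof (rule nn_integral_eq_integral[OF i2], rule AE_I2)
      show "0 \<le> r x - z j \<bullet> (indicator (E j) x *\<^sub>R g x)" for x
        by (rule order_trans[OF mult_nonneg_nonneg[OF nn indicator_pos_le] le])
    qed
    also have "(\<integral>x. r x - z j \<bullet> (indicator (E j) x *\<^sub>R g x) \<partial>\<mu>) = (\<integral>x. r x \<partial>\<mu>) - z j \<bullet> (\<integral>x. indicator (E j) x *\<^sub>R g x \<partial>\<mu>)"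
      using ri gE by (subst Bochner_Integration.integral_diff) (auto simp del: inner_scaleR_right)
    also have "\<dots> = (\<integral>x. r x \<partial>\<mu>)" by (simp add: g0)
    also have "ennreal (\<integral>x. r x \<partial>\<mu>) = (\<integral>\<^sup>+x. ennreal (r x) \<partial>\<mu>)"
      using nn by (intro nn_integral_eq_integral[OF ri, symmetric] AE_I2) (auto simp: r_def)
    also have "\<dots> = (\<integral>\<^sup>+x. ennreal (H (u x) (g x) + norm (g x)) * indicator (E j) x \<partial>\<mu>)"
      by (intro nn_integral_cong) (auto simp: r_def indicator_def)
    finally show ?thesis .
  qed
  have EU: "(\<Union>j. E j) = {x \<in> \<Omega>. M < u x}" using CU by (auto simp: E_def)
  have "(\<integral>\<^sup>+x. ennreal (if M < u x then H (u x) 0 else 0) \<partial>\<mu>) = (\<integral>\<^sup>+x\<in>(\<Union>j. E j). ennreal (H (u x) 0) \<partial>\<mu>)"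
    unfolding EU by (intro nn_integral_cong) (auto simp: indicator_def)
  also have "\<dots> = (\<Sum>j. \<integral>\<^sup>+x\<in>E j. ennreal (H (u x) 0) \<partial>\<mu>)"
    by (intro nn_integral_disjoint_family Ed) auto
  also have "\<dots> \<le> (\<Sum>j. \<integral>\<^sup>+x\<in>E j. ennreal (H (u x) (g x) + norm (g x)) \<partial>\<mu>)"
    by (intro suminf_le sub) auto
  also have "\<dots> = (\<integral>\<^sup>+x\<in>(\<Union>j. E j). ennreal (H (u x) (g x) + norm (g x)) \<partial>\<mu>)"
    using i by (intro nn_integral_disjoint_family[symmetric] Ed) auto
  also have "\<dots> \<le> (\<integral>\<^sup>+x. ennreal (H (u x) (g x) + norm (g x)) \<partial>\<mu>)"
    by (intro nn_integral_mono) (auto simp: indicator_def)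
  also have "\<dots> < \<infinity>"
  proof -
    have "integrable \<mu> (\<lambda>x. H (u x) (g x) + norm (g x))" using i gi by auto
    then show ?thesis using nn by (simp add: integrable_iff_bounded)
  qed
  finally show ?thesis .
qed

section \<open>Levels whose cost is small against the measure of the superlevel set\<close>

lemma superlevel_integral_tendsto_zero:
  assumes [measurable]: "u \<in> borel_measurable \<mu>" "f \<in> borel_measurable \<mu>"
    and fin: "(\<integral>\<^sup>+x. ennreal (if M < u x then f x else 0) \<partial>\<mu>) < \<infinity>"
  shows "(\<lambda>n::nat. \<integral>\<^sup>+x. ennreal (if max M (real n) < u x then f x else 0) \<partial>\<mu>) \<longlonglongrightarrow> 0"
proof -
  have "(\<lambda>n::nat. \<integral>\<^sup>+x. ennreal (if max M (real n) < u x then f x else 0) \<partial>\<mu>) \<longlonglongrightarrow> (\<integral>\<^sup>+x. 0 \<partial>\<mu>)"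
  proof (rule nn_integral_dominated_convergence[OF _ _ _ _ fin])
    show "AE x in \<mu>. (\<lambda>n. ennreal (if max M (real n) < u x then f x else 0)) \<longlonglongrightarrow> 0"
    proof (rule AE_I2)
      fix x
      obtain N :: nat where N: "u x \<le> real N" using real_arch_simple by blast
      then have "ennreal (if max M (real n) < u x then f x else 0) = 0" if "n \<ge> N" for n
        using that by auto
      then show "(\<lambda>n. ennreal (if max M (real n) < u x then f x else 0)) \<longlonglongrightarrow> 0"
        by (intro tendsto_eventually) (unfold eventually_sequentially, blast)
    qed
  qed auto
  then show ?thesis by simp
qed

text \<open>A near-minimiser of \<open>J\<close> over all levels from \<open>max M (real n)\<close>
  upwards costs at most one more than \<open>J (u x) (w x)\<close> at each point with
  \<open>t < u x\<close>. Its cost times the measure of these points is therefore at most an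
  integral over a high superlevel set, and such integrals tend to zero.\<close>

lemma exists_cheap_level:
  fixes J :: "real \<Rightarrow> 'b \<Rightarrow> real"
  assumes [measurable]: "u \<in> borel_measurable \<mu>" "(\<lambda>x. J (u x) (w x)) \<in> borel_measurable \<mu>"
    and nn: "\<And>t \<xi>. 0 \<le> J t \<xi>"
    and fin: "(\<integral>\<^sup>+x. ennreal (if M < u x then J (u x) (w x) else 0) \<partial>\<mu>) < \<infinity>" and e: "0 < e"
  shows "\<exists>t\<ge>m. \<exists>\<xi>. ennreal (J t \<xi> + 1) * emeasure \<mu> {x \<in> \<Omega>. t < u x} < ennreal e"
proof -
  interpret finite_measure \<mu> by (rule finite_measure_domain)
  have "(\<integral>\<^sup>+x. ennreal (if M < u x then J (u x) (w x) + 2 else 0) \<partial>\<mu>)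
     \<le> (\<integral>\<^sup>+x. ennreal (if M < u x then J (u x) (w x) else 0) + ennreal 2 \<partial>\<mu>)"
    using nn by (intro nn_integral_mono) auto
  also have "\<dots> = (\<integral>\<^sup>+x. ennreal (if M < u x then J (u x) (w x) else 0) \<partial>\<mu>) + ennreal 2 * emeasure \<mu> \<Omega>"
    by (subst nn_integral_add) auto
  also have "\<dots> < \<infinity>" using fin by (simp add: ennreal_mult_less_top emeasure_eq_measure)
  finally have "(\<lambda>n::nat. \<integral>\<^sup>+x. ennreal (if max M (real n) < u x then J (u x) (w x) + 2 else 0) \<partial>\<mu>) \<longlonglongrightarrow> 0"
    by (intro superlevel_integral_tendsto_zero) auto
  then have "eventually (\<lambda>n::nat. (\<integral>\<^sup>+x. ennreal (if max M (real n) < u x then J (u x) (w x) + 2 else 0) \<partial>\<mu>) < ennreal e) sequentially"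
    using e by (intro order_tendstoD) auto
  moreover have "eventually (\<lambda>n::nat. m \<le> real n) sequentially"
    by (meson eventually_at_top_linorder le_nat_floor of_nat_le_iff order_trans real_arch_simple)
  ultimately have "eventually (\<lambda>n::nat. (\<integral>\<^sup>+x. ennreal (if max M (real n) < u x then J (u x) (w x) + 2 else 0) \<partial>\<mu>) < ennreal e \<and> m \<le> real n) sequentially"
    by (rule eventually_conj)
  then obtain n :: nat where n: "(\<integral>\<^sup>+x. ennreal (if max M (real n) < u x then J (u x) (w x) + 2 else 0) \<partial>\<mu>) < ennreal e" "m \<le> real n"
    unfolding eventually_sequentially by blast
  \<comment> \<open>The infimum need not be attained, which costs one unit; the \<open>+ 1\<close>
    in the claim costs another. Hence the \<open>+ 2\<close> in the tail integral.\<close>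
  define S where "S = {J t \<xi> | t \<xi>. max M (real n) \<le> t}"
  have bdd: "bdd_below S" using nn by (auto simp: S_def intro!: bdd_belowI[of _ 0])
  have "J (max M (real n)) undefined \<in> S" unfolding S_def by blast
  then have "S \<noteq> {}" by blast
  then have "\<exists>s\<in>S. s < Inf S + 1" using cInf_lessD[of S "Inf S + 1"] by auto
  then obtain t \<xi> where t: "max M (real n) \<le> t" "J t \<xi> < Inf S + 1" by (auto simp: S_def)
  have low: "J t \<xi> \<le> J s \<eta> + 1" if "max M (real n) \<le> s" for s \<eta>
  proof -
    have "J s \<eta> \<in> S" using that by (auto simp: S_def)
    then have "Inf S \<le> J s \<eta>" using bdd by (rule cInf_lower)
    then show ?thesis using t(2) by simp
  qed
  have "ennreal (J t \<xi> + 1) * emeasure \<mu> {x \<in> \<Omega>. t < u x} = (\<integral>\<^sup>+x. ennreal (J t \<xi> + 1) * indicator {x \<in> \<Omega>. t < u x} x \<partial>\<mu>)"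
  proof -
    have "{x \<in> space \<mu>. t < u x} \<in> sets \<mu>" by measurable
    then show ?thesis by (subst nn_integral_cmult_indicator) auto
  qed
  also have "\<dots> \<le> (\<integral>\<^sup>+x. ennreal (if max M (real n) < u x then J (u x) (w x) + 2 else 0) \<partial>\<mu>)"
  proof (rule nn_integral_mono)
    fix x
    show "ennreal (J t \<xi> + 1) * indicator {x \<in> \<Omega>. t < u x} x \<le> ennreal (if max M (real n) < u x then J (u x) (w x) + 2 else 0)"
    proof (cases "t < u x")
      case True
      then have "max M (real n) < u x" using t(1) by linarith
      moreover have "J t \<xi> + 1 \<le> J (u x) (w x) + 2" using low[of "u x" "w x"] t(1) True by auto
      ultimately show ?thesis by (auto simp: indicator_def intro!: ennreal_leI)
    qed auto
  qed
  also have "\<dots> < ennreal e" by (rule n)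
  finally show ?thesis using t(1) n(2) by (intro exI[of _ t] conjI exI[of _ \<xi>]) auto
qed

text \<open>Under (A) only the level is optimised and \<open>\<xi> = 0\<close>, so the cost is
  \<open>2 * H t 0\<close>. Under (B) level and slope are optimised together for
  \<open>H t \<xi> + norm \<xi> powr p\<close>, and the opposite slope is paid for by the factor
  \<open>C + 1\<close>.\<close>

lemma exists_cheap_oscillation:
  fixes H :: "real \<Rightarrow> 'a \<Rightarrow> real"
  assumes u: "approx p \<Omega> (C1_le M) u g"
    and H: "continuous_on UNIV (\<lambda>(t, \<xi>). H t \<xi>)" and nn: "\<And>t \<xi>. 0 \<le> H t \<xi>"
    and AB: "(\<forall>t. \<exists>\<zeta>. \<forall>\<xi>. H t \<xi> \<ge> H t 0 + \<zeta> \<bullet> \<xi>) \<or> (\<exists>C\<ge>1. \<forall>t \<xi>. H t (- \<xi>) \<le> C * (H t \<xi> + 1))"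
    and i: "integrable \<mu> (\<lambda>x. H (u x) (g x))" and e: "0 < e"
  shows "\<exists>t\<ge>m. \<exists>\<xi>. ennreal (H t \<xi> + H t (- \<xi>) + norm \<xi> powr p + 1) * emeasure \<mu> {x \<in> \<Omega>. t < u x} < ennreal e"
proof -
  have m[measurable]: "u \<in> borel_measurable \<mu>" "g \<in> borel_measurable \<mu>" using u by (auto simp: approx_def)
  have mi[measurable]: "(\<lambda>x. H (u x) (g x)) \<in> borel_measurable \<mu>" using i by auto
  from AB show ?thesis
  proof
    assume A: "\<forall>t. \<exists>\<zeta>. \<forall>\<xi>. H t \<xi> \<ge> H t 0 + \<zeta> \<bullet> \<xi>"
    have m0[measurable]: "(\<lambda>x. H (u x) 0) \<in> borel_measurable \<mu>"
      by (rule measurable_integrand[OF H]) measurable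
    have "(\<integral>\<^sup>+x. ennreal (if M < u x then 2 * H (u x) 0 else 0) \<partial>\<mu>)
      = (\<integral>\<^sup>+x. ennreal 2 * ennreal (if M < u x then H (u x) 0 else 0) \<partial>\<mu>)"
      using nn by (intro nn_integral_cong) (auto simp: ennreal_mult)
    also have "\<dots> = ennreal 2 * (\<integral>\<^sup>+x. ennreal (if M < u x then H (u x) 0 else 0) \<partial>\<mu>)"
      by (rule nn_integral_cmult) measurable
    also have "\<dots> < \<infinity>"
      using nn_integral_subgradient_bound[OF u H nn _ i] A by (simp add: ennreal_mult_less_top)
    finally have fin: "(\<integral>\<^sup>+x. ennreal (if M < u x then 2 * H (u x) 0 else 0) \<partial>\<mu>) < \<infinity>" .
    \<comment> \<open>The second argument is a dummy of type \<open>unit\<close>, so the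
      minimisation runs over levels alone.\<close>
    have "\<exists>t\<ge>m. \<exists>\<xi>::unit. ennreal (2 * H t 0 + 1) * emeasure \<mu> {x \<in> \<Omega>. t < u x} < ennreal e"
      by (rule exists_cheap_level[where J="\<lambda>t _. 2 * H t 0" and w="\<lambda>_. ()" and M=M]) (use nn fin e in auto)
    then obtain t where t: "t \<ge> m" "ennreal (2 * H t 0 + 1) * emeasure \<mu> {x \<in> \<Omega>. t < u x} < ennreal e" by blast
    then show ?thesis by (intro exI[of _ t] conjI exI[of _ 0]) auto
  next
    assume "\<exists>C\<ge>1. \<forall>t \<xi>. H t (- \<xi>) \<le> C * (H t \<xi> + 1)"
    then obtain C where C: "C \<ge> 1" "\<And>t \<xi>. H t (- \<xi>) \<le> C * (H t \<xi> + 1)" by blast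
    define J where "J t \<xi> = H t \<xi> + norm \<xi> powr p" for t \<xi>
    have Jn: "0 \<le> J t \<xi>" for t \<xi> using nn by (simp add: J_def)
    have gL: "integrable \<mu> (\<lambda>x. norm (g x) powr p)"
      using approx_Lp_space(2)[OF u C1_le_subset] by (simp add: Lp_space_def)
    have Jm[measurable]: "(\<lambda>x. J (u x) (g x)) \<in> borel_measurable \<mu>" unfolding J_def by measurable
    have "integrable \<mu> (\<lambda>x. J (u x) (g x))" unfolding J_def using i gL by auto
    then have "(\<integral>\<^sup>+x. ennreal (J (u x) (g x)) \<partial>\<mu>) < \<infinity>" using Jn by (simp add: integrable_iff_bounded)
    moreover have "(\<integral>\<^sup>+x. ennreal (if M < u x then J (u x) (g x) else 0) \<partial>\<mu>) \<le> (\<integral>\<^sup>+x. ennreal (J (u x) (g x)) \<partial>\<mu>)"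
      by (intro nn_integral_mono) auto
    ultimately have fin: "(\<integral>\<^sup>+x. ennreal (if M < u x then J (u x) (g x) else 0) \<partial>\<mu>) < \<infinity>"
      by (rule order.strict_trans1[rotated])
    have "\<exists>t\<ge>m. \<exists>\<xi>. ennreal (J t \<xi> + 1) * emeasure \<mu> {x \<in> \<Omega>. t < u x} < ennreal (e / (C + 1))"
      by (rule exists_cheap_level[where w=g and M=M]) (use Jn fin e C in auto)
    then obtain t \<xi> where t: "t \<ge> m" "ennreal (J t \<xi> + 1) * emeasure \<mu> {x \<in> \<Omega>. t < u x} < ennreal (e / (C + 1))" by blast
    have "H t \<xi> + H t (- \<xi>) + norm \<xi> powr p + 1 \<le> (C + 1) * (J t \<xi> + 1)"
    proof -
      have "C * (H t \<xi> + 1) \<le> C * (J t \<xi> + 1)" using C(1) by (intro mult_left_mono) (auto simp: J_def)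
      then show ?thesis using C(2)[of t \<xi>] by (simp add: J_def algebra_simps)
    qed
    then have "ennreal (H t \<xi> + H t (- \<xi>) + norm \<xi> powr p + 1) * emeasure \<mu> {x \<in> \<Omega>. t < u x}
       \<le> ennreal ((C + 1) * (J t \<xi> + 1)) * emeasure \<mu> {x \<in> \<Omega>. t < u x}"
      by (intro mult_right_mono ennreal_leI) auto
    also have "\<dots> = ennreal (C + 1) * (ennreal (J t \<xi> + 1) * emeasure \<mu> {x \<in> \<Omega>. t < u x})"
      using C(1) Jn by (simp add: ennreal_mult mult.assoc)
    also have "\<dots> < ennreal (C + 1) * ennreal (e / (C + 1))"
    proof (rule ennreal_mult_strict_left_mono[OF t(2)])
      show "0 < ennreal (C + 1)" using C(1) by (simp only: ennreal_less_zero_iff)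
    qed simp
    also have "\<dots> = ennreal ((C + 1) * (e / (C + 1)))" using C(1) e by (intro ennreal_mult[symmetric]) auto
    also have "(C + 1) * (e / (C + 1)) = e" using C(1) by simp
    finally show ?thesis using t(1) by blast
  qed
qed


section \<open>Truncation\<close>

lemma wave_grad_norm: "norm (wave_grad a \<xi> x) \<le> norm \<xi>"
  by (auto simp: wave_grad_def sgn_if)

text \<open>Adding a compactly supported function changes \<open>\<phi>\<close> only on a compact
  part of the domain, so the upper bound of \<open>\<phi>\<close> becomes a bound for the boundary
  values of \<open>u\<close>.\<close>

lemma approx_add_C1_compact:
  assumes "approx p \<Omega> {f \<in> C1. \<forall>x. f x \<le> M} \<phi> g\<phi>"
    and "approx p \<Omega> (C1_compact \<Omega>) (\<lambda>x. u x - \<phi> x) (\<lambda>x. g x - g\<phi> x)"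
  shows "approx p \<Omega> (C1_le M) u g"
proof -
  have "approx p \<Omega> (C1_le M) (\<lambda>x. \<phi> x + 1 * (u x - \<phi> x)) (\<lambda>x. g\<phi> x + 1 *\<^sub>R (g x - g\<phi> x))"
  proof (rule approx_comb[OF assms _ C1_compact_subset])
    fix f h :: "'a \<Rightarrow> real" assume f: "f \<in> {f \<in> C1. \<forall>x. f x \<le> M}" and h: "h \<in> C1_compact \<Omega>"
    obtain K where K: "h \<in> C1" "compact K" "K \<subseteq> \<Omega>" "\<And>x. x \<notin> K \<Longrightarrow> h x = 0" using h by (auto simp: C1_compact_iff)
    then show "(\<lambda>x. f x + 1 * h x) \<in> C1_le M"
      using f by (auto simp: C1_le_def intro!: C1_add)
  qed auto
  then show ?thesis by simp
qed

text \<open>Everything an approximation \<open>v\<close> of \<open>u\<close> has to provide,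
  unchanged boundary data included, so that truncations from above and from below can be composed.
  \<open>w\<close> and \<open>g\<close> are the gradient witnesses of \<open>v\<close> and
  \<open>u\<close>.\<close>

definition energy_close ::
    "(real \<Rightarrow> 'a \<Rightarrow> real) \<Rightarrow> ('a \<Rightarrow> real) \<Rightarrow> ('a \<Rightarrow> 'a) \<Rightarrow> ('a \<Rightarrow> real) \<Rightarrow> ('a \<Rightarrow> 'a) \<Rightarrow> real
      \<Rightarrow> ('a \<Rightarrow> real) \<Rightarrow> ('a \<Rightarrow> 'a) \<Rightarrow> bool" where
  "energy_close H \<phi> g\<phi> u g e v w \<longleftrightarrow>
     approx p \<Omega> (C1_compact \<Omega>) (\<lambda>x. v x - \<phi> x) (\<lambda>x. w x - g\<phi> x) \<and>
     integrable \<mu> (\<lambda>x. H (v x) (w x)) \<and> D v u < ennreal e \<and> D w g < ennreal e \<and>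
     (\<integral>\<^sup>+x. ennreal \<bar>H (v x) (w x) - H (u x) (g x)\<bar> \<partial>\<mu>) < ennreal e"

text \<open>One majorant \<open>b\<close> with integral below \<open>e\<close> dominates the errors
  of the function, of the gradient and of the energy density. The last conclusion,
  \<open>min (u x) 0 \<le> v x\<close>, turns in the mirror image into the statement that an upper
  bound is preserved.\<close>

lemma truncate_above:
  fixes H :: "real \<Rightarrow> 'a \<Rightarrow> real"
  assumes \<phi>: "approx p \<Omega> {f \<in> C1. \<forall>x. f x \<le> M} \<phi> g\<phi>"
    and u: "approx p \<Omega> (C1_compact \<Omega>) (\<lambda>x. u x - \<phi> x) (\<lambda>x. g x - g\<phi> x)"
    and H: "continuous_on UNIV (\<lambda>(t, \<xi>). H t \<xi>)" and nn: "\<And>t \<xi>. 0 \<le> H t \<xi>"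
    and AB: "(\<forall>t. \<exists>\<zeta>. \<forall>\<xi>. H t \<xi> \<ge> H t 0 + \<zeta> \<bullet> \<xi>) \<or> (\<exists>C\<ge>1. \<forall>t \<xi>. H t (- \<xi>) \<le> C * (H t \<xi> + 1))"
    and i: "integrable \<mu> (\<lambda>x. H (u x) (g x))" and e: "0 < e"
  shows "\<exists>v w. energy_close H \<phi> g\<phi> u g e v w \<and>
    (\<exists>T. \<forall>x. v x \<le> T) \<and> (\<forall>x. min (u x) 0 \<le> v x)"
proof -
  have uM: "approx p \<Omega> (C1_le M) u g" by (rule approx_add_C1_compact[OF \<phi> u])
  have m[measurable]: "u \<in> borel_measurable \<mu>" "g \<in> borel_measurable \<mu>" using uM by (auto simp: approx_def)
  have mi[measurable]: "(\<lambda>x. H (u x) (g x)) \<in> borel_measurable \<mu>" using i by auto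
  note L = approx_Lp_space[OF uM C1_le_subset]
  define e1 where "e1 = e / (2 * 2 powr p)"
  have e1: "e1 > 0" using e by (simp add: e1_def)
  \<comment> \<open>Everything that must have a small tail at high levels of \<open>u\<close>:
    function, gradient and energy density.\<close>
  define y where "y x = \<bar>u x\<bar> powr p + norm (g x) powr p + H (u x) (g x)" for x
  have y0: "0 \<le> y x" for x using nn by (simp add: y_def)
  have ym[measurable]: "y \<in> borel_measurable \<mu>" unfolding y_def by measurable
  have "integrable \<mu> y" unfolding y_def using L i by (auto simp: Lp_space_def)
  then have "(\<integral>\<^sup>+x. ennreal (y x) \<partial>\<mu>) < \<infinity>" using y0 by (simp add: integrable_iff_bounded)
  moreover have "(\<integral>\<^sup>+x. ennreal (if 0 < u x then y x else 0) \<partial>\<mu>) \<le> (\<integral>\<^sup>+x. ennreal (y x) \<partial>\<mu>)"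
    by (intro nn_integral_mono) auto
  ultimately have "(\<integral>\<^sup>+x. ennreal (if 0 < u x then y x else 0) \<partial>\<mu>) < \<infinity>"
    by (rule order.strict_trans1[rotated])
  then have "(\<lambda>n::nat. \<integral>\<^sup>+x. ennreal (if max 0 (real n) < u x then y x else 0) \<partial>\<mu>) \<longlonglongrightarrow> 0"
    by (intro superlevel_integral_tendsto_zero) auto
  then have "eventually (\<lambda>n::nat. (\<integral>\<^sup>+x. ennreal (if max 0 (real n) < u x then y x else 0) \<partial>\<mu>) < ennreal e1) sequentially"
    using e1 by (intro order_tendstoD) auto
  then obtain n :: nat where "(\<integral>\<^sup>+x. ennreal (if max 0 (real n) < u x then y x else 0) \<partial>\<mu>) < ennreal e1"
    unfolding eventually_sequentially by blast
  then have Y: "(\<integral>\<^sup>+x. ennreal (if real n < u x then y x else 0) \<partial>\<mu>) < ennreal e1" by simp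
  obtain t \<xi> where t: "max M (real n) \<le> t"
    and X: "ennreal (H t \<xi> + H t (- \<xi>) + norm \<xi> powr p + 1) * emeasure \<mu> {x \<in> \<Omega>. t < u x} < ennreal e1"
    using exists_cheap_oscillation[OF uM H nn AB i e1] by blast
  have t0: "0 \<le> t" "M \<le> t" "real n \<le> t" using t by auto
  \<comment> \<open>The final \<open>+ 1\<close> absorbs the variation of \<open>H\<close> between
    the level \<open>t\<close> and the levels \<open>t + wave a \<xi> x\<close>.\<close>
  define K where "K = H t \<xi> + H t (- \<xi>) + norm \<xi> powr p + 1"
  have K: "norm \<xi> powr p \<le> K" "0 \<le> K" using nn[of t \<xi>] nn[of t "- \<xi>"] by (simp_all add: K_def)
  have "\<exists>d>0. \<forall>s. \<bar>s - t\<bar> < d \<longrightarrow> H s \<eta> \<le> H t \<eta> + 1" for \<eta>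
  proof -
    have "continuous_on UNIV (\<lambda>s. H s \<eta>)" by (intro continuous_integrand[OF H] continuous_intros)
    then obtain d where "d > 0" "\<forall>s. dist s t < d \<longrightarrow> dist (H s \<eta>) (H t \<eta>) < 1"
      unfolding continuous_on_iff by (metis UNIV_I zero_less_one)
    then show ?thesis by (force simp: dist_real_def)
  qed
  then obtain d1 d2 where d: "d1 > 0" "\<And>s. \<bar>s - t\<bar> < d1 \<Longrightarrow> H s \<xi> \<le> H t \<xi> + 1"
    "d2 > 0" "\<And>s. \<bar>s - t\<bar> < d2 \<Longrightarrow> H s (- \<xi>) \<le> H t (- \<xi>) + 1"
    by meson
  \<comment> \<open>The amplitude is fixed after level and slope: the wave then stays within both
    continuity radii, found at the single level \<open>t\<close> for the slopes \<open>\<xi>\<close>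
    and \<open>- \<xi>\<close>.\<close>
  define a where "a = min d1 d2 / (2 * pi)"
  have a: "a > 0" "a * pi < d1" "a * pi < d2" using d(1,3) by (auto simp: a_def)
  define v where "v x = min (u x) (t + wave a \<xi> x)" for x
  define w where "w x = (if t + wave a \<xi> x < u x then wave_grad a \<xi> x else g x)" for x
  note z = wave_bounds[OF a(1), of \<xi>]
  have tr: "approx p \<Omega> (C1_compact \<Omega>) (\<lambda>x. u x - v x) (\<lambda>x. g x - w x)"
    unfolding v_def w_def by (rule approx_truncate[OF uM t0(2) a(1)])
  have "approx p \<Omega> (C1_compact \<Omega>) (\<lambda>x. (u x - \<phi> x) + (-1) * (u x - v x)) (\<lambda>x. (g x - g\<phi> x) + (-1) *\<^sub>R (g x - w x))"
    by (rule approx_comb[OF u tr C1_compact_subset C1_compact_subset]) (simp add: C1_compact_diff)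
  then have v\<phi>: "approx p \<Omega> (C1_compact \<Omega>) (\<lambda>x. v x - \<phi> x) (\<lambda>x. w x - g\<phi> x)" by simp
  have vM: "approx p \<Omega> (C1_le M) v w" by (rule approx_add_C1_compact[OF \<phi> v\<phi>])
  have vm[measurable]: "v \<in> borel_measurable \<mu>" "w \<in> borel_measurable \<mu>" using vM by (auto simp: approx_def)
  have Hvw[measurable]: "(\<lambda>x. H (v x) (w x)) \<in> borel_measurable \<mu>" by (rule measurable_integrand[OF H vm])
  \<comment> \<open>Where \<open>t < u x\<close>, \<open>K\<close> bounds what the cap contributes
    and \<open>y\<close> what it replaces; the factor \<open>2 powr p\<close> comes from the
    difference of two gradients.\<close>
  define b where "b x = 2 powr p * ((if t < u x then K else 0) + (if real n < u x then y x else 0))" for x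
  have b1: "(if t < u x then K else 0) + (if real n < u x then y x else 0) \<le> b x" "0 \<le> b x" for x
  proof -
    have "0 \<le> (if t < u x then K else 0) + (if real n < u x then y x else 0)" using K y0 by simp
    moreover have "1 \<le> 2 powr p" using p by (simp add: ge_one_powr_ge_zero)
    ultimately show "(if t < u x then K else 0) + (if real n < u x then y x else 0) \<le> b x" "0 \<le> b x"
      unfolding b_def by (simp_all add: mult_le_cancel_right1)
  qed
  have "(\<integral>\<^sup>+x. ennreal (b x) \<partial>\<mu>)
     = (\<integral>\<^sup>+x. ennreal (2 powr p) * (ennreal K * indicator {x \<in> \<Omega>. t < u x} x + ennreal (if real n < u x then y x else 0)) \<partial>\<mu>)"
    using K y0 by (intro nn_integral_cong) (auto simp: b_def ennreal_mult indicator_def)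
  also have "\<dots> = ennreal (2 powr p) * (ennreal K * emeasure \<mu> {x \<in> \<Omega>. t < u x} + (\<integral>\<^sup>+x. ennreal (if real n < u x then y x else 0) \<partial>\<mu>))"
  proof -
    have "{x \<in> space \<mu>. t < u x} \<in> sets \<mu>" by measurable
    then have [measurable]: "{x \<in> \<Omega>. t < u x} \<in> sets \<mu>" by simp
    show ?thesis by (subst nn_integral_cmult, measurable) (subst nn_integral_add, auto simp: nn_integral_cmult_indicator)
  qed
  also have "\<dots> < ennreal (2 powr p) * (ennreal e1 + ennreal e1)"
    using X Y by (intro ennreal_mult_strict_left_mono add_strict_mono) (auto simp: K_def)
  also have "\<dots> = ennreal e" using e by (simp add: e1_def flip: ennreal_plus ennreal_mult)
  finally have bI: "(\<integral>\<^sup>+x. ennreal (b x) \<partial>\<mu>) < ennreal e" .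
  have p1: "norm (v x - u x) powr p \<le> b x" for x
  proof (cases "t + wave a \<xi> x < u x")
    case True
    then have "norm (v x - u x) \<le> \<bar>u x\<bar>" using z[of x] t0(1) by (auto simp: v_def)
    then have "norm (v x - u x) powr p \<le> \<bar>u x\<bar> powr p" using p by (intro powr_mono2) auto
    also have "\<dots> \<le> y x" using nn by (simp add: y_def)
    also have "\<dots> \<le> b x" using b1(1)[of x] True z[of x] t0 K by auto
    finally show ?thesis .
  qed (use b1 in \<open>auto simp: v_def\<close>)
  have p2: "norm (w x - g x) powr p \<le> b x" for x
  proof (cases "t + wave a \<xi> x < u x")
    case True
    then have w: "norm (w x) \<le> norm \<xi>" using wave_grad_norm by (simp add: w_def)
    have "norm (w x - g x) powr p \<le> (norm \<xi> + norm (g x)) powr p"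
      using norm_triangle_ineq4[of "w x" "g x"] w p by (intro powr_mono2) auto
    also have "\<dots> \<le> 2 powr p * (norm \<xi> powr p + norm (g x) powr p)"
      using p by (intro powr_add_le) auto
    also have "\<dots> \<le> 2 powr p * (K + y x)"
      using K nn by (intro mult_left_mono add_mono) (auto simp: y_def)
    also have "\<dots> = b x" using True z[of x] t0 by (auto simp: b_def)
    finally show ?thesis .
  qed (use b1 in \<open>auto simp: w_def\<close>)
  \<comment> \<open>Only almost everywhere: at the kinks \<open>wave_grad\<close> is
    \<open>0\<close>, and in general nothing bounds \<open>H\<close> at slope \<open>0\<close> by
    \<open>K\<close>.\<close>
  have p3: "AE x in \<mu>. \<bar>H (v x) (w x) - H (u x) (g x)\<bar> \<le> b x"
    using AE_wave_grad[OF a(1), of \<xi>]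
  proof eventually_elim
    case (elim x)
    show ?case
    proof (cases "t + wave a \<xi> x < u x")
      case True
      then have v: "v x = t + wave a \<xi> x" "w x = wave_grad a \<xi> x" by (auto simp: v_def w_def)
      have "\<bar>v x - t\<bar> < d1" "\<bar>v x - t\<bar> < d2" using z[of x] a v by auto
      then have "H (v x) \<xi> \<le> K \<and> H (v x) (- \<xi>) \<le> K"
        using d(2)[of "v x"] d(4)[of "v x"] nn[of t \<xi>] nn[of t "- \<xi>"] powr_ge_zero[of "norm \<xi>" p] unfolding K_def by linarith
      then have "H (v x) (w x) \<le> K" using elim v by auto
      moreover have "H (u x) (g x) \<le> y x" by (simp add: y_def)
      ultimately have "\<bar>H (v x) (w x) - H (u x) (g x)\<bar> \<le> K + y x" using nn[of "v x" "w x"] nn[of "u x" "g x"] by linarith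
      also have "\<dots> \<le> b x" using b1(1)[of x] True z[of x] t0 by auto
      finally show ?thesis .
    qed (use b1 in \<open>auto simp: v_def w_def\<close>)
  qed
  have D: "D v u < ennreal e" "D w g < ennreal e"
    using p1 p2 bI unfolding Lpd_def by (auto intro!: order.strict_trans1[OF nn_integral_mono bI] ennreal_leI)
  have I: "(\<integral>\<^sup>+x. ennreal \<bar>H (v x) (w x) - H (u x) (g x)\<bar> \<partial>\<mu>) < ennreal e"
    using p3 by (intro order.strict_trans1[OF nn_integral_mono_AE bI]) (auto elim!: eventually_mono intro: ennreal_leI)
  have "integrable \<mu> (\<lambda>x. H (v x) (w x) - H (u x) (g x))"
    using I by (intro integrableI_bounded) (auto elim: order.strict_trans)
  then have "integrable \<mu> (\<lambda>x. (H (v x) (w x) - H (u x) (g x)) + H (u x) (g x))"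
    using i by (rule Bochner_Integration.integrable_add)
  then have iv: "integrable \<mu> (\<lambda>x. H (v x) (w x))" by simp
  have "v x \<le> t + a * pi" "min (u x) 0 \<le> v x" for x
    using z[of x] t0(1) by (auto simp: v_def)
  then show ?thesis using v\<phi> iv D I unfolding energy_close_def by blast
qed

lemma approx_uminus:
  assumes "approx p \<Omega> (C1_compact \<Omega>) f g"
  shows "approx p \<Omega> (C1_compact \<Omega>) (\<lambda>x. - f x) (\<lambda>x. - g x)"
proof -
  have z: "(\<lambda>_. 0) \<in> C1_compact \<Omega>"
    by (auto simp: C1_compact_iff intro!: C1_const exI[of _ "{}"])
  have "approx p \<Omega> (C1_compact \<Omega>) (\<lambda>x. 0 + (-1) * f x) (\<lambda>x. grad (\<lambda>_. 0) x + (-1) *\<^sub>R g x)"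
    by (rule approx_comb[OF approx_self[OF z] assms C1_compact_subset C1_compact_subset])
      (auto intro: C1_compact_subset[THEN subsetD] dest: C1_compact_diff[OF z] simp: C1_compact_diff)
  then show ?thesis by (simp add: grad_const)
qed

text \<open>The upper bound is now asked of \<open>- \<phi>\<close>. Both alternatives survive the
  reflection: (A) with \<open>- \<zeta>\<close> in place of \<open>\<zeta>\<close>, (B) with the
  same constant.\<close>

lemma truncate_below:
  fixes H :: "real \<Rightarrow> 'a \<Rightarrow> real"
  assumes \<phi>: "approx p \<Omega> {f \<in> C1. \<forall>x. f x \<le> M} (\<lambda>x. - \<phi> x) (\<lambda>x. - g\<phi> x)"
    and u: "approx p \<Omega> (C1_compact \<Omega>) (\<lambda>x. u x - \<phi> x) (\<lambda>x. g x - g\<phi> x)"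
    and H: "continuous_on UNIV (\<lambda>(t, \<xi>). H t \<xi>)" and nn: "\<And>t \<xi>. 0 \<le> H t \<xi>"
    and AB: "(\<forall>t. \<exists>\<zeta>. \<forall>\<xi>. H t \<xi> \<ge> H t 0 + \<zeta> \<bullet> \<xi>) \<or> (\<exists>C\<ge>1. \<forall>t \<xi>. H t (- \<xi>) \<le> C * (H t \<xi> + 1))"
    and i: "integrable \<mu> (\<lambda>x. H (u x) (g x))" and e: "0 < e"
  shows "\<exists>v w. energy_close H \<phi> g\<phi> u g e v w \<and>
    (\<exists>T. \<forall>x. T \<le> v x) \<and> (\<forall>x. v x \<le> max (u x) 0)"
proof -
  have u': "approx p \<Omega> (C1_compact \<Omega>) (\<lambda>x. - u x - (- \<phi> x)) (\<lambda>x. - g x - (- g\<phi> x))"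
    using approx_uminus[OF u] by simp
  have "continuous_on UNIV (\<lambda>x :: real \<times> 'a. H (- fst x) (- snd x))"
    by (intro continuous_integrand[OF H] continuous_intros)
  then have H': "continuous_on UNIV (\<lambda>(t, \<xi>). H (- t) (- \<xi>))" by (simp add: case_prod_beta')
  have AB': "(\<forall>t. \<exists>\<zeta>. \<forall>\<xi>. H (- t) (- \<xi>) \<ge> H (- t) (- 0) + \<zeta> \<bullet> \<xi>) \<or>
     (\<exists>C\<ge>1. \<forall>t \<xi>. H (- t) (- (- \<xi>)) \<le> C * (H (- t) (- \<xi>) + 1))"
    using AB
  proof
    assume A: "\<forall>t. \<exists>\<zeta>. \<forall>\<xi>. H t \<xi> \<ge> H t 0 + \<zeta> \<bullet> \<xi>"
    have "\<exists>\<zeta>. \<forall>\<xi>. H (- t) (- \<xi>) \<ge> H (- t) (- 0) + \<zeta> \<bullet> \<xi>" for t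
    proof -
      obtain \<zeta> where \<zeta>: "\<forall>\<xi>. H (- t) \<xi> \<ge> H (- t) 0 + \<zeta> \<bullet> \<xi>" using A by blast
      have "H (- t) (- \<xi>) \<ge> H (- t) (- 0) + (- \<zeta>) \<bullet> \<xi>" for \<xi>
        using \<zeta>[rule_format, of "- \<xi>"] by simp
      then show ?thesis by blast
    qed
    then show ?thesis by blast
  next
    assume "\<exists>C\<ge>1. \<forall>t \<xi>. H t (- \<xi>) \<le> C * (H t \<xi> + 1)"
    then show ?thesis by blast
  qed
  obtain v w where vw: "approx p \<Omega> (C1_compact \<Omega>) (\<lambda>x. v x - (- \<phi> x)) (\<lambda>x. w x - (- g\<phi> x))"
    "integrable \<mu> (\<lambda>x. H (- v x) (- w x))" "D v (\<lambda>x. - u x) < ennreal e" "D w (\<lambda>x. - g x) < ennreal e"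
    "(\<integral>\<^sup>+x. ennreal \<bar>H (- v x) (- w x) - H (- (- u x)) (- (- g x))\<bar> \<partial>\<mu>) < ennreal e"
    "\<exists>T. \<forall>x. v x \<le> T" "\<forall>x. min (- u x) 0 \<le> v x"
    using truncate_above[where H="\<lambda>t \<xi>. H (- t) (- \<xi>)", OF \<phi> u' H' nn AB' _ e] i by (auto simp: energy_close_def)
  have 1: "approx p \<Omega> (C1_compact \<Omega>) (\<lambda>x. - v x - \<phi> x) (\<lambda>x. - w x - g\<phi> x)"
    using approx_uminus[OF vw(1)] by simp
  have neg: "D (\<lambda>x. - a x) b = D a (\<lambda>x. - b x)" for a b :: "'a \<Rightarrow> 'b::euclidean_space"
  proof -
    have "norm (- a x - b x) = norm (a x - (- b x))" for x
      by (metis minus_diff_eq diff_minus_eq_add minus_add_distrib norm_minus_cancel uminus_add_conv_diff add.commute)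
    then show ?thesis by (simp only: Lpd_def)
  qed
  have "\<exists>T. \<forall>x. T \<le> - v x" using vw(6) by (metis neg_le_iff_le)
  moreover have "- v x \<le> max (u x) 0" for x using vw(7)[rule_format, of x] by (auto simp: min_def max_def split: if_splits)
  ultimately show ?thesis
    using 1 vw(2-5) by (intro exI[of _ "\<lambda>x. - v x"] exI[of _ "\<lambda>x. - w x"]) (simp add: energy_close_def neg)
qed

text \<open>Cutting from below is applied to the result of cutting from above; since
  \<open>v' x \<le> max (v x) 0\<close>, the upper bound already gained is not lost.\<close>

lemma bounded_approximation:
  fixes H :: "real \<Rightarrow> 'a \<Rightarrow> real"
  assumes \<phi>: "approx p \<Omega> {f \<in> C1. \<forall>x. f x \<le> M} \<phi> g\<phi>"
    and \<phi>': "approx p \<Omega> {f \<in> C1. \<forall>x. f x \<le> M} (\<lambda>x. - \<phi> x) (\<lambda>x. - g\<phi> x)"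
    and u: "approx p \<Omega> (C1_compact \<Omega>) (\<lambda>x. u x - \<phi> x) (\<lambda>x. g x - g\<phi> x)"
    and H: "continuous_on UNIV (\<lambda>(t, \<xi>). H t \<xi>)" and nn: "\<And>t \<xi>. 0 \<le> H t \<xi>"
    and AB: "(\<forall>t. \<exists>\<zeta>. \<forall>\<xi>. H t \<xi> \<ge> H t 0 + \<zeta> \<bullet> \<xi>) \<or> (\<exists>C\<ge>1. \<forall>t \<xi>. H t (- \<xi>) \<le> C * (H t \<xi> + 1))"
    and i: "integrable \<mu> (\<lambda>x. H (u x) (g x))" and e: "0 < e"
  shows "\<exists>v w. energy_close H \<phi> g\<phi> u g e v w \<and> (\<exists>T. \<forall>x. \<bar>v x\<bar> \<le> T)"
proof -
  \<comment> \<open>Energy errors simply add, so \<open>e / 2\<close> serves for them; the distances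
    \<open>D\<close> pass through the triangle inequality with its factor
    \<open>2 powr p\<close>.\<close>
  define e1 where "e1 = min (e / 2) (e / (2 * 2 powr p))"
  have e1: "e1 > 0" "e1 \<le> e / 2" "e1 \<le> e / (2 * 2 powr p)" using e by (auto simp: e1_def)
  obtain v w where v: "approx p \<Omega> (C1_compact \<Omega>) (\<lambda>x. v x - \<phi> x) (\<lambda>x. w x - g\<phi> x)"
    "integrable \<mu> (\<lambda>x. H (v x) (w x))" "D v u < ennreal e1" "D w g < ennreal e1"
    "(\<integral>\<^sup>+x. ennreal \<bar>H (v x) (w x) - H (u x) (g x)\<bar> \<partial>\<mu>) < ennreal e1" "\<exists>T. \<forall>x. v x \<le> T"
    using truncate_above[OF \<phi> u H nn AB i e1(1)] unfolding energy_close_def by blast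
  obtain v' w' where v': "approx p \<Omega> (C1_compact \<Omega>) (\<lambda>x. v' x - \<phi> x) (\<lambda>x. w' x - g\<phi> x)"
    "integrable \<mu> (\<lambda>x. H (v' x) (w' x))" "D v' v < ennreal e1" "D w' w < ennreal e1"
    "(\<integral>\<^sup>+x. ennreal \<bar>H (v' x) (w' x) - H (v x) (w x)\<bar> \<partial>\<mu>) < ennreal e1" "\<exists>T. \<forall>x. T \<le> v' x" "\<forall>x. v' x \<le> max (v x) 0"
    using truncate_below[OF \<phi>' v(1) H nn AB v(2) e1(1)] unfolding energy_close_def by blast
  have m: "u \<in> borel_measurable \<mu>" "g \<in> borel_measurable \<mu>" "v \<in> borel_measurable \<mu>" "w \<in> borel_measurable \<mu>"
    "v' \<in> borel_measurable \<mu>" "w' \<in> borel_measurable \<mu>"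
    using approx_add_C1_compact[OF \<phi> u] approx_add_C1_compact[OF \<phi> v(1)] approx_add_C1_compact[OF \<phi> v'(1)]
    by (auto simp: approx_def)
  have le: "x < ennreal (e / (2 * 2 powr p))" "x < ennreal (e / 2)" if "x < ennreal e1" for x
    using that e1 by (auto elim!: order.strict_trans2 intro: ennreal_leI)
  have D: "D v' u < ennreal e" "D w' g < ennreal e"
    using Lpd_less[OF m(5,3,1) le(1)[OF v'(3)] le(1)[OF v(3)]] Lpd_less[OF m(6,4,2) le(1)[OF v'(4)] le(1)[OF v(4)]] by auto
  have "(\<integral>\<^sup>+x. ennreal \<bar>H (v' x) (w' x) - H (u x) (g x)\<bar> \<partial>\<mu>)
    \<le> (\<integral>\<^sup>+x. ennreal \<bar>H (v' x) (w' x) - H (v x) (w x)\<bar> + ennreal \<bar>H (v x) (w x) - H (u x) (g x)\<bar> \<partial>\<mu>)"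
    by (intro nn_integral_mono) (simp flip: ennreal_plus)
  also have "\<dots> = (\<integral>\<^sup>+x. ennreal \<bar>H (v' x) (w' x) - H (v x) (w x)\<bar> \<partial>\<mu>) + (\<integral>\<^sup>+x. ennreal \<bar>H (v x) (w x) - H (u x) (g x)\<bar> \<partial>\<mu>)"
    using v(2) v'(2) i by (intro nn_integral_add) auto
  also have "\<dots> < ennreal (e / 2) + ennreal (e / 2)"
    using le(2)[OF v(5)] le(2)[OF v'(5)] by (rule add_strict_mono[rotated])
  also have "\<dots> = ennreal e" using e by (simp flip: ennreal_plus)
  finally have I: "(\<integral>\<^sup>+x. ennreal \<bar>H (v' x) (w' x) - H (u x) (g x)\<bar> \<partial>\<mu>) < ennreal e" .
  obtain T1 where T1: "\<And>x. v x \<le> T1" using v(6) by blast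
  obtain T2 where T2: "\<And>x. T2 \<le> v' x" using v'(6) by blast
  have "\<bar>v' x\<bar> \<le> max \<bar>T1\<bar> \<bar>T2\<bar>" for x
    using T1[of x] T2[of x] v'(7)[rule_format, of x] by (auto simp: max_def abs_if split: if_splits)
  then show ?thesis using v'(1,2) D I unfolding energy_close_def by blast
qed

text \<open>Exchanges the gradient chosen in \<open>integrand\<close> for the explicit witness, so
  that the functional can be evaluated on approximable pairs.\<close>

lemma integrand_approx:
  assumes u: "approx p \<Omega> (C1_le M) u g"
    and H: "continuous_on UNIV (\<lambda>(t, \<xi>). H t \<xi>)" and L: "\<And>x t \<xi>. x \<in> \<Omega> \<Longrightarrow> L x t \<xi> = H t \<xi>"
  shows "integrand L \<Omega> u \<in> borel_measurable \<mu>" "AE x in \<mu>. integrand L \<Omega> u x = H (u x) (g x)"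
proof -
  have m: "u \<in> borel_measurable \<mu>" "g \<in> borel_measurable \<mu>" using u by (auto simp: approx_def)
  note w = weak_gradient_eq[OF approx_has_weak_gradient[OF u C1_le_subset] m(2)]
  show "integrand L \<Omega> u \<in> borel_measurable \<mu>"
    using measurable_integrand[OF H m(1) w(2)]
    by (rule measurable_cong[THEN iffD1, rotated]) (simp add: integrand_def L)
  have "AE x in \<mu>. x \<in> \<Omega>" using AE_space[of \<mu>] by simp
  then show "AE x in \<mu>. integrand L \<Omega> u x = H (u x) (g x)"
    using w(1) by eventually_elim (simp add: integrand_def L)
qed

end

theorem theorem1p4:
  fixes \<Omega> :: "(real ^ 'n) set"
    and p :: real
    and \<phi> :: "real ^ 'n \<Rightarrow> real"
    and H :: "real \<Rightarrow> real ^ 'n \<Rightarrow> real"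
    and L :: "real ^ 'n \<Rightarrow> real \<Rightarrow> real ^ 'n \<Rightarrow> real"
  assumes "open \<Omega>" and "bounded \<Omega>"
    and "1 \<le> p" and "p \<le> real CARD('n)"
    and "\<phi> \<in> W1p_space p UNIV \<inter> Linf_space UNIV"
    and "continuous_on UNIV (\<lambda>(t, \<xi>). H t \<xi>)"
    and "\<And>t \<xi>. 0 \<le> H t \<xi>"
    and "\<And>x t \<xi>. x \<in> \<Omega> \<Longrightarrow> L x t \<xi> = H t \<xi>"
    and "(\<forall>t. \<exists>\<zeta>. \<forall>\<xi>. H t \<xi> \<ge> H t 0 + \<zeta> \<bullet> \<xi>) \<or>
         (\<exists>C\<ge>1. \<forall>t \<xi>. H t (- \<xi>) \<le> C * (H t \<xi> + 1))"
  shows "\<forall>u\<in>admissible p \<Omega> \<phi> L. Linf_regular_at p \<Omega> \<phi> L u"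
proof
  fix u assume u: "u \<in> admissible p \<Omega> \<phi> L"
  interpret bounded_domain \<Omega> p by unfold_locales fact+
  note H = assms(6) and nn = assms(7) and L = assms(8) and AB = assms(9)
  obtain g\<phi> where \<phi>: "\<phi> \<in> Lp_space p UNIV" "g\<phi> \<in> Lp_space p UNIV" "has_weak_gradient UNIV \<phi> g\<phi>"
    using assms(5) by (auto simp: W1p_space_def)
  obtain M where M: "AE x in lebesgue. \<bar>\<phi> x\<bar> \<le> M"
    using assms(5) unfolding Linf_space_def lebesgue_on_UNIV_eq by auto
  have M1: "AE x in lebesgue. \<phi> x \<le> M" and M2: "AE x in lebesgue. - \<phi> x \<le> M"
    using M by (auto elim!: eventually_mono)
  have a1: "approx p \<Omega> {f \<in> C1. \<forall>x. f x \<le> M} \<phi> g\<phi>"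
    by (rule W1p_UNIV_approx[OF \<phi> M1])
  have a2: "approx p \<Omega> {f \<in> C1. \<forall>x. f x \<le> M} (\<lambda>x. - \<phi> x) (\<lambda>x. - g\<phi> x)"
  proof (rule W1p_UNIV_approx[OF _ _ _ M2])
    show "(\<lambda>x. - \<phi> x) \<in> Lp_space p UNIV" "(\<lambda>x. - g\<phi> x) \<in> Lp_space p UNIV"
      using \<phi>(1,2) by (auto simp: Lp_space_def)
    show "has_weak_gradient UNIV (\<lambda>x. - \<phi> x) (\<lambda>x. - g\<phi> x)"
      using \<phi>(3) by (auto simp: has_weak_gradient_def locally_integrable_def)
  qed
  obtain v0 where v0: "v0 \<in> W1p0_space p \<Omega>" "u = (\<lambda>x. \<phi> x + v0 x)" and iu: "integrable \<mu> (integrand L \<Omega> u)"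
    using u by (auto simp: admissible_def W1p_affine_space_def)
  obtain gv where gv: "approx p \<Omega> (C1_compact \<Omega>) v0 gv" using W1p0_space_approx[OF v0(1)] by blast
  define g where "g x = g\<phi> x + gv x" for x
  have ua: "approx p \<Omega> (C1_compact \<Omega>) (\<lambda>x. u x - \<phi> x) (\<lambda>x. g x - g\<phi> x)"
    using gv by (simp add: v0(2) g_def)
  have uM: "approx p \<Omega> (C1_le M) u g" by (rule approx_add_C1_compact[OF a1 ua])
  have um: "u \<in> borel_measurable \<mu>" "g \<in> borel_measurable \<mu>" using uM by (auto simp: approx_def)
  note Iu = integrand_approx[where L=L, OF uM H L]
  have iHu: "integrable \<mu> (\<lambda>x. H (u x) (g x))"
    using iu Iu measurable_integrand[OF H um] by (subst integrable_cong_AE[where g="integrand L \<Omega> u"]) (auto elim!: eventually_mono)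
  define e where "e k = 1 / real (Suc k)" for k
  have e: "e k > 0" for k by (simp add: e_def)
  \<comment> \<open>\<open>D\<close> is a p-th power, so the threshold
    \<open>(e k / 2) powr p\<close> makes each of the two summands of \<open>W1p_norm\<close>
    smaller than \<open>e k / 2\<close>; the threshold \<open>e k\<close> is for the
    energies.\<close>
  define P where "P k v w \<longleftrightarrow> energy_close H \<phi> g\<phi> u g (min ((e k / 2) powr p) (e k)) v w \<and> (\<exists>T. \<forall>x. \<bar>v x\<bar> \<le> T)" for k v w
  have "\<exists>v w. P k v w" for k
    unfolding P_def by (rule bounded_approximation[OF a1 a2 ua H nn AB iHu]) (use e[of k] in auto)
  then obtain v w where P: "\<And>k. P k (v k) (w k)" by metis
  have vw: "approx p \<Omega> (C1_compact \<Omega>) (\<lambda>x. v k x - \<phi> x) (\<lambda>x. w k x - g\<phi> x)"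
    "integrable \<mu> (\<lambda>x. H (v k x) (w k x))" "D (v k) u < ennreal (min ((e k / 2) powr p) (e k))"
    "D (w k) g < ennreal (min ((e k / 2) powr p) (e k))"
    "(\<integral>\<^sup>+x. ennreal \<bar>H (v k x) (w k x) - H (u x) (g x)\<bar> \<partial>\<mu>) < ennreal (min ((e k / 2) powr p) (e k))"
    "\<exists>T. \<forall>x. \<bar>v k x\<bar> \<le> T" for k
    using P[of k] unfolding P_def energy_close_def by blast+
  have vM: "approx p \<Omega> (C1_le M) (v k) (w k)" for k by (rule approx_add_C1_compact[OF a1 vw(1)])
  have vm: "v k \<in> borel_measurable \<mu>" "w k \<in> borel_measurable \<mu>" for k using vM[of k] by (auto simp: approx_def)
  note Iv = integrand_approx[where L=L, OF vM H L]
  have iv: "integrable \<mu> (integrand L \<Omega> (v k))" for k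
    using vw(2)[of k] Iv[of k] by (subst integrable_cong_AE[where g="\<lambda>x. H (v k x) (w k x)"]) auto
  have adm: "v k \<in> admissible p \<Omega> \<phi> L \<inter> Linf_space \<Omega>" for k
  proof -
    have "v k \<in> W1p_affine_space p \<Omega> \<phi>"
      unfolding W1p_affine_space_def
      using approx_W1p0_space[OF vw(1)[of k]] by (auto intro!: exI[of _ "\<lambda>x. v k x - \<phi> x"])
    moreover have "v k \<in> Linf_space \<Omega>"
      using vm(1)[of k] vw(6)[of k] by (auto simp: Linf_space_def)
    ultimately show ?thesis using iv by (simp add: admissible_def)
  qed
  have less: "x < ennreal ((e k / 2) powr p)" "x < ennreal (e k)" if "x < ennreal (min ((e k / 2) powr p) (e k))" for x k
    using that by (auto elim!: order.strict_trans2 intro: ennreal_leI)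
  have n1: "W1p_norm p \<Omega> (\<lambda>x. v k x - u x) < e k" for k
    by (rule W1p_norm_diff_less[OF approx_has_weak_gradient[OF vM C1_le_subset] approx_has_weak_gradient[OF uM C1_le_subset]
        approx_Lp_space[OF vM C1_le_subset] approx_Lp_space[OF uM C1_le_subset] e less(1)[OF vw(3)] less(1)[OF vw(4)]])
  have n2: "Lp_norm 1 \<Omega> (\<lambda>x. integrand L \<Omega> (v k) x - integrand L \<Omega> u x) < e k" for k
  proof -
    have "Lp_norm 1 \<Omega> (\<lambda>x. integrand L \<Omega> (v k) x - integrand L \<Omega> u x) = (\<integral>x. \<bar>integrand L \<Omega> (v k) x - integrand L \<Omega> u x\<bar> \<partial>\<mu>)"
      by (simp add: Lp_norm_def)
    also have "\<dots> = (\<integral>x. \<bar>H (v k x) (w k x) - H (u x) (g x)\<bar> \<partial>\<mu>)"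
      using Iv(2)[of k] Iu(2) iv[of k] iu vw(2)[of k] iHu
      by (intro integral_cong_AE) (auto elim: eventually_elim2)
    finally have "ennreal (Lp_norm 1 \<Omega> (\<lambda>x. integrand L \<Omega> (v k) x - integrand L \<Omega> u x)) = (\<integral>\<^sup>+x. ennreal \<bar>H (v k x) (w k x) - H (u x) (g x)\<bar> \<partial>\<mu>)"
      using vw(2)[of k] iHu by (subst nn_integral_eq_integral) auto
    then have "ennreal (Lp_norm 1 \<Omega> (\<lambda>x. integrand L \<Omega> (v k) x - integrand L \<Omega> u x)) < ennreal (e k)"
      using less(2)[OF vw(5)[of k]] by (simp only:)
    then show ?thesis by (simp only: ennreal_less_iff[OF Lp_norm_nonneg])
  qed
  have e0: "e \<longlonglongrightarrow> 0" unfolding e_def by (rule LIMSEQ_Suc[OF lim_1_over_n])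
  have squeeze: "X \<longlonglongrightarrow> 0" if "\<And>k. 0 \<le> X k" "\<And>k. X k < e k" for X
    by (rule tendsto_sandwich[OF _ _ tendsto_const e0])
      (use that in \<open>auto intro!: always_eventually intro: less_imp_le\<close>)
  have "(\<lambda>k. W1p_norm p \<Omega> (\<lambda>x. v k x - u x)) \<longlonglongrightarrow> 0"
    by (rule squeeze[OF _ n1]) (simp add: W1p_norm_def Lp_norm_nonneg add_nonneg_nonneg)
  moreover have "(\<lambda>k. Lp_norm 1 \<Omega> (\<lambda>x. integrand L \<Omega> (v k) x - integrand L \<Omega> u x)) \<longlonglongrightarrow> 0"
    by (rule squeeze[OF Lp_norm_nonneg n2])
  ultimately show "Linf_regular_at p \<Omega> \<phi> L u"
    unfolding Linf_regular_at_def using adm by blast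
qed

end
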